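(* Let $(a_\nu)_{\nu\in\mathbf Z}$ be complex numbers such that $|a_\nu|\le C\,m(\nu)$ for all $\nu\in\mathbf Z$ and some constant $C>0$, where $m:\mathbf Z\to\,]0,+\infty[$ satisfies $\sum_{\nu\in\mathbf Z}(1+|\nu|)m(\nu)<\infty$ and $m(-\nu)=m(\nu)$ for all $\nu$. Let $p(\zeta)=\sum_{\nu\in\mathbf Z}a_\nu\zeta^\nu$, $\zeta\in S^1$. Let $P_N=(a_{j-k})_{0\le j,k<N}$ be the associated $N\times N$ Toeplitz matrix, let $Q_\omega=Q_\omega(N)$ be an $N\times N$ random matrix whose entries are independent complex Gaussian random variables of law $\mathcal N_{\mathbf C}(0,1)$, and put $P_N^\delta=P_N+\delta Q_\omega$. Let $$\xi_N=\frac1N\sum_{\lambda\in\mathrm{Spec}(P_N^\delta)}\delta_\lambda$$ be the empirical measure of eigenvalues of $P_N^\delta$, eigenvalues being counted with multiplicity. Let $\delta_0\in\,]0,1[$ and $\delta_1>3/2$. If $\delta=\delta(N)$ satisfies $$e^{-N^{\delta_0}}\le\delta\ll N^{-\delta_1},$$ then, almost surely, $$\xi_N\rightharpoonup p_*\Big(\frac1{2\pi}L_{S^1}\Big),\qquad N\to\infty,$$ weakly.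
   Context: The law $\mathcal N_{\mathbf C}(0,1)$ is $\pi^{-1}e^{-|\alpha|^2}L(d\alpha)$, with $L$ the Lebesgue measure on $\mathbf C$. The random matrices $Q_\omega(N)$, $N\ge1$, are defined on a common probability space. $\delta_\lambda$ is the Dirac measure at $\lambda\in\mathbf C$ (not to be confused with the coupling constant $\delta$ or the exponents $\delta_0,\delta_1$). $L_{S^1}$ is the Lebesgue (arc length) measure on the unit circle $S^1$, of total mass $2\pi$, and $p_*$ denotes push-forward under $p:S^1\to\mathbf C$. $A\ll B$ means $A\le cB$ with a sufficiently small constant $c>0$ independent of $N$. Weak convergence is convergence of integrals against bounded continuous functions. *)

theory Defs
  imports
    "HOL-Probability.Probability"
    "Jordan_Normal_Form.Matrix"
    "Jordan_Normal_Form.Char_Poly"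
    "Jordan_Normal_Form.Spectral_Radius"
begin

definition toeplitz_mat :: "(int \<Rightarrow> complex) \<Rightarrow> nat \<Rightarrow> complex mat" where
  "toeplitz_mat a N = mat N N (\<lambda>(j, k). a (int j - int k))"

text \<open>The unordered sum is absolutely convergent for the coefficients considered here;
  only the values on the unit circle matter.\<close>

definition symbol :: "(int \<Rightarrow> complex) \<Rightarrow> complex \<Rightarrow> complex" where
  "symbol a \<zeta> = (\<Sum>\<^sub>\<infinity>\<nu>\<in>UNIV. a \<nu> * \<zeta> powi \<nu>)"

definition std_complex_normal :: "complex measure" where
  "std_complex_normal = density lborel (\<lambda>\<alpha>. ennreal (exp (- (cmod \<alpha>)\<^sup>2) / pi))"

definition complex_gaussian_matrix :: "'w measure \<Rightarrow> nat \<Rightarrow> ('w \<Rightarrow> complex mat) \<Rightarrow> bool" where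
  "complex_gaussian_matrix M N Q \<longleftrightarrow>
     (\<forall>\<omega>\<in>space M. Q \<omega> \<in> carrier_mat N N) \<and>
     prob_space.indep_vars M (\<lambda>_. borel) (\<lambda>(i, j) \<omega>. Q \<omega> $$ (i, j)) ({..<N} \<times> {..<N}) \<and>
     (\<forall>i<N. \<forall>j<N. distr M borel (\<lambda>\<omega>. Q \<omega> $$ (i, j)) = std_complex_normal)"

text \<open>Eigenvalues are counted with algebraic multiplicity, i.e. their order as zeros of the
  characteristic polynomial; \<^term>\<open>return borel z\<close> is the Dirac measure at \<open>z\<close>.\<close>

definition empirical_measure :: "complex mat \<Rightarrow> complex measure" where
  "empirical_measure A = measure_of UNIV (sets borel)
     (\<lambda>B. ennreal (1 / real (dim_row A)) *
        (\<Sum>z\<in>spectrum A. of_nat (Polynomial.order z (char_poly A)) * emeasure (return borel z) B))"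

lemma sets_empirical_measure [simp, measurable_cong]: "sets (empirical_measure A) = sets borel"
  unfolding empirical_measure_def using sets.sigma_sets_eq[of "borel :: complex measure"] by simp

lemma emeasure_empirical_measure:
  assumes "B \<in> sets borel"
  shows "emeasure (empirical_measure A) B = ennreal (1 / real (dim_row A)) *
        (\<Sum>z\<in>spectrum A. of_nat (Polynomial.order z (char_poly A)) * indicator B z)"
proof -
  let ?\<mu> = "\<lambda>B. ennreal (1 / real (dim_row A)) *
        (\<Sum>z\<in>spectrum A. of_nat (Polynomial.order z (char_poly A)) * emeasure (return borel z) B)"
  have "countably_additive (sets borel) ?\<mu>"
  proof (rule countably_additiveI)
    fix F :: "nat \<Rightarrow> complex set"
    assume F: "range F \<subseteq> sets borel" "disjoint_family F"
    have *: "(\<Sum>i. emeasure (return borel z) (F i)) = emeasure (return borel z) (\<Union>i. F i)" for z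
      using F by (intro suminf_emeasure) auto
    have "(\<Sum>i. ?\<mu> (F i)) = ennreal (1 / real (dim_row A)) *
        (\<Sum>i. \<Sum>z\<in>spectrum A. of_nat (Polynomial.order z (char_poly A)) * emeasure (return borel z) (F i))"
      by (rule ennreal_suminf_cmult)
    also have "(\<Sum>i. \<Sum>z\<in>spectrum A. of_nat (Polynomial.order z (char_poly A)) * emeasure (return borel z) (F i)) =
        (\<Sum>z\<in>spectrum A. \<Sum>i. of_nat (Polynomial.order z (char_poly A)) * emeasure (return borel z) (F i))"
      by (rule suminf_sum) (rule summableI)
    also have "\<dots> = (\<Sum>z\<in>spectrum A. of_nat (Polynomial.order z (char_poly A)) *
        emeasure (return borel z) (\<Union>i. F i))"
      by (simp only: ennreal_suminf_cmult *)
    finally show "(\<Sum>i. ?\<mu> (F i)) = ?\<mu> (\<Union>i. F i)" .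
  qed
  moreover have "positive (sets borel) ?\<mu>"
    by (simp add: positive_def)
  ultimately have "emeasure (empirical_measure A) B = ?\<mu> B"
    using assms by (intro emeasure_measure_of[OF empirical_measure_def])
      (simp_all only: sets_empirical_measure, simp_all)
  then show ?thesis
    using assms by simp
qed

text \<open>Arc length on the unit circle, as a measure on the circle itself: the image of the
  Lebesgue measure on \<open>[0, 2\<pi>)\<close> under \<open>\<theta> \<mapsto> e\<^sup>i\<^sup>\<theta>\<close>.\<close>

definition circle_measure :: "complex measure" where
  "circle_measure = distr (restrict_space lborel {0..<2 * pi})
     (restrict_space borel (sphere 0 1)) cis"

definition weakly_converges :: "(nat \<Rightarrow> 'a::topological_space measure) \<Rightarrow> 'a measure \<Rightarrow> bool" where
  "weakly_converges \<mu> \<nu> \<longleftrightarrow>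
     (\<forall>f :: 'a \<Rightarrow> real. continuous_on UNIV f \<longrightarrow> bounded (range f) \<longrightarrow>
        (\<lambda>N. \<integral>x. f x \<partial>\<mu> N) \<longlonglongrightarrow> (\<integral>x. f x \<partial>\<nu>))"

end

theory Submission
  imports Defs "HOL-Complex_Analysis.Complex_Analysis" "HOL-Real_Asymp.Real_Asymp"
begin

text \<open>The circulant matrix \<open>A\<close> with eigenvalues \<open>p(\<omega>)\<close>, \<open>\<omega>\<^sup>N = 1\<close>, differs from the Toeplitz matrix
  by a matrix \<open>R\<close> whose entries have absolute sum at most \<open>K = \<Sum> |\<nu>| |a\<^sub>\<nu>|\<close>. For \<open>z\<close> off the
  curve \<open>p(S\<^sup>1)\<close>, at distance \<open>d\<close>, Hadamard's inequality in the Fourier basis gives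
  \<open>|det(A - z + W)| \<le> |det(A - z)| exp(\<Sum>\<^sub>k |W e\<^sub>k| / d)\<close>. With \<open>W = R + \<delta> Q\<close> and
  \<open>\<delta> \<le> N powr (- 3/2 - \<epsilon>)\<close> the exponent is bounded, which is the upper bound for the determinant.
  For the lower bound, \<open>w \<mapsto> det(A - z + \<delta> Q + w R)\<close> has, by the same estimate, boundedly many
  zeros near \<open>w = 1\<close>, and translating \<open>Q\<close> by small multiples of \<open>R\<close>, which distorts the Gaussian law
  only by a bounded factor, moves \<open>w\<close> away from them. So \<open>log |det|\<close> changes by \<open>o(N)\<close> for almost
  every \<open>z\<close>, and convergence of logarithmic potentials yields that the eigenvalues of the perturbed
  Toeplitz matrix and of \<open>A\<close> have the same limit distribution; for \<open>A\<close> the limit is that of a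
  Riemann sum.\<close>

section \<open>Hadamard's inequality\<close>

text \<open>The obstacle is that \<open>R\<close> is bounded but not small. Without noise det(A - z
  + R) can be exponentially smaller than det(A - z), as for a Jordan block and z inside the unit
  circle, so the lower bound has to come from the noise, tiny as it is. At w = 0 the noise does no
  harm: the column norms of \<delta> Q add up to at most \<delta> N^(3/2) times the largest entry,
  which tends to 0, and |det(A - z + \<delta> Q)| stays above half of |det(A - z)|. From there a
  polynomial in the single variable w leads to w = 1, and a Jensen type count bounds its zeros by
  some n independent of N. Each zero costs a factor \<delta> / (2 N^3) at worst, so the logarithm
  loses about n (N^\<open>\<delta>\<^sub>0\<close> + 3 log N), which is o(N) because
  \<open>\<delta>\<^sub>0\<close> < 1. The powers of N are tuned as follows: N^2 translates give a
  failure probability O(N^-2), summable for Borel-Cantelli, and steps of 1/N^3 keep every translate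
  within \<open>R\<close> / N, so that the Gaussian density changes by a bounded factor where the
  entries are at most N.\<close>

lemma orthogonalize_columns:
  fixes M :: "complex mat"
  assumes M: "M \<in> carrier_mat n n" and "k \<le> n"
  shows "\<exists>M'\<in>carrier_mat n n. det M' = det M \<and>
    (\<forall>i<k. \<forall>j<k. i \<noteq> j \<longrightarrow> (\<Sum>r<n. cnj (M' $$ (r,i)) * M' $$ (r,j)) = 0) \<and>
    (\<forall>j<n. (\<Sum>r<n. (cmod (M' $$ (r,j)))\<^sup>2) \<le> (\<Sum>r<n. (cmod (M $$ (r,j)))\<^sup>2))"
  using \<open>k \<le> n\<close>
proof (induction k)
  case 0
  then show ?case using M by (intro bexI[of _ M]) auto
next
  case (Suc k)
  then have k: "k < n" by simp
  obtain A where A: "A \<in> carrier_mat n n" and dA: "det A = det M"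
    and ortho: "\<And>i j. i < k \<Longrightarrow> j < k \<Longrightarrow> i \<noteq> j \<Longrightarrow> (\<Sum>r<n. cnj (A $$ (r,i)) * A $$ (r,j)) = 0"
    and le: "\<And>j. j < n \<Longrightarrow> (\<Sum>r<n. (cmod (A $$ (r,j)))\<^sup>2) \<le> (\<Sum>r<n. (cmod (M $$ (r,j)))\<^sup>2)"
    using Suc by (auto simp: less_imp_le)
  \<comment> \<open>Unnormalised Gram-Schmidt: \<open>c i\<close> is the coefficient of the
    projection of column \<open>k\<close> on column \<open>i\<close>. If column \<open>i\<close> is
    zero the quotient is 0 by convention, and the inner product it has to reproduce is 0
    too.\<close>
  define c where "c i = (\<Sum>r<n. cnj (A $$ (r,i)) * A $$ (r,k)) /
    complex_of_real (\<Sum>r<n. (cmod (A $$ (r,i)))\<^sup>2)" for i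
  define s where "s r = (\<Sum>i<k. c i * A $$ (r,i))" for r
  define w where "w r = A $$ (r,k) - s r" for r
  define B where "B = mat n n (\<lambda>(r,j). if j = k then w r else A $$ (r,j))"
  \<comment> \<open>Subtracting the projections is right multiplication by a unit upper triangular
    matrix, so the determinant does not change.\<close>
  define T where "T = mat n n (\<lambda>(i,j). if i = j then 1 else if j = k \<and> i < k then - c i else 0)"
  have B: "B \<in> carrier_mat n n" and T: "T \<in> carrier_mat n n"
    by (auto simp: B_def T_def)
  have "B = A * T"
  proof (rule eq_matI)
    fix r j assume "r < dim_row (A * T)" "j < dim_col (A * T)"
    then have rj: "r < n" "j < n" using A T by auto
    have "(A * T) $$ (r, j) = (\<Sum>i<n. A $$ (r,i) * T $$ (i,j))"
      using rj A T by (simp add: scalar_prod_def atLeast0LessThan)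
    also have "\<dots> = B $$ (r, j)"
    proof (cases "j = k")
      case False
      have "(\<Sum>i<n. A $$ (r,i) * T $$ (i,j)) = (\<Sum>i<n. if i = j then A $$ (r,j) else 0)"
        using False rj by (intro sum.cong) (auto simp: T_def)
      then show ?thesis using False rj by (simp add: B_def)
    next
      case True
      have "(\<Sum>i<n. A $$ (r,i) * T $$ (i,j)) =
          (\<Sum>i<n. (if i = k then A $$ (r,k) else 0) - (if i < k then c i * A $$ (r,i) else 0))"
        using True rj by (intro sum.cong) (auto simp: T_def)
      also have "\<dots> = A $$ (r,k) - (\<Sum>i<n. (if i < k then c i * A $$ (r,i) else 0))"
        using k by (simp add: sum_subtractf)
      also have "(\<Sum>i<n. (if i < k then c i * A $$ (r,i) else 0)) = s r"
        unfolding s_def using k by (intro sum.mono_neutral_cong_right) auto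
      finally show ?thesis using True rj by (simp add: B_def w_def)
    qed
    finally show "B $$ (r,j) = (A * T) $$ (r,j)" by simp
  qed (use A B T in auto)
  moreover have "det T = 1"
  proof -
    have "upper_triangular T" using T by (auto simp: upper_triangular_def T_def)
    then have "det T = (\<Prod>i<n. T $$ (i,i))"
      using det_upper_triangular[OF _ T] T by (simp add: prod_list_diag_prod atLeast0LessThan)
    then show ?thesis by (simp add: T_def)
  qed
  ultimately have dB: "det B = det M" using det_mult[OF A T] dA by simp
  have ip0: "(\<Sum>r<n. cnj (A $$ (r,i)) * w r) = 0" if i: "i < k" for i
  proof -
    let ?g = "\<Sum>r<n. (cmod (A $$ (r,i)))\<^sup>2"
    have gi: "(\<Sum>r<n. cnj (A $$ (r,i)) * A $$ (r,i)) = complex_of_real ?g"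
      by (simp add: complex_norm_square mult.commute del: of_real_power)
    have "(\<Sum>r<n. cnj (A $$ (r,i)) * s r) = (\<Sum>l<k. c l * (\<Sum>r<n. cnj (A $$ (r,i)) * A $$ (r,l)))"
      unfolding s_def sum_distrib_left by (subst sum.swap) (simp add: mult_ac)
    also have "\<dots> = (\<Sum>l<k. if l = i then c i * complex_of_real ?g else 0)"
      using ortho i gi by (intro sum.cong) auto
    also have "\<dots> = c i * complex_of_real ?g" using i by simp
    also have "\<dots> = (\<Sum>r<n. cnj (A $$ (r,i)) * A $$ (r,k))"
    proof (cases "?g = 0")
      case True
      then have "\<forall>r\<in>{..<n}. (cmod (A $$ (r,i)))\<^sup>2 = 0"
        by (subst (asm) sum_nonneg_eq_0_iff) auto
      then show ?thesis using True by simp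
    next
      case False
      then have "complex_of_real ?g \<noteq> 0" using of_real_eq_0_iff by blast
      then show ?thesis by (simp add: c_def del: of_real_sum)
    qed
    finally show ?thesis by (simp add: w_def right_diff_distrib sum_subtractf)
  qed
  have ip0': "(\<Sum>r<n. cnj (w r) * A $$ (r,i)) = 0" if i: "i < k" for i
    using arg_cong[OF ip0[OF i], of cnj] by (simp add: mult.commute)
  have sw: "(\<Sum>r<n. cnj (s r) * w r) = 0"
  proof -
    have "(\<Sum>r<n. cnj (s r) * w r) = (\<Sum>l<k. cnj (c l) * (\<Sum>r<n. cnj (A $$ (r,l)) * w r))"
      unfolding s_def cnj_sum sum_distrib_left sum_distrib_right by (subst sum.swap) (simp add: mult_ac)
    then show ?thesis using ip0 by simp
  qed
  \<comment> \<open>Pythagoras: \<open>w\<close> is orthogonal to the removed part \<open>s\<close>,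
    so column \<open>k\<close> can only become shorter.\<close>
  have wle: "(\<Sum>r<n. (cmod (w r))\<^sup>2) \<le> (\<Sum>r<n. (cmod (A $$ (r,k)))\<^sup>2)"
  proof -
    have "(cmod (A $$ (r,k)))\<^sup>2 = (cmod (w r))\<^sup>2 + (cmod (s r))\<^sup>2 + 2 * Re (cnj (s r) * w r)" for r
      unfolding w_def by (simp only: cmod_power2) (simp add: power2_eq_square algebra_simps)
    then have "(\<Sum>r<n. (cmod (A $$ (r,k)))\<^sup>2) =
        (\<Sum>r<n. (cmod (w r))\<^sup>2) + (\<Sum>r<n. (cmod (s r))\<^sup>2) + 2 * Re (\<Sum>r<n. cnj (s r) * w r)"
      by (simp add: sum.distrib sum_distrib_left)
    then show ?thesis using sw by (simp add: sum_nonneg)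
  qed
  have "(\<Sum>r<n. cnj (B $$ (r,i)) * B $$ (r,j)) = 0" if "i < Suc k" "j < Suc k" "i \<noteq> j" for i j
    using that k ip0 ip0' ortho by (auto simp: B_def less_Suc_eq)
  moreover have "(\<Sum>r<n. (cmod (B $$ (r,j)))\<^sup>2) \<le> (\<Sum>r<n. (cmod (M $$ (r,j)))\<^sup>2)" if "j < n" for j
    using that wle le[OF that] by (cases "j = k") (auto simp: B_def)
  ultimately show ?case using B dB by blast
qed

lemma det_map_cnj:
  fixes A :: "complex mat"
  assumes A: "A \<in> carrier_mat n n"
  shows "det (map_mat cnj A) = cnj (det A)"
proof -
  have cA: "map_mat cnj A \<in> carrier_mat n n" using A by auto
  show ?thesis
    unfolding det_def'[OF A] det_def'[OF cA] cnj_sum complex_cnj_mult cnj_prod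
    using A by (intro sum.cong refl arg_cong2[of _ _ _ _ "(*)"] prod.cong)
      (auto simp: sign_def permutes_in_image[of _ "{0..<n}", unfolded atLeastLessThan_iff, simplified])
qed

text \<open>For orthogonal columns the Gram matrix is diagonal with the squared column lengths on
  the diagonal, and its determinant is |det|^2. The general case follows because orthogonalisation
  keeps the determinant and lengthens no column.\<close>

lemma hadamard_det_le:
  fixes M :: "complex mat"
  assumes M: "M \<in> carrier_mat n n"
  shows "cmod (det M) \<le> (\<Prod>j<n. sqrt (\<Sum>r<n. (cmod (M $$ (r,j)))\<^sup>2))"
proof -
  obtain A where A: "A \<in> carrier_mat n n" and dA: "det A = det M"
    and ortho: "\<And>i j. i < n \<Longrightarrow> j < n \<Longrightarrow> i \<noteq> j \<Longrightarrow> (\<Sum>r<n. cnj (A $$ (r,i)) * A $$ (r,j)) = 0"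
    and le: "\<And>j. j < n \<Longrightarrow> (\<Sum>r<n. (cmod (A $$ (r,j)))\<^sup>2) \<le> (\<Sum>r<n. (cmod (M $$ (r,j)))\<^sup>2)"
    using orthogonalize_columns[OF M order_refl] by auto
  define H where "H = mat n n (\<lambda>(i,j). cnj (A $$ (j,i)))"
  have H: "H \<in> carrier_mat n n" by (simp add: H_def)
  have Ht: "H = transpose_mat (map_mat cnj A)" using A by (auto simp: H_def)
  have cA: "map_mat cnj A \<in> carrier_mat n n" using A by auto
  have dH: "det H = cnj (det A)" unfolding Ht det_transpose[OF cA] by (rule det_map_cnj[OF A])
  have entry: "(H * A) $$ (i,j) = (\<Sum>r<n. cnj (A $$ (r,i)) * A $$ (r,j))" if "i < n" "j < n" for i j
    using that A H by (simp add: scalar_prod_def atLeast0LessThan H_def)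
  have HA: "H * A \<in> carrier_mat n n" using H A by simp
  have "upper_triangular (H * A)"
    using HA A H entry ortho by (auto simp: upper_triangular_def simp del: index_mult_mat(1))
  then have "det (H * A) = (\<Prod>i<n. (H * A) $$ (i,i))"
    using det_upper_triangular[OF _ HA] HA H by (simp add: prod_list_diag_prod atLeast0LessThan)
  also have "\<dots> = (\<Prod>i<n. complex_of_real (\<Sum>r<n. (cmod (A $$ (r,i)))\<^sup>2))"
    by (intro prod.cong refl, subst entry)
      (auto simp: complex_norm_square mult.commute simp del: of_real_power)
  finally have "cnj (det A) * det A = complex_of_real (\<Prod>i<n. \<Sum>r<n. (cmod (A $$ (r,i)))\<^sup>2)"
    using det_mult[OF H A] dH by simp
  then have "complex_of_real ((cmod (det A))\<^sup>2) = complex_of_real (\<Prod>i<n. \<Sum>r<n. (cmod (A $$ (r,i)))\<^sup>2)"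
    by (simp only: complex_norm_square mult.commute)
  then have "(cmod (det A))\<^sup>2 = (\<Prod>i<n. \<Sum>r<n. (cmod (A $$ (r,i)))\<^sup>2)"
    by (rule of_real_eq_iff[THEN iffD1])
  also have "\<dots> \<le> (\<Prod>i<n. \<Sum>r<n. (cmod (M $$ (r,i)))\<^sup>2)"
    using le by (intro prod_mono) (auto intro: sum_nonneg)
  also have "\<dots> = (\<Prod>j<n. sqrt (\<Sum>r<n. (cmod (M $$ (r,j)))\<^sup>2))\<^sup>2"
    by (simp add: prod_power_distrib sum_nonneg)
  finally show ?thesis unfolding dA
    by (rule power2_le_imp_le) (simp add: prod_nonneg sum_nonneg)
qed

section \<open>Lower bounds for polynomials with few zeros\<close>

text \<open>Re f < m says that f is closer to 0 than to 2 m, so f / (2 m - f) maps the disc into the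
  unit disc and fixes 0. The Schwarz lemma bounds it by 1/2 on the disc of half the radius, and
  solving for f gives 2 m.\<close>

lemma borel_caratheodory:
  fixes f :: "complex \<Rightarrow> complex"
  assumes hol: "f holomorphic_on ball 0 (2 * r)" and r: "0 < r" and f0: "f 0 = 0"
    and m: "0 < m" and Re: "\<And>z. cmod z < 2 * r \<Longrightarrow> Re (f z) < m" and z: "cmod z \<le> r"
  shows "cmod (f z) \<le> 2 * m"
proof -
  define g where "g \<xi> = f (of_real (2 * r) * \<xi>)" for \<xi>
  define \<phi> where "\<phi> \<xi> = g \<xi> / (of_real (2 * m) - g \<xi>)" for \<xi>
  have in_ball: "cmod (of_real (2 * r) * \<xi>) < 2 * r" if "cmod \<xi> < 1" for \<xi>
    using that r by (simp add: norm_mult)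
  have Reg: "Re (g \<xi>) < m" if "cmod \<xi> < 1" for \<xi>
    unfolding g_def using Re[OF in_ball[OF that]] .
  have ne: "of_real (2 * m) - g \<xi> \<noteq> 0" if "cmod \<xi> < 1" for \<xi>
  proof
    assume "of_real (2 * m) - g \<xi> = 0"
    then have "2 * m = Re (g \<xi>)"
      by (metis Re_complex_of_real eq_iff_diff_eq_0)
    then show False using Reg[OF that] m by simp
  qed
  have lt: "cmod (g \<xi>) < cmod (of_real (2 * m) - g \<xi>)" if "cmod \<xi> < 1" for \<xi>
  proof -
    have "(cmod (of_real (2 * m) - g \<xi>))\<^sup>2 - (cmod (g \<xi>))\<^sup>2 = 4 * m * (m - Re (g \<xi>))"
      by (simp only: cmod_power2) (simp add: power2_eq_square algebra_simps)
    also have "\<dots> > 0" using Reg[OF that] m by simp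
    finally show ?thesis by (simp add: power2_less_imp_less)
  qed
  have g_hol: "g holomorphic_on ball 0 1"
    unfolding g_def
    by (rule holomorphic_on_compose_gen[of "\<lambda>\<xi>. of_real (2*r) * \<xi>" _ f "ball 0 (2*r)", unfolded comp_def])
      (use hol in_ball in \<open>auto intro!: holomorphic_intros\<close>)
  have hol\<phi>: "\<phi> holomorphic_on ball 0 1"
    unfolding \<phi>_def using ne g_hol by (intro holomorphic_intros) auto
  have "\<phi> 0 = 0" using f0 by (simp add: \<phi>_def g_def)
  moreover have "cmod (\<phi> \<xi>) < 1" if "cmod \<xi> < 1" for \<xi>
    using lt[OF that] by (simp add: \<phi>_def norm_divide divide_less_eq)
  moreover define \<xi> where "\<xi> = z / of_real (2 * r)"
  have \<xi>: "cmod \<xi> \<le> 1 / 2" using z r by (simp add: \<xi>_def norm_divide divide_le_eq)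
  ultimately have "cmod (\<phi> \<xi>) \<le> cmod \<xi>"
    using Schwarz_Lemma(1)[OF hol\<phi>] by auto
  then have "cmod (\<phi> \<xi>) \<le> 1 / 2" using \<xi> by simp
  moreover have "g \<xi> = f z" using r by (simp add: g_def \<xi>_def)
  moreover have "cmod (of_real (2 * m) - f z) > 0"
    using ne[of \<xi>] \<xi> \<open>g \<xi> = f z\<close> by simp
  ultimately have "cmod (f z) \<le> 1 / 2 * cmod (of_real (2 * m) - f z)"
    by (simp add: \<phi>_def norm_divide divide_le_eq)
  also have "cmod (of_real (2 * m) - f z) \<le> 2 * m + cmod (f z)"
    using norm_triangle_ineq4[of "of_real (2*m)" "f z"] m by (simp add: norm_mult)
  finally show ?thesis by simp
qed

text \<open>An upper bound on growth alone yields a lower bound: on |t| < 2 the real part of g - 1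
  stays below exp(1/8) - 1 < 1/4, so Borel-Caratheodory gives |g(1) - 1| \<le> 1/2. This is the
  origin of the constant 1/16 used for perturbations below.\<close>

lemma holomorphic_one_near_one:
  assumes hol: "g holomorphic_on UNIV" and "g 0 = 1"
    and le: "\<And>t. cmod (g t) \<le> exp (\<rho> * cmod t)" and "\<rho> \<le> 1 / 16" "0 \<le> \<rho>"
  shows "cmod (g 1) \<ge> 1 / 2"
proof -
  have Re: "Re (g t - 1) < 1/4" if "cmod t < 2 * 1" for t
  proof -
    have "Re (g t) \<le> exp (\<rho> * cmod t)" using le[of t] complex_Re_le_cmod order_trans by blast
    also have "\<dots> \<le> exp (1 / 16 * 2)"
      using that assms by (intro exp_mono mult_mono) auto
    also have "\<dots> \<le> 1 + 1/8 + (1/8)\<^sup>2" using exp_bound[of "1/8"] by simp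
    also have "\<dots> < 1 + 1/4" by (simp add: power2_eq_square)
    finally show ?thesis by simp
  qed
  have "cmod (g 1 - 1) \<le> 2 * (1/4)"
    by (rule borel_caratheodory[where r = 1, OF _ _ _ _ Re])
      (use assms in \<open>auto intro!: holomorphic_intros intro: holomorphic_on_subset\<close>)
  then show ?thesis
    using norm_triangle_ineq4[of "g 1" "g 1 - 1"] by simp
qed

lemma poly_factor_roots_in_disc:
  fixes p :: "complex poly"
  assumes "p \<noteq> 0"
  shows "\<exists>q ws. p = q * prod_list (map (\<lambda>v. [:- v, 1:]) ws) \<and> (\<forall>v\<in>set ws. cmod v \<le> R) \<and>
    (\<forall>w. cmod w \<le> R \<longrightarrow> poly q w \<noteq> 0)"
  using assms
proof (induction "degree p" arbitrary: p rule: less_induct)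
  case less
  show ?case
  proof (cases "\<exists>v. cmod v \<le> R \<and> poly p v = 0")
    case False
    then show ?thesis by (intro exI[of _ p] exI[of _ "[]"]) auto
  next
    case True
    then obtain v where v: "cmod v \<le> R" "poly p v = 0" by blast
    then obtain p' where p': "p = [:- v, 1:] * p'" by (auto simp: poly_eq_0_iff_dvd)
    with less.prems have "p' \<noteq> 0" by auto
    moreover have "degree p' < degree p" using \<open>p' \<noteq> 0\<close> unfolding p' by (subst degree_mult_eq) auto
    ultimately obtain q ws where "p' = q * prod_list (map (\<lambda>v. [:- v, 1:]) ws)"
      "\<forall>v\<in>set ws. cmod v \<le> R" "\<forall>w. cmod w \<le> R \<longrightarrow> poly q w \<noteq> 0"
      using less.hyps by blast
    then show ?thesis using v p'
      by (intro exI[of _ q] exI[of _ "v # ws"]) (auto simp: mult_ac)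
  qed
qed

text \<open>Dividing out the zeros in |w| \<le> 4 leaves q, zero-free on that disc. A factor |w - v|
  is at least 8 on |w| = 12 and at most 4 at w = 0, so the maximum principle for q bounds the number
  of zeros. A holomorphic logarithm of q and Borel-Caratheodory, from radius 4 to radius 2, then
  bound q from below.\<close>

lemma poly_lower_bound_by_roots:
  fixes f :: "complex poly"
  assumes f0: "cmod (poly f 0) \<ge> 1 / 2" and le: "\<And>w. cmod w \<le> 12 \<Longrightarrow> cmod (poly f w) \<le> exp M"
  obtains ws where "2 ^ length ws \<le> 2 * exp M"
    and "\<And>w. cmod w \<le> 2 \<Longrightarrow> exp (- 4 * M - 2) / 8 * prod_list (map (\<lambda>v. cmod (w - v)) ws) \<le> cmod (poly f w)"
proof -
  have "f \<noteq> 0" using f0 by auto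
  then obtain q ws where f: "f = q * prod_list (map (\<lambda>v. [:- v, 1:]) ws)"
    and ws: "\<forall>v\<in>set ws. cmod v \<le> 4" and q: "\<And>w. cmod w \<le> 4 \<Longrightarrow> poly q w \<noteq> 0"
    using poly_factor_roots_in_disc[of f 4] by blast
  define n where "n = length ws"
  have pf: "cmod (poly f w) = cmod (poly q w) * prod_list (map (\<lambda>v. cmod (w - v)) ws)" for w
  proof -
    have "cmod (poly (prod_list (map (\<lambda>v. [:- v, 1:]) us)) w) = prod_list (map (\<lambda>v. cmod (w - v)) us)" for us
    proof (induction us)
      case (Cons v us)
      have "poly [:- v, 1:] w = w - v" by simp
      then show ?case using Cons by (simp only: list.map prod_list.Cons poly_mult norm_mult)
    qed simp
    then show ?thesis unfolding f poly_mult norm_mult by simp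
  qed
  have lower: "8 ^ length us \<le> prod_list (map (\<lambda>v. cmod (w - v)) us)"
    if "cmod w = 12" "\<forall>v\<in>set us. cmod v \<le> 4" for w us
    using that(2)
  proof (induction us)
    case (Cons v us)
    have "8 \<le> cmod (w - v)" using norm_triangle_ineq2[of w v] that(1) Cons.prems by simp
    then show ?case using Cons by (auto intro!: mult_mono)
  qed auto
  have upper: "prod_list (map (\<lambda>v. cmod (0 - v)) us) \<le> 4 ^ length us"
    if "\<forall>v\<in>set us. cmod v \<le> 4" for us
    using that by (induction us) (auto intro!: mult_mono prod_list_nonneg)
  have qsphere: "cmod (poly q w) \<le> exp M / 8 ^ n" if "cmod w = 12" for w
  proof -
    have "cmod (poly q w) * 8 ^ n \<le> cmod (poly f w)"
      unfolding pf n_def using lower[OF that ws] by (intro mult_left_mono) auto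
    also have "\<dots> \<le> exp M" using le that by simp
    finally show ?thesis by (simp add: field_simps)
  qed
  have qle: "cmod (poly q w) \<le> exp M / 8 ^ n" if "cmod w \<le> 12" for w
    by (rule maximum_modulus_frontier[of "poly q" "cball 0 12"])
      (use that qsphere in \<open>auto intro!: holomorphic_intros continuous_intros\<close>)
  have "cmod (poly f 0) \<le> cmod (poly q 0) * 4 ^ n"
    unfolding pf n_def using upper[OF ws] by (intro mult_left_mono) auto
  then have q0: "cmod (poly q 0) \<ge> 1 / 2 / 4 ^ n"
    using f0 by (simp add: field_simps)
  have "1 / 2 / 4 ^ n \<le> exp M / 8 ^ n" using q0 qle[of 0] by simp
  then have "8 ^ n / 4 ^ n \<le> 2 * exp M" by (simp add: field_simps)
  moreover have "(8 ^ n / 4 ^ n :: real) = 2 ^ n" by (simp flip: power_divide)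
  ultimately have n: "2 ^ n \<le> 2 * exp M" by simp
  \<comment> \<open>M may be negative: 1 \<le> 2^n \<le> 2 exp M only forces M \<ge> - ln 2.
    Borel-Caratheodory asks for a strictly positive bound, which M + 1 is.\<close>
  have M: "M + 1 > 0"
  proof -
    have "1 \<le> 2 * exp M" using n one_le_power[of "2::real" n] by linarith
    moreover have "exp 1 \<ge> (5/2 :: real)" using exp_lower_Taylor_quadratic[of "1::real"] by simp
    ultimately have "(1/2) * (5/2) \<le> exp M * exp 1" by (intro mult_mono) auto
    then have "exp 0 < exp (M + 1)" by (simp add: exp_add)
    then show ?thesis by simp
  qed
  have "poly q holomorphic_on ball 0 4" by (intro holomorphic_intros)
  moreover have "contractible (ball (0::complex) 4)" by (simp add: convex_imp_contractible)
  ultimately obtain h where h: "h holomorphic_on ball 0 4" "\<And>z. z \<in> ball 0 4 \<Longrightarrow> poly q z = exp (h z)"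
    using contractible_imp_holomorphic_log[of "poly q" "ball 0 4"] q
    by (metis less_imp_le mem_ball_0)
  have ReF: "Re (h z - h 0) < M + 1" if "cmod z < 2 * 2" for z
  proof -
    have "exp (Re (h z)) \<le> exp M / 8 ^ n"
      using h(2)[of z] qle[of z] that by simp
    moreover have "exp (Re (h 0)) \<ge> 1 / 2 / 4 ^ n"
      using h(2)[of 0] q0 by simp
    ultimately have "exp (Re (h z)) * (1 / 2 / 4 ^ n) \<le> exp M / 8 ^ n * exp (Re (h 0))"
      by (intro mult_mono) auto
    then have "exp (Re (h z)) * (8 ^ n / 4 ^ n) \<le> 2 * exp M * exp (Re (h 0))"
      by (simp add: field_simps)
    moreover have "exp (Re (h z)) * 1 \<le> exp (Re (h z)) * (8 ^ n / 4 ^ n)"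
      by (intro mult_left_mono) (auto simp: field_simps intro!: power_mono)
    ultimately have "exp (Re (h z)) \<le> 2 * exp (M + Re (h 0))" by (simp add: exp_add)
    also have "\<dots> < exp 1 * exp (M + Re (h 0))"
      using exp_lower_Taylor_quadratic[of 1] by (intro mult_strict_right_mono) auto
    also have "\<dots> = exp (M + 1 + Re (h 0))" by (simp add: exp_add)
    finally show ?thesis by simp
  qed
  have qlow: "exp (- 4 * M - 2) / 8 \<le> cmod (poly q w)" if "cmod w \<le> 2" for w
  proof -
    have "cmod (h w - h 0) \<le> 2 * (M + 1)"
      by (rule borel_caratheodory[where r = 2, OF _ _ _ M ReF])
        (use that h(1) in \<open>auto intro!: holomorphic_intros\<close>)
    then have "Re (h w) \<ge> Re (h 0) - 2 * (M + 1)"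
      using abs_Re_le_cmod[of "h w - h 0"] by simp
    then have "exp (Re (h 0) - 2 * (M + 1)) \<le> exp (Re (h w))" by simp
    then have "exp (Re (h 0)) * exp (- 2 * (M + 1)) \<le> exp (Re (h w))"
      by (simp add: exp_add[symmetric])
    moreover have "(1 / 2 / 4 ^ n) * exp (- 2 * (M + 1)) \<le> exp (Re (h 0)) * exp (- 2 * (M + 1))"
      using h(2)[of 0] q0 by (intro mult_right_mono) auto
    \<comment> \<open>The count of zeros enters squared, 4^n = (2^n)^2 \<le> 4 exp(2 M); together
      with exp(-2 (M + 1)) this makes up the constant exp(-4 M - 2) / 8.\<close>
    moreover have "exp (- 4 * M - 2) / 8 \<le> (1 / 2 / 4 ^ n) * exp (- 2 * (M + 1))"
    proof -
      have "(4::real) ^ n = (2 ^ n)\<^sup>2" by (simp add: power2_eq_square flip: power_mult_distrib)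
      also have "\<dots> \<le> (2 * exp M)\<^sup>2" using n by (intro power_mono) auto
      also have "\<dots> = 4 * exp (2 * M)" by (simp add: power2_eq_square exp_add[symmetric])
      finally have "1 / (4 * exp (2 * M)) \<le> 1 / (4::real) ^ n" by (intro divide_left_mono) auto
      then have "1 / (4 * exp (2 * M)) * (1/2 * exp (- 2 * (M + 1))) \<le> 1 / (4::real) ^ n * (1/2 * exp (- 2 * (M + 1)))"
        by (intro mult_right_mono) auto
      moreover have "1 / (4 * exp (2 * M)) * (1/2 * exp (- 2 * (M + 1))) = exp (- 4 * M - 2) / 8"
        by (simp add: exp_minus exp_diff exp_add[symmetric] field_simps)
      ultimately show ?thesis by simp
    qed
    moreover have "cmod (poly q w) = exp (Re (h w))" using h(2)[of w] that by simp
    ultimately show ?thesis by linarith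
  qed
  show thesis
  proof (rule that)
    show "2 ^ length ws \<le> 2 * exp M" using n by (simp add: n_def)
    show "exp (- 4 * M - 2) / 8 * prod_list (map (\<lambda>v. cmod (w - v)) ws) \<le> cmod (poly f w)"
      if "cmod w \<le> 2" for w
      unfolding pf using qlow[OF that] by (intro mult_right_mono prod_list_nonneg) auto
  qed
qed

section \<open>Translates of Gaussian product measures\<close>

text \<open>The restriction to \<open>I\<close> keeps the image extensional, as points of the
  product space have to be.\<close>

definition translate :: "'i set \<Rightarrow> ('i \<Rightarrow> complex) \<Rightarrow> ('i \<Rightarrow> complex) \<Rightarrow> 'i \<Rightarrow> complex" where
  "translate I c x = (\<lambda>i\<in>I. x i + c i)"

lemma measurable_translate [measurable]:
  "translate I c \<in> measurable (PiM I (\<lambda>_. borel)) (PiM I (\<lambda>_. borel))"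
  unfolding translate_def by measurable

lemma sets_std_complex_normal [simp, measurable_cong]: "sets std_complex_normal = sets borel"
  by (simp add: std_complex_normal_def)

lemma space_std_complex_normal [simp]: "space std_complex_normal = UNIV"
  by (simp add: std_complex_normal_def)

lemma nn_integral_std_complex_normal:
  assumes [measurable]: "f \<in> borel_measurable borel"
  shows "(\<integral>\<^sup>+x. f x \<partial>std_complex_normal) = (\<integral>\<^sup>+x. ennreal (exp (- (cmod x)\<^sup>2) / pi) * f x \<partial>lborel)"
  unfolding std_complex_normal_def by (subst nn_integral_density) auto

text \<open>The one-dimensional Cameron-Martin identity: the weight is the density at x + c divided
  by the density at x, and Lebesgue measure is translation invariant.\<close>

lemma std_complex_normal_translate:
  assumes [measurable]: "A \<in> sets borel"
  shows "(\<integral>\<^sup>+x. ennreal (exp ((cmod x)\<^sup>2 - (cmod (x + c))\<^sup>2)) * indicator A (x + c) \<partial>std_complex_normal) =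
    emeasure std_complex_normal A"
proof -
  have "(\<integral>\<^sup>+x. ennreal (exp ((cmod x)\<^sup>2 - (cmod (x + c))\<^sup>2)) * indicator A (x + c) \<partial>std_complex_normal) =
    (\<integral>\<^sup>+x. ennreal (exp (- (cmod (c + x))\<^sup>2) / pi) * indicator A (c + x) \<partial>lborel)"
    by (subst nn_integral_std_complex_normal, measurable)
      (auto intro!: nn_integral_cong simp: ennreal_mult' [symmetric] mult.assoc[symmetric] exp_add[symmetric] add.commute)
  also have "\<dots> = (\<integral>\<^sup>+x. ennreal (exp (- (cmod x)\<^sup>2) / pi) * indicator A x \<partial>distr lborel borel ((+) c))"
    by (subst nn_integral_distr) auto
  also have "\<dots> = (\<integral>\<^sup>+x. indicator A x \<partial>std_complex_normal)"
    by (subst nn_integral_std_complex_normal) (auto simp: lborel_distr_plus)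
  finally show ?thesis by simp
qed

text \<open>Half of the exponent pays for the tail. The other half is a wider Gaussian whose mass
  follows by rescaling the plane with sqrt 2, hence the factor 2. The total mass is left as a
  factor; it is identified only when \<open>std_complex_normal\<close> appears as the law of a
  matrix entry.\<close>

lemma emeasure_std_complex_normal_tail:
  assumes "b \<ge> 0"
  shows "emeasure std_complex_normal {x. cmod x > b} \<le>
    ennreal (2 * exp (- b\<^sup>2 / 2)) * emeasure std_complex_normal UNIV"
proof -
  have "emeasure std_complex_normal {x. cmod x > b} = (\<integral>\<^sup>+x. indicator {x. cmod x > b} x \<partial>std_complex_normal)"
    by simp
  also have "\<dots> = (\<integral>\<^sup>+x. ennreal (exp (- (cmod x)\<^sup>2) / pi) * indicator {x. cmod x > b} x \<partial>lborel)"
    by (rule nn_integral_std_complex_normal) measurable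
  also have "\<dots> \<le> (\<integral>\<^sup>+x. ennreal (exp (- b\<^sup>2 / 2)) * ennreal (exp (- (cmod x)\<^sup>2 / 2) / pi) \<partial>lborel)"
  proof (intro nn_integral_mono)
    fix x :: complex
    show "ennreal (exp (- (cmod x)\<^sup>2) / pi) * indicator {x. b < cmod x} x \<le>
      ennreal (exp (- b\<^sup>2 / 2)) * ennreal (exp (- (cmod x)\<^sup>2 / 2) / pi)"
    proof (cases "b < cmod x")
      case True
      then have "b\<^sup>2 \<le> (cmod x)\<^sup>2" using assms by (intro power_mono) auto
      then have "exp (- (cmod x)\<^sup>2) \<le> exp (- b\<^sup>2 / 2 + - (cmod x)\<^sup>2 / 2)" by simp
      then have "exp (- (cmod x)\<^sup>2) / pi \<le> exp (- b\<^sup>2 / 2) * (exp (- (cmod x)\<^sup>2 / 2) / pi)"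
        by (simp add: exp_add[symmetric] divide_right_mono)
      then show ?thesis using True by (simp add: ennreal_mult'[symmetric] ennreal_leI)
    qed simp
  qed
  also have "\<dots> = ennreal (exp (- b\<^sup>2 / 2)) * (\<integral>\<^sup>+x. ennreal (exp (- (cmod x)\<^sup>2 / 2) / pi) \<partial>lborel)"
    by (rule nn_integral_cmult) measurable
  also have "(\<integral>\<^sup>+x. ennreal (exp (- (cmod x)\<^sup>2 / 2) / pi) \<partial>lborel) =
      (\<integral>\<^sup>+x. ennreal (exp (- (cmod x)\<^sup>2 / 2) / pi) \<partial>
        density (distr lborel borel (\<lambda>x::complex. 0 + sqrt 2 *\<^sub>R x)) (\<lambda>_. ennreal (\<bar>sqrt 2\<bar> ^ DIM(complex))))"
    by (subst lborel_affine[of "sqrt 2" "0::complex"]) auto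
  also have "\<dots> = (\<integral>\<^sup>+x. 2 * ennreal (exp (- (cmod (sqrt 2 *\<^sub>R x))\<^sup>2 / 2) / pi) \<partial>lborel)"
    by (subst nn_integral_density, measurable, subst nn_integral_distr) (auto simp: ennreal_numeral[symmetric] simp del: ennreal_numeral)
  also have "\<dots> = (\<integral>\<^sup>+x. 2 * ennreal (exp (- (cmod x)\<^sup>2) / pi) \<partial>lborel)"
    by (simp add: power_mult_distrib)
  also have "\<dots> = 2 * (\<integral>\<^sup>+x. ennreal (exp (- (cmod x)\<^sup>2) / pi) \<partial>lborel)"
    by (rule nn_integral_cmult) measurable
  also have "(\<integral>\<^sup>+x. ennreal (exp (- (cmod (x::complex))\<^sup>2) / pi) \<partial>lborel) = emeasure std_complex_normal UNIV"
    by (subst nn_integral_indicator[symmetric], simp, subst nn_integral_std_complex_normal) auto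
  finally show ?thesis by (simp add: ennreal_mult' mult_ac)
qed

context
  fixes I :: "'i set"
  assumes finI: "finite I" and prob_normal: "prob_space std_complex_normal"
begin

interpretation prod: product_prob_space "\<lambda>_::'i. std_complex_normal" I
  using prob_normal by (simp add: product_prob_space_def product_sigma_finite_def
    product_prob_space_axioms_def prob_space_imp_sigma_finite)

abbreviation gaussian_product :: "('i \<Rightarrow> complex) measure" where
  "gaussian_product \<equiv> PiM I (\<lambda>_. std_complex_normal)"

text \<open>A product measure is determined by its values on boxes. On a box the weight splits over
  the coordinates, and each factor is the identity in dimension one.\<close>

lemma gaussian_product_translate:
  assumes S: "S \<in> sets (PiM I (\<lambda>_. borel))"
  shows "emeasure gaussian_product S = (\<integral>\<^sup>+x. (\<Prod>i\<in>I. ennreal (exp ((cmod (x i))\<^sup>2 - (cmod (x i + c i))\<^sup>2))) *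
    indicator S (translate I c x) \<partial>gaussian_product)"
proof -
  let ?h = "\<lambda>x. \<Prod>i\<in>I. ennreal (exp ((cmod (x i))\<^sup>2 - (cmod (x i + c i))\<^sup>2))"
  let ?D = "distr (density gaussian_product ?h) (PiM I (\<lambda>_. borel)) (translate I c)"
  have sets_eq: "sets (PiM I (\<lambda>_. std_complex_normal)) = sets (PiM I (\<lambda>_. borel))"
    by (intro sets_PiM_cong) auto
  note [measurable_cong] = sets_eq
  have h[measurable]: "?h \<in> borel_measurable (PiM I (\<lambda>_. borel))"
    by measurable
  have D: "emeasure ?D A = (\<integral>\<^sup>+x. ?h x * indicator A (translate I c x) \<partial>gaussian_product)"
    if [measurable]: "A \<in> sets (PiM I (\<lambda>_. borel))" for A
  proof -
    have "emeasure ?D A = (\<integral>\<^sup>+x. indicator A x \<partial>?D)" by simp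
    also have "\<dots> = (\<integral>\<^sup>+x. indicator A (translate I c x) \<partial>density gaussian_product ?h)"
      by (rule nn_integral_distr) measurable
    also have "\<dots> = (\<integral>\<^sup>+x. ?h x * indicator A (translate I c x) \<partial>gaussian_product)"
      by (rule nn_integral_density) measurable
    finally show ?thesis .
  qed
  have "?D = gaussian_product"
  proof (rule prod.PiM_eqI)
    fix A :: "'i \<Rightarrow> complex set" assume A: "\<And>i. i \<in> I \<Longrightarrow> A i \<in> sets std_complex_normal"
    then have A': "Pi\<^sub>E I A \<in> sets (PiM I (\<lambda>_. borel))"
      using finI by (intro sets_PiM_I_finite) auto
    have ind: "?h x * indicator (Pi\<^sub>E I A) (translate I c x) =
        (\<Prod>i\<in>I. ennreal (exp ((cmod (x i))\<^sup>2 - (cmod (x i + c i))\<^sup>2)) * indicator (A i) (x i + c i))" for x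
    proof (cases "\<forall>i\<in>I. x i + c i \<in> A i")
      case True
      then have "translate I c x \<in> Pi\<^sub>E I A" by (simp add: translate_def)
      then show ?thesis using True by simp
    next
      case False
      then obtain i where "i \<in> I" "x i + c i \<notin> A i" by blast
      moreover from this have "translate I c x \<notin> Pi\<^sub>E I A" by (auto simp: translate_def PiE_iff)
      ultimately show ?thesis using finI by (auto intro!: bexI[of _ i])
    qed
    have "emeasure ?D (Pi\<^sub>E I A) = (\<integral>\<^sup>+x. (\<Prod>i\<in>I. ennreal (exp ((cmod (x i))\<^sup>2 - (cmod (x i + c i))\<^sup>2)) *
        indicator (A i) (x i + c i)) \<partial>gaussian_product)"
      by (rule trans[OF D[OF A']], rule nn_integral_cong, rule ind)
    also have "\<dots> = (\<Prod>i\<in>I. \<integral>\<^sup>+x. ennreal (exp ((cmod x)\<^sup>2 - (cmod (x + c i))\<^sup>2)) * indicator (A i) (x + c i) \<partial>std_complex_normal)"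
    proof (intro prod.product_nn_integral_prod finI)
      fix i assume "i \<in> I"
      with A have [measurable]: "A i \<in> sets borel" by simp
      show "(\<lambda>x. ennreal (exp ((cmod x)\<^sup>2 - (cmod (x + c i))\<^sup>2)) * indicator (A i) (x + c i))
        \<in> borel_measurable std_complex_normal" by measurable
    qed
    also have "\<dots> = (\<Prod>i\<in>I. emeasure std_complex_normal (A i))"
      using A by (intro prod.cong refl std_complex_normal_translate) auto
    finally show "emeasure ?D (Pi\<^sub>E I A) = (\<Prod>i\<in>I. emeasure std_complex_normal (A i))" .
  qed (simp_all add: finI sets_eq)
  then show ?thesis using D[OF S] by simp
qed

text \<open>The density ratio is estimated where the translated point lies in \<open>S\<close>, so
  |x + c| \<le> b and |x|^2 - |x + c|^2 \<le> 2 b |c| + |c|^2 in each coordinate. The cost is thus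
  governed by the sum of the |c_i|, which is why a bound on the absolute entry sum of
  \<open>R\<close> matters.\<close>

lemma gaussian_product_translate_le:
  assumes S: "S \<in> sets (PiM I (\<lambda>_. borel))" and b: "\<And>x i. x \<in> S \<Longrightarrow> i \<in> I \<Longrightarrow> cmod (x i) \<le> b"
    and C: "(\<Sum>i\<in>I. 2 * b * cmod (c i) + (cmod (c i))\<^sup>2) \<le> C"
  shows "emeasure gaussian_product S \<le> ennreal (exp C) * (\<integral>\<^sup>+x. indicator S (translate I c x) \<partial>gaussian_product)"
proof -
  have sets_eq: "sets (PiM I (\<lambda>_. std_complex_normal)) = sets (PiM I (\<lambda>_. borel))"
    by (intro sets_PiM_cong) auto
  note [measurable_cong] = sets_eq
  note [measurable] = S
  have "emeasure gaussian_product S \<le> (\<integral>\<^sup>+x. ennreal (exp C) * indicator S (translate I c x) \<partial>gaussian_product)"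
    unfolding gaussian_product_translate[OF S, of c]
  proof (intro nn_integral_mono)
    fix x
    show "(\<Prod>i\<in>I. ennreal (exp ((cmod (x i))\<^sup>2 - (cmod (x i + c i))\<^sup>2))) * indicator S (translate I c x)
      \<le> ennreal (exp C) * indicator S (translate I c x)"
    proof (cases "translate I c x \<in> S")
      case True
      have "(cmod (x i))\<^sup>2 - (cmod (x i + c i))\<^sup>2 \<le> 2 * b * cmod (c i) + (cmod (c i))\<^sup>2" if i: "i \<in> I" for i
      proof -
        have "cmod (x i) \<le> cmod (x i + c i) + cmod (c i)"
          using norm_triangle_ineq4[of "x i + c i" "c i"] by simp
        then have "(cmod (x i))\<^sup>2 \<le> (cmod (x i + c i) + cmod (c i))\<^sup>2" by (intro power_mono) auto
        moreover have "cmod (x i + c i) \<le> b"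
          using b[OF True i] i by (simp add: translate_def)
        then have "cmod (x i + c i) * cmod (c i) \<le> b * cmod (c i)" by (intro mult_right_mono) auto
        ultimately show ?thesis by (simp add: power2_sum)
      qed
      then have "(\<Prod>i\<in>I. exp ((cmod (x i))\<^sup>2 - (cmod (x i + c i))\<^sup>2)) \<le>
        (\<Prod>i\<in>I. exp (2 * b * cmod (c i) + (cmod (c i))\<^sup>2))"
        by (intro prod_mono) auto
      also have "\<dots> \<le> exp C" using C by (simp add: exp_sum[OF finI, symmetric])
      finally show ?thesis by (simp add: prod_ennreal mult_right_mono ennreal_leI)
    qed simp
  qed
  also have "\<dots> = ennreal (exp C) * (\<integral>\<^sup>+x. indicator S (translate I c x) \<partial>gaussian_product)"
    by (rule nn_integral_cmult) measurable
  finally show ?thesis .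
qed

text \<open>Each of the m preimages of \<open>S\<close> under the translations has measure at least
  exp(-C) times that of \<open>S\<close>, while no point lies in more than n of them. Integrating
  the number of preimages containing a point gives the bound.\<close>

lemma gaussian_product_avoiding_translates:
  assumes S: "S \<in> sets (PiM I (\<lambda>_. borel))" and b: "\<And>x i. x \<in> S \<Longrightarrow> i \<in> I \<Longrightarrow> cmod (x i) \<le> b"
    and C: "\<And>k. k < m \<Longrightarrow> (\<Sum>i\<in>I. 2 * b * cmod (c k i) + (cmod (c k i))\<^sup>2) \<le> C"
    and n: "\<And>x. card {k. k < m \<and> translate I (c k) x \<in> S} \<le> n"
  shows "of_nat m * emeasure gaussian_product S \<le> ennreal (exp C) * of_nat n"
proof -
  have sets_eq: "sets (PiM I (\<lambda>_. std_complex_normal)) = sets (PiM I (\<lambda>_. borel))"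
    by (intro sets_PiM_cong) auto
  note [measurable_cong] = sets_eq
  note [measurable] = S
  have "of_nat m * emeasure gaussian_product S = (\<Sum>k<m. emeasure gaussian_product S)" by simp
  also have "\<dots> \<le> (\<Sum>k<m. ennreal (exp C) * (\<integral>\<^sup>+x. indicator S (translate I (c k) x) \<partial>gaussian_product))"
    using b C by (intro sum_mono gaussian_product_translate_le[OF S, where b = b]) auto
  also have "\<dots> = ennreal (exp C) * (\<integral>\<^sup>+x. (\<Sum>k<m. indicator S (translate I (c k) x)) \<partial>gaussian_product)"
    by (subst nn_integral_sum) (measurable, simp add: sum_distrib_left)
  also have "\<dots> \<le> ennreal (exp C) * (\<integral>\<^sup>+x. of_nat n \<partial>gaussian_product)"
  proof (intro mult_left_mono nn_integral_mono)
    fix x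
    have "(\<Sum>k<m. indicator S (translate I (c k) x) :: ennreal) = of_nat (card {k. k < m \<and> translate I (c k) x \<in> S})"
    proof -
      have "{k. k < m \<and> translate I (c k) x \<in> S} = {k\<in>{..<m}. translate I (c k) x \<in> S}" by auto
      then show ?thesis
        by (simp add: indicator_def of_bool_def flip: sum.inter_filter)
    qed
    also have "\<dots> \<le> of_nat n" using n by (simp add: of_nat_mono)
    finally show "(\<Sum>k<m. indicator S (translate I (c k) x) :: ennreal) \<le> of_nat n" .
  qed simp
  also have "\<dots> = ennreal (exp C) * of_nat n"
    using prod.emeasure_space_1 by simp
  finally show ?thesis .
qed

end

section \<open>Logarithmic potentials on a square\<close>

text \<open>Lebesgue measure on [-B, B], kept as a measure on the whole line so that measurability
  means plain Borel measurability.\<close>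

definition segment_measure :: "real \<Rightarrow> real measure" where
  "segment_measure B = density lborel (\<lambda>x. ennreal (indicator {-B..B} x))"

lemma sets_segment_measure [simp, measurable_cong]: "sets (segment_measure B) = sets borel"
  by (simp add: segment_measure_def)

lemma space_segment_measure [simp]: "space (segment_measure B) = UNIV"
  by (simp add: segment_measure_def)

lemma finite_segment_measure: "finite_measure (segment_measure B)"
proof
  show "emeasure (segment_measure B) (space (segment_measure B)) \<noteq> \<infinity>"
    by (simp add: segment_measure_def emeasure_density ennreal_indicator emeasure_lborel_Icc_eq)
qed

interpretation segment: finite_measure "segment_measure B" for B
  by (rule finite_segment_measure)

interpretation segment_pair: pair_sigma_finite "segment_measure B" "segment_measure B" for B
  by standard

abbreviation square_measure :: "real \<Rightarrow> (real \<times> real) measure" where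
  "square_measure B \<equiv> segment_measure B \<Otimes>\<^sub>M segment_measure B"

lemma finite_segment_pair: "finite_measure (square_measure B)"
  by (rule finite_measure_pair_measure) (rule finite_segment_measure)+

interpretation square: finite_measure "square_measure B" for B
  by (rule finite_segment_pair)

lemma AE_segment: "AE x in segment_measure B. \<bar>x\<bar> \<le> B"
  unfolding segment_measure_def by (subst AE_density) (auto simp: indicator_def)

lemma AE_segment_neq: "AE x in segment_measure B. x \<noteq> s"
  unfolding segment_measure_def by (subst AE_density) (auto intro: AE_mp[OF AE_lborel_singleton])

lemma AE_segment_pair: "AE z in square_measure B.
    \<bar>fst z\<bar> \<le> B \<and> \<bar>snd z\<bar> \<le> B \<and> fst z \<noteq> s \<and> snd z \<noteq> t"
proof (rule segment_pair.AE_pair_measure)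
  show "AE x in segment_measure B. AE y in segment_measure B.
    \<bar>fst (x, y)\<bar> \<le> B \<and> \<bar>snd (x, y)\<bar> \<le> B \<and> fst (x, y) \<noteq> s \<and> snd (x, y) \<noteq> t"
    using AE_segment[of B] AE_segment_neq[where s = s and B = B]
  proof eventually_elim
    case (elim x)
    show ?case
      using AE_segment[of B] AE_segment_neq[where s = t and B = B] by eventually_elim (use elim in auto)
  qed
qed measurable

lemma integral_segment:
  fixes f :: "real \<Rightarrow> real"
  assumes [measurable]: "f \<in> borel_measurable borel"
  shows "(\<integral>x. f x \<partial>segment_measure B) = (\<integral>x. indicator {-B..B} x *\<^sub>R f x \<partial>lborel)"
  unfolding segment_measure_def by (subst integral_density) auto

lemma integral_segment_FTC:
  fixes f F :: "real \<Rightarrow> real"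
  assumes [measurable]: "f \<in> borel_measurable borel" and "0 \<le> B"
    and "\<And>x. \<bar>x\<bar> \<le> B \<Longrightarrow> (F has_real_derivative f x) (at x)"
    and "continuous_on {-B..B} f"
  shows "(\<integral>x. f x \<partial>segment_measure B) = F B - F (- B)"
  unfolding integral_segment[OF assms(1)]
  by (rule integral_FTC_atLeastAtMost)
    (use assms in \<open>auto simp: has_real_derivative_iff_has_vector_derivative intro: has_vector_derivative_at_within\<close>)

section \<open>The singular weight |x|^(-1/2) and bounds for the logarithmic kernel\<close>

definition inv_sqrt :: "real \<Rightarrow> real" where "inv_sqrt x = \<bar>x\<bar> powr (- (1/2))"

lemma inv_sqrt_measurable [measurable]: "inv_sqrt \<in> borel_measurable borel"
  unfolding inv_sqrt_def[abs_def] by measurable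

lemma inv_sqrt_nonneg [simp]: "inv_sqrt x \<ge> 0" by (simp add: inv_sqrt_def)

lemma nn_integral_inv_sqrt:
  assumes "c \<ge> 0"
  shows "(\<integral>\<^sup>+x. ennreal (inv_sqrt x) * indicator {-c..c} x \<partial>lborel) \<le> ennreal (4 * sqrt c)"
proof -
  have pos: "(\<integral>\<^sup>+x. ennreal (inv_sqrt x) * indicator {0..c} x \<partial>lborel) = ennreal (2 * sqrt c)"
  proof -
    have "((\<lambda>x. x powr (- (1/2))) has_integral (c powr (- (1/2) + 1) / (- (1/2) + 1))) {0..c}"
      using assms by (intro has_integral_powr_from_0) auto
    also have "c powr (- (1/2) + 1) / (- (1/2) + 1) = 2 * sqrt c"
      using assms by (simp add: powr_half_sqrt)
    finally have "(inv_sqrt has_integral (2 * sqrt c)) {0..c}"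
      by (rule has_integral_eq[rotated]) (auto simp: inv_sqrt_def)
    then show ?thesis by (intro nn_integral_has_integral_lebesgue') auto
  qed
  have neg: "(\<integral>\<^sup>+x. ennreal (inv_sqrt x) * indicator {-c..0} x \<partial>lborel) = ennreal (2 * sqrt c)"
  proof -
    have "(\<integral>\<^sup>+x. ennreal (inv_sqrt x) * indicator {-c..0} x \<partial>lborel) =
        ennreal \<bar>-1\<bar> * (\<integral>\<^sup>+x. ennreal (inv_sqrt (0 + (-1) * x)) * indicator {-c..0} (0 + (-1) * x) \<partial>lborel)"
      by (rule nn_integral_real_affine) auto
    also have "\<dots> = (\<integral>\<^sup>+x. ennreal (inv_sqrt x) * indicator {0..c} x \<partial>lborel)"
      by (auto intro!: nn_integral_cong simp: inv_sqrt_def indicator_def)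
    finally show ?thesis using pos by simp
  qed
  have "(\<integral>\<^sup>+x. ennreal (inv_sqrt x) * indicator {-c..c} x \<partial>lborel) \<le>
    (\<integral>\<^sup>+x. ennreal (inv_sqrt x) * indicator {-c..0} x + ennreal (inv_sqrt x) * indicator {0..c} x \<partial>lborel)"
    by (intro nn_integral_mono) (auto simp: indicator_def)
  also have "\<dots> = ennreal (2 * sqrt c) + ennreal (2 * sqrt c)"
    by (subst nn_integral_add) (auto simp: pos neg)
  also have "\<dots> = ennreal (4 * sqrt c)" using assms by (simp add: ennreal_plus[symmetric] del: ennreal_plus)
  finally show ?thesis .
qed

lemma nn_integral_inv_sqrt_segment:
  assumes "\<bar>s\<bar> \<le> B"
  shows "(\<integral>\<^sup>+x. ennreal (inv_sqrt (x - s)) \<partial>segment_measure B) \<le> ennreal (4 * sqrt (2 * B))"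
proof -
  have "(\<integral>\<^sup>+x. ennreal (inv_sqrt (x - s)) \<partial>segment_measure B) =
      (\<integral>\<^sup>+x. ennreal (indicator {-B..B} x) * ennreal (inv_sqrt (x - s)) \<partial>lborel)"
    unfolding segment_measure_def by (rule nn_integral_density) auto
  also have "\<dots> = ennreal \<bar>1\<bar> * (\<integral>\<^sup>+x. ennreal (indicator {-B..B} (s + 1 * x)) * ennreal (inv_sqrt (s + 1 * x - s)) \<partial>lborel)"
    by (rule nn_integral_real_affine) auto
  also have "\<dots> \<le> (\<integral>\<^sup>+x. ennreal (inv_sqrt x) * indicator {-(2*B)..2*B} x \<partial>lborel)"
    using assms by (auto intro!: nn_integral_mono simp: indicator_def)
  also have "\<dots> \<le> ennreal (4 * sqrt (2 * B))"
    using assms by (intro nn_integral_inv_sqrt) auto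
  finally show ?thesis .
qed

text \<open>\<^term>\<open>log_kernel (Re z) (Im z)\<close> is \<open>ln (cmod z)\<close>, with the junk value \<open>0\<close> at \<open>z = 0\<close>.\<close>

definition log_kernel :: "real \<Rightarrow> real \<Rightarrow> real" where
  "log_kernel u v = ln (u\<^sup>2 + v\<^sup>2) / 2"

lemma log_kernel_measurable [measurable]: "(\<lambda>z. log_kernel (f z) (g z)) \<in> borel_measurable M"
  if "f \<in> borel_measurable M" "g \<in> borel_measurable M"
  using that unfolding log_kernel_def by measurable

lemma ln_cmod_eq_log_kernel: "ln (cmod z) = log_kernel (Re z) (Im z)"
  by (cases "z = 0") (auto simp: log_kernel_def cmod_def ln_sqrt complex_eq_iff sum_power2_gt_zero_iff)

lemma log_kernel_le: "log_kernel u v \<le> \<bar>u\<bar> + \<bar>v\<bar>"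
proof (cases "u = 0 \<and> v = 0")
  case False
  then have "u\<^sup>2 + v\<^sup>2 > 0" by (simp add: sum_power2_gt_zero_iff)
  moreover have "u\<^sup>2 + v\<^sup>2 \<le> (\<bar>u\<bar> + \<bar>v\<bar>)\<^sup>2" by (simp add: power2_sum)
  ultimately have "log_kernel u v \<le> ln ((\<bar>u\<bar> + \<bar>v\<bar>)\<^sup>2) / 2"
    unfolding log_kernel_def by (auto intro!: divide_right_mono ln_mono)
  also have "\<dots> = ln (\<bar>u\<bar> + \<bar>v\<bar>)" using False by (subst ln_realpow) auto
  also have "\<dots> \<le> \<bar>u\<bar> + \<bar>v\<bar>" using False by (intro ln_bound) auto
  finally show ?thesis .
qed (simp add: log_kernel_def)

text \<open>The inequality X \<le> 2 exp(X / 2) trades the excess of - log r over L for exp(-L / 2)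
  r^(-1/2), and r^(-1/2) is at most \<open>inv_sqrt\<close> of any nonzero coordinate. Both weights
  are added because \<open>inv_sqrt\<close> takes the default value 0 at 0. The factor exp(-L / 2)
  later makes the potentials uniformly integrable.\<close>

lemma neg_log_kernel_le:
  assumes "L \<ge> 0"
  shows "max 0 (- log_kernel u v - L) \<le> 2 * exp (- L / 2) * (inv_sqrt u + inv_sqrt v)"
proof (cases "u = 0 \<and> v = 0")
  case True
  then show ?thesis using assms by (simp add: log_kernel_def)
next
  case False
  define q where "q = u\<^sup>2 + v\<^sup>2"
  have q: "q > 0" using False by (simp add: q_def sum_power2_gt_zero_iff)
  have "max 0 (- log_kernel u v - L) \<le> 2 * exp ((- log_kernel u v - L) / 2)"
  proof -
    have "X \<le> 2 * exp (X / 2)" for X :: real using exp_ge_add_one_self[of "X / 2"] by linarith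
    then show ?thesis by simp
  qed
  also have "\<dots> = 2 * exp (- L / 2) * exp (- ln q / 4)"
  proof -
    have "(- log_kernel u v - L) / 2 = - L / 2 + - ln q / 4"
      by (simp add: log_kernel_def q_def field_simps)
    then show ?thesis by (simp only: exp_add mult.assoc)
  qed
  also have "exp (- ln q / 4) = q powr (- (1/4))" using q by (simp add: powr_def)
  also have "q powr (- (1/4)) \<le> inv_sqrt u + inv_sqrt v"
  proof -
    have *: "q powr (- (1/4)) \<le> inv_sqrt a" if "a \<noteq> 0" "a\<^sup>2 \<le> q" for a
    proof -
      have "q powr (- (1/4)) \<le> (a\<^sup>2) powr (- (1/4))" using that by (intro powr_mono2') auto
      also have "a\<^sup>2 = \<bar>a\<bar> powr 2" using that by simp
      also have "(\<bar>a\<bar> powr 2) powr (- (1/4)) = inv_sqrt a" by (simp only: powr_powr inv_sqrt_def) simp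
      finally show ?thesis .
    qed
    show ?thesis
    proof (cases "u = 0")
      case True
      then show ?thesis using *[of v] False by (simp add: q_def add_increasing)
    next
      case False
      then show ?thesis using *[of u] by (simp add: q_def add_increasing2)
    qed
  qed
  finally show ?thesis by (simp add: mult_left_mono)
qed

lemma abs_log_kernel_le: "\<bar>log_kernel u v\<bar> \<le> \<bar>u\<bar> + \<bar>v\<bar> + 2 * (inv_sqrt u + inv_sqrt v)"
proof -
  have "- log_kernel u v \<le> 2 * (inv_sqrt u + inv_sqrt v)"
    using neg_log_kernel_le[of 0 u v] by simp
  moreover define p where "p = \<bar>u\<bar> + \<bar>v\<bar>"
  moreover have "0 \<le> p" by (simp add: p_def)
  ultimately show ?thesis
    using log_kernel_le[of u v] inv_sqrt_nonneg[of u] inv_sqrt_nonneg[of v]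
    unfolding p_def[symmetric] by argo
qed

text \<open>The product of the weights dominates the partial derivatives of the kernel, for Fubini.
  Their sum dominates the logarithmic singularity, with a constant that does not depend on its
  position (s, t).\<close>

lemma nn_integral_inv_sqrt_pair:
  assumes "\<bar>s\<bar> \<le> B" "\<bar>t\<bar> \<le> B"
  shows "(\<integral>\<^sup>+z. ennreal (inv_sqrt (fst z - s) * inv_sqrt (snd z - t)) \<partial>square_measure B) < \<infinity>"
    and "(\<integral>\<^sup>+z. ennreal (inv_sqrt (fst z - s) + inv_sqrt (snd z - t)) \<partial>square_measure B)
      \<le> ennreal (8 * sqrt (2 * B) * measure (segment_measure B) UNIV)"
proof -
  let ?K = "4 * sqrt (2 * B)"
  have K: "?K \<ge> 0" using assms by simp
  have "(\<integral>\<^sup>+z. ennreal (inv_sqrt (fst z - s) * inv_sqrt (snd z - t)) \<partial>square_measure B) =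
      (\<integral>\<^sup>+x. \<integral>\<^sup>+y. ennreal (inv_sqrt (x - s)) * ennreal (inv_sqrt (y - t)) \<partial>segment_measure B \<partial>segment_measure B)"
    by (subst segment.nn_integral_fst[symmetric]) (auto simp: ennreal_mult)
  also have "\<dots> = (\<integral>\<^sup>+x. ennreal (inv_sqrt (x - s)) \<partial>segment_measure B) * (\<integral>\<^sup>+y. ennreal (inv_sqrt (y - t)) \<partial>segment_measure B)"
    by (simp add: nn_integral_cmult nn_integral_multc)
  also have "\<dots> \<le> ennreal ?K * ennreal ?K"
    by (intro mult_mono nn_integral_inv_sqrt_segment assms) auto
  also have "\<dots> < \<infinity>" by (simp add: ennreal_mult_less_top)
  finally show "(\<integral>\<^sup>+z. ennreal (inv_sqrt (fst z - s) * inv_sqrt (snd z - t)) \<partial>square_measure B) < \<infinity>" .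
  have "(\<integral>\<^sup>+z. ennreal (inv_sqrt (fst z - s) + inv_sqrt (snd z - t)) \<partial>square_measure B) =
      (\<integral>\<^sup>+x. \<integral>\<^sup>+y. ennreal (inv_sqrt (x - s)) + ennreal (inv_sqrt (y - t)) \<partial>segment_measure B \<partial>segment_measure B)"
    by (subst segment.nn_integral_fst[symmetric]) auto
  also have "\<dots> = (\<integral>\<^sup>+x. ennreal (inv_sqrt (x - s)) \<partial>segment_measure B) * emeasure (segment_measure B) UNIV +
      (\<integral>\<^sup>+y. ennreal (inv_sqrt (y - t)) \<partial>segment_measure B) * emeasure (segment_measure B) UNIV"
    by (simp add: nn_integral_add nn_integral_multc)
  also have "\<dots> \<le> ennreal ?K * emeasure (segment_measure B) UNIV + ennreal ?K * emeasure (segment_measure B) UNIV"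
    by (intro add_mono mult_right_mono nn_integral_inv_sqrt_segment assms) auto
  also have "\<dots> = ennreal (8 * sqrt (2 * B) * measure (segment_measure B) UNIV)"
    unfolding segment.emeasure_eq_measure using K
    by (simp add: ennreal_mult'[symmetric] ennreal_plus[symmetric] del: ennreal_plus)
  finally show "(\<integral>\<^sup>+z. ennreal (inv_sqrt (fst z - s) + inv_sqrt (snd z - t)) \<partial>square_measure B)
      \<le> ennreal (8 * sqrt (2 * B) * measure (segment_measure B) UNIV)" .
qed

lemma poly_measurable [measurable]: "(\<lambda>x. poly p (f x)) \<in> borel_measurable M"
  if [measurable]: "f \<in> borel_measurable M" for p :: "real poly"
  by (rule measurable_compose[OF that]) (intro borel_measurable_continuous_onI continuous_intros)

lemma integrable_segment_continuous:
  fixes f :: "real \<Rightarrow> real"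
  assumes [measurable]: "f \<in> borel_measurable borel" and "continuous_on {-B..B} f"
  shows "integrable (segment_measure B) f"
proof -
  have "bounded (f ` {-B..B})"
    using assms(2) by (intro compact_imp_bounded compact_continuous_image) auto
  then obtain K where K: "\<And>x. x \<in> {-B..B} \<Longrightarrow> norm (f x) \<le> K" unfolding bounded_iff by (metis imageI)
  show ?thesis
    by (rule segment.integrable_const_bound[where B = K])
      (use AE_segment[of B] K in \<open>auto elim!: AE_mp simp: abs_le_iff\<close>)
qed

lemma integrable_square_times_poly:
  fixes k :: "real \<times> real \<Rightarrow> real"
  assumes k: "integrable (square_measure B) k"
  shows "integrable (square_measure B) (\<lambda>z. k z * (poly p (fst z) * poly q (snd z)))"
proof -
  have "\<exists>K. \<forall>x. \<bar>x\<bar> \<le> B \<longrightarrow> \<bar>poly r x\<bar> \<le> K" for r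
  proof -
    have "bounded (poly r ` {-B..B})"
      by (intro compact_imp_bounded compact_continuous_image continuous_intros) auto
    then obtain K where "\<And>x. x \<in> {-B..B} \<Longrightarrow> norm (poly r x) \<le> K" unfolding bounded_iff by (metis imageI)
    then show ?thesis by (intro exI[of _ K]) (simp add: abs_le_iff)
  qed
  then obtain K1 K2 where K: "\<And>x. \<bar>x\<bar> \<le> B \<Longrightarrow> \<bar>poly p x\<bar> \<le> K1" "\<And>x. \<bar>x\<bar> \<le> B \<Longrightarrow> \<bar>poly q x\<bar> \<le> K2"
    by metis
  have [measurable]: "k \<in> borel_measurable (square_measure B)" using k by auto
  show ?thesis
  proof (rule Bochner_Integration.integrable_bound)
    show "integrable (square_measure B) (\<lambda>z. k z * (K1 * K2))" using k by simp
    show "AE z in square_measure B. norm (k z * (poly p (fst z) * poly q (snd z))) \<le> norm (k z * (K1 * K2))"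
      using AE_segment_pair[of B 0 0]
    proof eventually_elim
      case (elim z)
      have "\<bar>poly p (fst z)\<bar> * \<bar>poly q (snd z)\<bar> \<le> \<bar>K1\<bar> * \<bar>K2\<bar>"
        using elim K(1)[of "fst z"] K(2)[of "snd z"] by (intro mult_mono) auto
      then show ?case by (simp add: abs_mult mult_left_mono)
    qed
  qed measurable
qed

lemma integrable_log_kernel:
  assumes "\<bar>s\<bar> \<le> B" "\<bar>t\<bar> \<le> B"
  shows "integrable (square_measure B) (\<lambda>z. log_kernel (fst z - s) (snd z - t))"
proof -
  have i: "integrable (square_measure B) (\<lambda>z. inv_sqrt (fst z - s) + inv_sqrt (snd z - t))"
  proof (rule integrableI_bounded)
    have "(\<integral>\<^sup>+z. ennreal (inv_sqrt (fst z - s) + inv_sqrt (snd z - t)) \<partial>square_measure B) < \<infinity>"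
      using nn_integral_inv_sqrt_pair(2)[OF assms] by (rule order.strict_trans1) simp
    then show "(\<integral>\<^sup>+z. ennreal (norm (inv_sqrt (fst z - s) + inv_sqrt (snd z - t))) \<partial>square_measure B) < \<infinity>"
      by simp
  qed measurable
  show ?thesis
  proof (rule Bochner_Integration.integrable_bound)
    show "integrable (square_measure B) (\<lambda>z. 4 * B + 2 * (inv_sqrt (fst z - s) + inv_sqrt (snd z - t)))"
      by (intro Bochner_Integration.integrable_add integrable_mult_right i) simp
    show "AE z in square_measure B. norm (log_kernel (fst z - s) (snd z - t))
        \<le> norm (4 * B + 2 * (inv_sqrt (fst z - s) + inv_sqrt (snd z - t)))"
      using AE_segment_pair[of B 0 0]
    proof eventually_elim
      case (elim z)
      have "\<bar>log_kernel (fst z - s) (snd z - t)\<bar> \<le> \<bar>fst z - s\<bar> + \<bar>snd z - t\<bar> + 2 * (inv_sqrt (fst z - s) + inv_sqrt (snd z - t))"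
        by (rule abs_log_kernel_le)
      also have "\<bar>fst z - s\<bar> + \<bar>snd z - t\<bar> \<le> 4 * B" using elim assms by linarith
      finally show ?case by simp
    qed
  qed measurable
qed

text \<open>In terms of p = sqrt |u| and q = sqrt |v| this is p^3 q \<le> p^4 + q^4. It gives the
  derivative u / (u^2 + v^2) of the kernel a majorant that is a product of integrable functions of
  one variable.\<close>

lemma div_sum_squares_le:
  assumes "u \<noteq> 0" "v \<noteq> 0"
  shows "\<bar>u / (u\<^sup>2 + v\<^sup>2)\<bar> \<le> inv_sqrt u * inv_sqrt v"
proof -
  define p q where "p = sqrt \<bar>u\<bar>" and "q = sqrt \<bar>v\<bar>"
  have pq: "p > 0" "q > 0" "\<bar>u\<bar> = p\<^sup>2" "\<bar>v\<bar> = q\<^sup>2" using assms by (auto simp: p_def q_def)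
  have w: "inv_sqrt u = 1 / p" "inv_sqrt v = 1 / q"
    unfolding inv_sqrt_def p_def q_def powr_minus_divide by (simp_all add: powr_half_sqrt)
  have "p ^ 3 * q \<le> p ^ 4 + q ^ 4"
  proof (cases "q \<le> p")
    case True
    then have "p ^ 3 * q \<le> p ^ 3 * p" using pq by (intro mult_left_mono) auto
    also have "\<dots> = p ^ 4" by (simp add: eval_nat_numeral)
    also have "\<dots> \<le> p ^ 4 + q ^ 4" by simp
    finally show ?thesis .
  next
    case False
    then have "p ^ 3 * q \<le> q ^ 3 * q" using pq by (intro mult_right_mono power_mono) auto
    also have "\<dots> = q ^ 4" by (simp add: eval_nat_numeral)
    also have "\<dots> \<le> p ^ 4 + q ^ 4" by simp
    finally show ?thesis .
  qed
  moreover have "u\<^sup>2 = p ^ 4" "v\<^sup>2 = q ^ 4"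
    using arg_cong[OF pq(3), of "\<lambda>x. x\<^sup>2"] arg_cong[OF pq(4), of "\<lambda>x. x\<^sup>2"] by simp_all
  moreover have S: "p ^ 4 + q ^ 4 > 0" using pq by (simp add: add_pos_pos)
  moreover have "p\<^sup>2 / (p ^ 4 + q ^ 4) \<le> 1 / p * (1 / q)" if le: "p ^ 3 * q \<le> p ^ 4 + q ^ 4"
  proof -
    have "p\<^sup>2 = (p ^ 3 * q) / (p * q)" using pq by (simp add: eval_nat_numeral)
    also have "\<dots> \<le> (p ^ 4 + q ^ 4) / (p * q)" using pq le by (intro divide_right_mono) auto
    finally show ?thesis using S by (simp add: pos_divide_le_eq)
  qed
  ultimately show ?thesis
    using pq w by (simp add: abs_divide)
qed

lemma integrable_div_sum_squares:
  assumes "\<bar>s\<bar> \<le> B" "\<bar>t\<bar> \<le> B"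
  shows "integrable (square_measure B) (\<lambda>z. (fst z - s) / ((fst z - s)\<^sup>2 + (snd z - t)\<^sup>2))"
proof (rule Bochner_Integration.integrable_bound)
  show "integrable (square_measure B) (\<lambda>z. inv_sqrt (fst z - s) * inv_sqrt (snd z - t))"
    using nn_integral_inv_sqrt_pair(1)[OF assms] by (intro integrableI_bounded) auto
  show "AE z in square_measure B. norm ((fst z - s) / ((fst z - s)\<^sup>2 + (snd z - t)\<^sup>2))
      \<le> norm (inv_sqrt (fst z - s) * inv_sqrt (snd z - t))"
    using AE_segment_pair[of B s t]
  proof eventually_elim
    case (elim z)
    then show ?case using div_sum_squares_le[of "fst z - s" "snd z - t"] by simp
  qed
qed measurable

section \<open>Integration by parts against the logarithmic kernel\<close>

lemma integral_log_kernel_by_parts: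
  assumes "0 \<le> B" and v: "v \<noteq> 0" and \<alpha>: "poly (pderiv \<alpha>) B = 0" "poly (pderiv \<alpha>) (- B) = 0"
  shows "(\<integral>x. log_kernel (x - s) v * poly (pderiv (pderiv \<alpha>)) x \<partial>segment_measure B) =
    - (\<integral>x. (x - s) / ((x - s)\<^sup>2 + v\<^sup>2) * poly (pderiv \<alpha>) x \<partial>segment_measure B)"
proof -
  let ?f = "\<lambda>x. (x - s) / ((x - s)\<^sup>2 + v\<^sup>2) * poly (pderiv \<alpha>) x"
  let ?g = "\<lambda>x. log_kernel (x - s) v * poly (pderiv (pderiv \<alpha>)) x"
  have pos: "(x - s)\<^sup>2 + v\<^sup>2 > 0" for x using v by (simp add: sum_power2_gt_zero_iff)
  have ne: "(x - s)\<^sup>2 + v\<^sup>2 \<noteq> 0" for x using pos[of x] by linarith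
  have cf: "continuous_on {-B..B} ?f" by (intro continuous_intros) (use ne in auto)
  have cg: "continuous_on {-B..B} ?g"
    unfolding log_kernel_def by (intro continuous_intros) (use ne in auto)
  have "(\<integral>x. ?f x + ?g x \<partial>segment_measure B) =
      log_kernel (B - s) v * poly (pderiv \<alpha>) B - log_kernel (- B - s) v * poly (pderiv \<alpha>) (- B)"
  proof (rule integral_segment_FTC)
    fix x assume "\<bar>x\<bar> \<le> B"
    show "((\<lambda>x. log_kernel (x - s) v * poly (pderiv \<alpha>) x) has_real_derivative ?f x + ?g x) (at x)"
      unfolding log_kernel_def using pos[of x]
      by (auto intro!: derivative_eq_intros poly_DERIV simp: field_simps)
  next
    show "continuous_on {-B..B} (\<lambda>x. ?f x + ?g x)" by (rule continuous_on_add[OF cf cg])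
  qed (use assms in auto)
  also have "\<dots> = 0" using \<alpha> by simp
  finally have "(\<integral>x. ?f x \<partial>segment_measure B) + (\<integral>x. ?g x \<partial>segment_measure B) = 0"
    by (subst (asm) Bochner_Integration.integral_add)
      (rule integrable_segment_continuous[OF _ cf] integrable_segment_continuous[OF _ cg], measurable)+
  then show ?thesis by simp
qed

lemma integral_arctan_by_parts:
  assumes "0 \<le> B" and u: "u \<noteq> 0" and \<beta>: "poly \<beta> B = 0" "poly \<beta> (- B) = 0"
  shows "(\<integral>y. u / (u\<^sup>2 + (y - t)\<^sup>2) * poly \<beta> y \<partial>segment_measure B) =
    - (\<integral>y. arctan ((y - t) / u) * poly (pderiv \<beta>) y \<partial>segment_measure B)"
proof -
  let ?f = "\<lambda>y. u / (u\<^sup>2 + (y - t)\<^sup>2) * poly \<beta> y"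
  let ?g = "\<lambda>y. arctan ((y - t) / u) * poly (pderiv \<beta>) y"
  have pos: "u\<^sup>2 + (y - t)\<^sup>2 > 0" for y using u by (simp add: sum_power2_gt_zero_iff)
  have ne: "u\<^sup>2 + (y - t)\<^sup>2 \<noteq> 0" for y using pos[of y] by linarith
  have cf: "continuous_on {-B..B} ?f" by (intro continuous_intros) (use ne in auto)
  have cg: "continuous_on {-B..B} ?g" by (intro continuous_intros) (use u in auto)
  have "(\<integral>y. ?f y + ?g y \<partial>segment_measure B) =
      arctan ((B - t) / u) * poly \<beta> B - arctan ((- B - t) / u) * poly \<beta> (- B)"
  proof (rule integral_segment_FTC)
    fix y assume "\<bar>y\<bar> \<le> B"
    have "((\<lambda>y. arctan ((y - t) / u)) has_real_derivative inverse (1 + ((y - t) / u)\<^sup>2) * (1 / u)) (at y)"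
      by (rule DERIV_chain2[OF DERIV_arctan]) (use u in \<open>auto intro!: derivative_eq_intros\<close>)
    also have "inverse (1 + ((y - t) / u)\<^sup>2) * (1 / u) = u / (u\<^sup>2 + (y - t)\<^sup>2)"
    proof -
      have "1 + ((y - t) / u)\<^sup>2 = (u\<^sup>2 + (y - t)\<^sup>2) / u\<^sup>2" using u by (simp add: field_simps)
      then show ?thesis using u by (simp add: power2_eq_square)
    qed
    finally show "((\<lambda>y. arctan ((y - t) / u) * poly \<beta> y) has_real_derivative ?f y + ?g y) (at y)"
      by (rule DERIV_cong[OF DERIV_mult[OF _ poly_DERIV]]) simp
  next
    show "continuous_on {-B..B} (\<lambda>x. ?f x + ?g x)" by (rule continuous_on_add[OF cf cg])
  qed (use assms in auto)
  also have "\<dots> = 0" using \<beta> by simp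
  finally have "(\<integral>y. ?f y \<partial>segment_measure B) + (\<integral>y. ?g y \<partial>segment_measure B) = 0"
    by (subst (asm) Bochner_Integration.integral_add)
      (rule integrable_segment_continuous[OF _ cf] integrable_segment_continuous[OF _ cg], measurable)+
  then show ?thesis by simp
qed

text \<open>In the sense of distributions the derivative of the sign function is twice a point mass
  at s; the boundary terms vanish with \<alpha>.\<close>

lemma integral_sgn_pderiv:
  assumes s: "\<bar>s\<bar> < B" and \<alpha>: "poly \<alpha> B = 0" "poly \<alpha> (- B) = 0"
  shows "(\<integral>x. sgn (x - s) * poly (pderiv \<alpha>) x \<partial>segment_measure B) = - 2 * poly \<alpha> s"
proof -
  let ?f = "\<lambda>x. sgn (x - s) * poly (pderiv \<alpha>) x"
  have seg: "has_bochner_integral lborel (\<lambda>x. indicator {a..b} x *\<^sub>R poly (pderiv \<alpha>) x) (poly \<alpha> b - poly \<alpha> a)"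
    if "a \<le> b" for a b
    by (rule has_bochner_integral_FTC_Icc)
      (use that in \<open>auto intro!: has_field_derivative_at_within[OF poly_DERIV] continuous_intros
        simp: has_real_derivative_iff_has_vector_derivative[symmetric]\<close>)
  have "(\<integral>x. ?f x \<partial>segment_measure B) = (\<integral>x. indicator {-B..B} x *\<^sub>R ?f x \<partial>lborel)"
    by (rule integral_segment) measurable
  also have "\<dots> = (\<integral>x. indicator {s..B} x *\<^sub>R poly (pderiv \<alpha>) x - indicator {-B..s} x *\<^sub>R poly (pderiv \<alpha>) x \<partial>lborel)"
    by (rule integral_cong_AE, measurable)
      (use AE_lborel_singleton[of s] s in \<open>auto elim!: AE_mp intro!: AE_I2 simp: indicator_def sgn_if\<close>)
  also have "\<dots> = (poly \<alpha> B - poly \<alpha> s) - (poly \<alpha> s - poly \<alpha> (- B))"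
    by (intro has_bochner_integral_integral_eq has_bochner_integral_diff seg) (use s in auto)
  finally show ?thesis using \<alpha> by simp
qed


lemma abs_arctan_le: "\<bar>arctan x\<bar> \<le> pi / 2"
  using arctan_bounded[of x] by linarith

lemma arctan_add_arctan_inverse:
  assumes "u \<noteq> 0" "v \<noteq> 0"
  shows "arctan (v / u) + arctan (u / v) = pi / 2 * (sgn u * sgn v)"
proof -
  have "arctan (1 / (u / v)) = sgn (u / v) * pi / 2 - arctan (u / v)"
    by (rule Transcendental.arctan_inverse) (use assms in simp)
  then show ?thesis by (simp add: sgn_divide mult_ac)
qed

text \<open>A Cauchy-Riemann equation for log z: the x-derivative u / (u^2 + v^2) of log r is also
  the y-derivative of arctan (v / u). One integration by parts in x and one in y, with Fubini in
  between, therefore replace the kernel by a bounded one. The exceptional lines x = s and y = t are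
  null sets.\<close>

lemma integral_log_kernel_pderiv2:
  assumes s: "\<bar>s\<bar> < B" and t: "\<bar>t\<bar> < B"
    and \<alpha>: "poly (pderiv \<alpha>) B = 0" "poly (pderiv \<alpha>) (- B) = 0"
    and \<beta>: "poly \<beta> B = 0" "poly \<beta> (- B) = 0"
  shows "(\<integral>z. log_kernel (fst z - s) (snd z - t) * (poly (pderiv (pderiv \<alpha>)) (fst z) * poly \<beta> (snd z)) \<partial>square_measure B) =
    (\<integral>z. arctan ((snd z - t) / (fst z - s)) * (poly (pderiv \<alpha>) (fst z) * poly (pderiv \<beta>) (snd z)) \<partial>square_measure B)"
    (is "?lhs = ?rhs")
proof -
  let ?S = "segment_measure B"
  have B: "0 \<le> B" using s by simp
  have i1: "integrable (square_measure B) (case_prod (\<lambda>x y. log_kernel (x - s) (y - t) * (poly (pderiv (pderiv \<alpha>)) x * poly \<beta> y)))"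
    using integrable_square_times_poly[OF integrable_log_kernel[of s B t]] s t by (simp add: case_prod_beta')
  have i2: "integrable (square_measure B) (case_prod (\<lambda>x y. (x - s) / ((x - s)\<^sup>2 + (y - t)\<^sup>2) * (poly (pderiv \<alpha>) x * poly \<beta> y)))"
    using integrable_square_times_poly[OF integrable_div_sum_squares[of s B t]] s t by (simp add: case_prod_beta')
  have "integrable (square_measure B) (\<lambda>z. arctan ((snd z - t) / (fst z - s)))"
    by (rule square.integrable_const_bound[where B = "pi / 2"])
      (use abs_arctan_le in \<open>simp_all\<close>)
  then have i3: "integrable (square_measure B) (case_prod (\<lambda>x y. arctan ((y - t) / (x - s)) * (poly (pderiv \<alpha>) x * poly (pderiv \<beta>) y)))"
    using integrable_square_times_poly[where k = "\<lambda>z. arctan ((snd z - t) / (fst z - s))"] by (simp add: case_prod_beta')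
  have "?lhs = (\<integral>y. \<integral>x. log_kernel (x - s) (y - t) * (poly (pderiv (pderiv \<alpha>)) x * poly \<beta> y) \<partial>?S \<partial>?S)"
    using segment_pair.integral_snd[OF i1] by (simp add: case_prod_beta')
  also have "\<dots> = (\<integral>y. - (\<integral>x. (x - s) / ((x - s)\<^sup>2 + (y - t)\<^sup>2) * (poly (pderiv \<alpha>) x * poly \<beta> y) \<partial>?S) \<partial>?S)"
  proof (rule integral_cong_AE)
    show "AE y in ?S. (\<integral>x. log_kernel (x - s) (y - t) * (poly (pderiv (pderiv \<alpha>)) x * poly \<beta> y) \<partial>?S) =
        - (\<integral>x. (x - s) / ((x - s)\<^sup>2 + (y - t)\<^sup>2) * (poly (pderiv \<alpha>) x * poly \<beta> y) \<partial>?S)"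
      using AE_segment_neq[where s = t]
    proof eventually_elim
      case (elim y)
      then show ?case
        using integral_log_kernel_by_parts[OF B _ \<alpha>, of "y - t" s]
        unfolding mult.assoc[symmetric] integral_mult_left_zero by simp
    qed
  qed measurable
  also have "\<dots> = - (\<integral>x. \<integral>y. (x - s) / ((x - s)\<^sup>2 + (y - t)\<^sup>2) * (poly (pderiv \<alpha>) x * poly \<beta> y) \<partial>?S \<partial>?S)"
    using segment_pair.Fubini_integral[OF i2] by simp
  also have "\<dots> = - (\<integral>x. - (\<integral>y. arctan ((y - t) / (x - s)) * (poly (pderiv \<alpha>) x * poly (pderiv \<beta>) y) \<partial>?S) \<partial>?S)"
  proof (rule arg_cong[where f = uminus], rule integral_cong_AE)
    show "AE x in ?S. (\<integral>y. (x - s) / ((x - s)\<^sup>2 + (y - t)\<^sup>2) * (poly (pderiv \<alpha>) x * poly \<beta> y) \<partial>?S) =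
        - (\<integral>y. arctan ((y - t) / (x - s)) * (poly (pderiv \<alpha>) x * poly (pderiv \<beta>) y) \<partial>?S)"
      using AE_segment_neq[where s = s]
    proof eventually_elim
      case (elim x)
      then have *: "(\<integral>y. (x - s) / ((x - s)\<^sup>2 + (y - t)\<^sup>2) * poly \<beta> y \<partial>?S) =
          - (\<integral>y. arctan ((y - t) / (x - s)) * poly (pderiv \<beta>) y \<partial>?S)"
        using integral_arctan_by_parts[OF B _ \<beta>, of "x - s" t] by simp
      show ?case
        unfolding mult.left_commute[of _ "poly (pderiv \<alpha>) x"] integral_mult_right_zero * by simp
    qed
  qed measurable
  also have "\<dots> = ?rhs"
    using segment_pair.integral_fst'[OF i3] by (simp add: case_prod_beta')
  finally show ?thesis .
qed

lemma integral_square_flip: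
  fixes f :: "real \<Rightarrow> real \<Rightarrow> real"
  assumes [measurable]: "case_prod f \<in> borel_measurable (square_measure B)"
  shows "(\<integral>z. f (snd z) (fst z) \<partial>square_measure B) = (\<integral>z. f (fst z) (snd z) \<partial>square_measure B)"
  using segment_pair.integral_product_swap[of "case_prod f" B] by (simp add: case_prod_beta')

text \<open>The logarithm is a fundamental solution of the Laplacian. Integrating each second derivative by
  parts once in either variable leaves \<open>arctan (v / u)\<close> and \<open>arctan (u / v)\<close>, whose sum is locally
  constant.\<close>

lemma integral_log_kernel_laplacian:
  assumes s: "\<bar>s\<bar> < B" and t: "\<bar>t\<bar> < B"
    and \<alpha>: "poly \<alpha> B = 0" "poly \<alpha> (- B) = 0" "poly (pderiv \<alpha>) B = 0" "poly (pderiv \<alpha>) (- B) = 0"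
    and \<beta>: "poly \<beta> B = 0" "poly \<beta> (- B) = 0" "poly (pderiv \<beta>) B = 0" "poly (pderiv \<beta>) (- B) = 0"
  shows "(\<integral>z. log_kernel (fst z - s) (snd z - t) *
      (poly (pderiv (pderiv \<alpha>)) (fst z) * poly \<beta> (snd z) + poly \<alpha> (fst z) * poly (pderiv (pderiv \<beta>)) (snd z)) \<partial>square_measure B) =
    2 * pi * (poly \<alpha> s * poly \<beta> t)"
proof -
  let ?S = "segment_measure B" and ?D = "\<lambda>p. poly (pderiv p)"
  have swap: "log_kernel u v = log_kernel v u" for u v by (simp add: log_kernel_def add.commute)
  have il: "integrable (square_measure B) (\<lambda>z. log_kernel (fst z - s) (snd z - t))"
    using integrable_log_kernel s t by simp
  have ia: "integrable (square_measure B) (\<lambda>z. arctan (f z))"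
    if [measurable]: "f \<in> borel_measurable (square_measure B)" for f
    by (rule square.integrable_const_bound[where B = "pi / 2"])
      (use abs_arctan_le in \<open>simp_all\<close>)
  \<comment> \<open>Exchanging the coordinates reduces the second derivative in the other variable
    to the previous lemma and inverts the quotient inside the arctangent.\<close>
  have "(\<integral>z. log_kernel (fst z - s) (snd z - t) * (poly \<alpha> (fst z) * poly (pderiv (pderiv \<beta>)) (snd z)) \<partial>square_measure B) =
      (\<integral>z. log_kernel (fst z - t) (snd z - s) * (poly (pderiv (pderiv \<beta>)) (fst z) * poly \<alpha> (snd z)) \<partial>square_measure B)"
    by (subst integral_square_flip[where f = "\<lambda>x y. log_kernel (y - s) (x - t) * (poly \<alpha> y * poly (pderiv (pderiv \<beta>)) x)"])
      (auto simp: swap mult.commute case_prod_beta')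
  also have "\<dots> = (\<integral>z. arctan ((snd z - s) / (fst z - t)) * (?D \<beta> (fst z) * ?D \<alpha> (snd z)) \<partial>square_measure B)"
    by (rule integral_log_kernel_pderiv2) (use assms in auto)
  also have "\<dots> = (\<integral>z. arctan ((fst z - s) / (snd z - t)) * (?D \<alpha> (fst z) * ?D \<beta> (snd z)) \<partial>square_measure B)"
    by (subst integral_square_flip[where f = "\<lambda>x y. arctan ((x - s) / (y - t)) * (?D \<alpha> x * ?D \<beta> y)", symmetric])
      (auto simp: mult.commute case_prod_beta')
  finally have J2: "(\<integral>z. log_kernel (fst z - s) (snd z - t) * (poly \<alpha> (fst z) * poly (pderiv (pderiv \<beta>)) (snd z)) \<partial>square_measure B) =
      (\<integral>z. arctan ((fst z - s) / (snd z - t)) * (?D \<alpha> (fst z) * ?D \<beta> (snd z)) \<partial>square_measure B)" .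
  have "(\<integral>z. log_kernel (fst z - s) (snd z - t) *
      (poly (pderiv (pderiv \<alpha>)) (fst z) * poly \<beta> (snd z) + poly \<alpha> (fst z) * poly (pderiv (pderiv \<beta>)) (snd z)) \<partial>square_measure B) =
    (\<integral>z. log_kernel (fst z - s) (snd z - t) * (poly (pderiv (pderiv \<alpha>)) (fst z) * poly \<beta> (snd z)) \<partial>square_measure B) +
    (\<integral>z. log_kernel (fst z - s) (snd z - t) * (poly \<alpha> (fst z) * poly (pderiv (pderiv \<beta>)) (snd z)) \<partial>square_measure B)"
    unfolding distrib_left by (intro Bochner_Integration.integral_add integrable_square_times_poly il)
  also have "\<dots> = (\<integral>z. arctan ((snd z - t) / (fst z - s)) * (?D \<alpha> (fst z) * ?D \<beta> (snd z)) \<partial>square_measure B) +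
    (\<integral>z. arctan ((fst z - s) / (snd z - t)) * (?D \<alpha> (fst z) * ?D \<beta> (snd z)) \<partial>square_measure B)"
    unfolding J2 by (subst integral_log_kernel_pderiv2) (use assms in auto)
  also have "\<dots> = (\<integral>z. arctan ((snd z - t) / (fst z - s)) * (?D \<alpha> (fst z) * ?D \<beta> (snd z)) +
      arctan ((fst z - s) / (snd z - t)) * (?D \<alpha> (fst z) * ?D \<beta> (snd z)) \<partial>square_measure B)"
    by (intro Bochner_Integration.integral_add[symmetric] integrable_square_times_poly ia) measurable
  \<comment> \<open>Off the two lines through (s, t) the arctangents add up to \<pi>/2 times a
    product of signs, so the double integral splits. Each factor contributes -2 times a point value,
    and 4 \<pi>/2 = 2 \<pi>.\<close>
  also have "\<dots> = (\<integral>z. pi / 2 * ((sgn (fst z - s) * ?D \<alpha> (fst z)) * (sgn (snd z - t) * ?D \<beta> (snd z))) \<partial>square_measure B)"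
  proof (rule integral_cong_AE)
    show "AE z in square_measure B. arctan ((snd z - t) / (fst z - s)) * (?D \<alpha> (fst z) * ?D \<beta> (snd z)) +
      arctan ((fst z - s) / (snd z - t)) * (?D \<alpha> (fst z) * ?D \<beta> (snd z)) =
      pi / 2 * ((sgn (fst z - s) * ?D \<alpha> (fst z)) * (sgn (snd z - t) * ?D \<beta> (snd z)))"
      using AE_segment_pair[of B s t]
    proof eventually_elim
      case (elim z)
      then show ?case
        unfolding distrib_right[symmetric]
        by (subst arctan_add_arctan_inverse) (simp_all add: mult_ac)
    qed
  qed measurable
  also have "\<dots> = pi / 2 * (\<integral>z. (sgn (fst z - s) * ?D \<alpha> (fst z)) * (sgn (snd z - t) * ?D \<beta> (snd z)) \<partial>square_measure B)"
    by (rule integral_mult_right_zero)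
  also have "(\<integral>z. (sgn (fst z - s) * ?D \<alpha> (fst z)) * (sgn (snd z - t) * ?D \<beta> (snd z)) \<partial>square_measure B) =
      (\<integral>x. sgn (x - s) * ?D \<alpha> x \<partial>?S) * (\<integral>y. sgn (y - t) * ?D \<beta> y \<partial>?S)"
  proof -
    have "integrable (square_measure B) (\<lambda>z. sgn (fst z - s) * sgn (snd z - t))"
      by (rule square.integrable_const_bound[where B = 1]) (auto intro!: AE_I2 simp: sgn_if)
    from integrable_square_times_poly[OF this, of "pderiv \<alpha>" "pderiv \<beta>"]
    have "integrable (square_measure B) (\<lambda>z. (sgn (fst z - s) * ?D \<alpha> (fst z)) * (sgn (snd z - t) * ?D \<beta> (snd z)))"
      by (simp add: mult_ac)
    from segment_pair.integral_fst'[OF this] show ?thesis by simp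
  qed
  also have "\<dots> = (- 2 * poly \<alpha> s) * (- 2 * poly \<beta> t)"
    using integral_sgn_pderiv[OF s \<alpha>(1,2)] integral_sgn_pderiv[OF t \<beta>(1,2)] by simp
  finally show ?thesis by (simp add: mult_ac)
qed

section \<open>The replacement principle\<close>

text \<open>Points of the plane are pairs of reals here, so that the square carries a product
  measure and the integrations by parts run coordinatewise.\<close>

definition potential_difference :: "(nat \<Rightarrow> complex) \<Rightarrow> (nat \<Rightarrow> complex) \<Rightarrow> nat \<Rightarrow> real \<times> real \<Rightarrow> real" where
  "potential_difference p q N z = (\<Sum>i<N. log_kernel (fst z - Re (p i)) (snd z - Im (p i)) -
     log_kernel (fst z - Re (q i)) (snd z - Im (q i))) / real N"

lemma potential_difference_measurable [measurable]:
  "potential_difference p q N \<in> borel_measurable (square_measure B)"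
  unfolding potential_difference_def[abs_def] by measurable

lemma complex_in_squareD:
  assumes "cmod p \<le> B"
  shows "\<bar>Re p\<bar> \<le> B" "\<bar>Im p\<bar> \<le> B"
  using assms abs_Re_le_cmod[of p] abs_Im_le_cmod[of p] by linarith+

lemma integrable_potential_difference:
  assumes "\<And>i. i < N \<Longrightarrow> cmod (p i) \<le> B \<and> cmod (q i) \<le> B"
  shows "integrable (square_measure B) (potential_difference p q N)"
  unfolding potential_difference_def[abs_def] using assms
  by (intro integrable_divide Bochner_Integration.integrable_sum Bochner_Integration.integrable_diff integrable_log_kernel)
    (auto dest: complex_in_squareD)

lemma abs_log_kernel_excess_le:
  assumes "\<bar>u\<bar> + \<bar>v\<bar> \<le> L"
  shows "\<bar>log_kernel u v\<bar> - L \<le> 2 * exp (- L / 2) * (inv_sqrt u + inv_sqrt v)"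
proof -
  have L: "L \<ge> 0" using assms by linarith
  have "max 0 (- log_kernel u v - L) \<le> 2 * exp (- L / 2) * (inv_sqrt u + inv_sqrt v)"
    by (rule neg_log_kernel_le[OF L])
  then show ?thesis using log_kernel_le[of u v] assms by linarith
qed

text \<open>Uniform integrability in quantitative form: cutting off at 2 L, that is L for each of
  the two potentials, costs O(exp(-L / 2)) whatever N and the points are. Since |u| + |v| \<le> 4 B
  \<le> L on the square, only the negative part of the logarithm can exceed L.\<close>

lemma integral_abs_potential_difference_le:
  assumes N: "N > 0" and pq: "\<And>i. i < N \<Longrightarrow> cmod (p i) \<le> B \<and> cmod (q i) \<le> B" and L: "4 * B \<le> L"
  shows "(\<integral>z. \<bar>potential_difference p q N z\<bar> \<partial>square_measure B) \<le>
    (\<integral>z. min \<bar>potential_difference p q N z\<bar> (2 * L) \<partial>square_measure B) +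
    4 * exp (- L / 2) * (8 * sqrt (2 * B) * measure (segment_measure B) UNIV)"
proof -
  define W where "W = 8 * sqrt (2 * B) * measure (segment_measure B) UNIV"
  define w where "w c z = inv_sqrt (fst z - Re c) + inv_sqrt (snd z - Im c)" for c z
  have [measurable]: "w c \<in> borel_measurable (square_measure B)" for c
    unfolding w_def[abs_def] by measurable
  have B: "B \<ge> 0" using pq[OF N] norm_ge_zero[of "p 0"] by linarith
  have w_nonneg: "0 \<le> w c z" for c z by (simp add: w_def)
  have wW: "integrable (square_measure B) (w c)" "(\<integral>z. w c z \<partial>square_measure B) \<le> W" if "cmod c \<le> B" for c
  proof -
    have le: "(\<integral>\<^sup>+z. ennreal (w c z) \<partial>square_measure B) \<le> ennreal W"
      unfolding w_def W_def using nn_integral_inv_sqrt_pair(2) complex_in_squareD[OF that] by blast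
    then have "(\<integral>\<^sup>+z. ennreal (w c z) \<partial>square_measure B) < \<infinity>"
      by (rule order.strict_trans1) simp
    then show i: "integrable (square_measure B) (w c)"
      using w_nonneg by (intro integrableI_bounded) auto
    have "W \<ge> 0" using B by (simp add: W_def)
    then show "(\<integral>z. w c z \<partial>square_measure B) \<le> W"
      using le nn_integral_eq_integral[OF i] w_nonneg by (simp add: ennreal_le_iff)
  qed
  let ?h = "potential_difference p q N"
  let ?R = "\<lambda>z. (\<Sum>i<N. 2 * exp (- L / 2) * (w (p i) z + w (q i) z)) / real N"
  have ih: "integrable (square_measure B) (\<lambda>z. \<bar>?h z\<bar>)"
    using integrable_potential_difference[OF pq] by auto
  have im: "integrable (square_measure B) (\<lambda>z. min \<bar>?h z\<bar> (2 * L))"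
    using ih by (intro integrable_min) auto
  have iR: "integrable (square_measure B) ?R"
    using wW pq by (intro integrable_divide Bochner_Integration.integrable_sum integrable_mult_right Bochner_Integration.integrable_add) auto
  have "(\<integral>z. \<bar>?h z\<bar> \<partial>square_measure B) \<le> (\<integral>z. min \<bar>?h z\<bar> (2 * L) + ?R z \<partial>square_measure B)"
  proof (rule integral_mono_AE)
    show "AE z in square_measure B. \<bar>?h z\<bar> \<le> min \<bar>?h z\<bar> (2 * L) + ?R z"
      using AE_segment_pair[of B 0 0]
    proof eventually_elim
      case (elim z)
      have R0: "?R z \<ge> 0" using w_nonneg by (intro divide_nonneg_nonneg sum_nonneg mult_nonneg_nonneg add_nonneg_nonneg) auto
      have ex: "\<bar>log_kernel (fst z - Re c) (snd z - Im c)\<bar> - L \<le> 2 * exp (- L / 2) * w c z" if "cmod c \<le> B" for c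
        unfolding w_def
      proof (rule abs_log_kernel_excess_le)
        show "\<bar>fst z - Re c\<bar> + \<bar>snd z - Im c\<bar> \<le> L"
          using complex_in_squareD[OF that] elim L by linarith
      qed
      have "\<bar>?h z\<bar> \<le> (\<Sum>i<N. \<bar>log_kernel (fst z - Re (p i)) (snd z - Im (p i)) -
         log_kernel (fst z - Re (q i)) (snd z - Im (q i))\<bar>) / real N"
        unfolding potential_difference_def abs_divide by (auto intro!: divide_right_mono sum_abs)
      also have "\<dots> \<le> (\<Sum>i<N. 2 * L + 2 * exp (- L / 2) * (w (p i) z + w (q i) z)) / real N"
      proof (intro divide_right_mono sum_mono)
        fix i assume "i \<in> {..<N}"
        then have "cmod (p i) \<le> B" "cmod (q i) \<le> B" using pq by auto
        from ex[OF this(1)] ex[OF this(2)]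
        show "\<bar>log_kernel (fst z - Re (p i)) (snd z - Im (p i)) - log_kernel (fst z - Re (q i)) (snd z - Im (q i))\<bar>
          \<le> 2 * L + 2 * exp (- L / 2) * (w (p i) z + w (q i) z)"
          unfolding distrib_left by linarith
      qed simp
      also have "\<dots> = 2 * L + ?R z"
        using N by (simp add: sum.distrib add_divide_distrib)
      finally show ?case using R0 by (auto simp: min_def)
    qed
  qed (use ih im iR in auto)
  also have "\<dots> = (\<integral>z. min \<bar>?h z\<bar> (2 * L) \<partial>square_measure B) + (\<integral>z. ?R z \<partial>square_measure B)"
    by (rule Bochner_Integration.integral_add[OF im iR])
  also have "(\<integral>z. ?R z \<partial>square_measure B) \<le> 4 * exp (- L / 2) * W"
  proof -
    have "(\<integral>z. ?R z \<partial>square_measure B) =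
        (\<Sum>i<N. 2 * exp (- L / 2) * ((\<integral>z. w (p i) z \<partial>square_measure B) + (\<integral>z. w (q i) z \<partial>square_measure B))) / real N"
      using wW(1) pq by (simp add: Bochner_Integration.integral_sum Bochner_Integration.integral_add)
    also have "\<dots> \<le> (\<Sum>i<N. 2 * exp (- L / 2) * (W + W)) / real N"
      using wW(2) pq by (intro divide_right_mono sum_mono mult_left_mono add_mono) auto
    also have "\<dots> = 4 * exp (- L / 2) * W" using N by simp
    finally show ?thesis .
  qed
  finally show ?thesis unfolding W_def by simp
qed

text \<open>Vitali's argument: for a fixed level L dominated convergence handles the truncated
  integrals, and the remainder is small uniformly in N once L is large.\<close>

lemma integral_abs_potential_difference_tendsto_0:
  fixes p q :: "nat \<Rightarrow> nat \<Rightarrow> complex"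
  assumes pq: "\<forall>\<^sub>F N in sequentially. \<forall>i<N. cmod (p N i) \<le> B \<and> cmod (q N i) \<le> B"
    and lim: "AE z in square_measure B. (\<lambda>N. potential_difference (p N) (q N) N z) \<longlonglongrightarrow> 0"
  shows "(\<lambda>N. \<integral>z. \<bar>potential_difference (p N) (q N) N z\<bar> \<partial>square_measure B) \<longlonglongrightarrow> 0"
proof (rule tendstoI)
  fix e :: real assume e: "e > 0"
  let ?W = "8 * sqrt (2 * B) * measure (segment_measure B) UNIV"
  have "((\<lambda>L. 4 * exp (- L / 2) * ?W) \<longlongrightarrow> 4 * 0 * ?W) at_top"
    by (intro tendsto_intros filterlim_compose[OF exp_at_bot] filterlim_compose[of uminus, OF filterlim_uminus_at_bot_at_top, simplified]) real_asymp
  then have "\<forall>\<^sub>F L in at_top. 4 * exp (- L / 2) * ?W < e / 2"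
    using e by (intro order_tendstoD(2)) auto
  then have "\<forall>\<^sub>F L in at_top. 4 * exp (- L / 2) * ?W < e / 2 \<and> 4 * B \<le> L \<and> 0 \<le> L"
    by (intro eventually_conj eventually_ge_at_top)
  then obtain L where L: "4 * exp (- L / 2) * ?W < e / 2" "4 * B \<le> L" "0 \<le> L"
    by (auto simp: eventually_at_top_linorder)
  have "(\<lambda>N. \<integral>z. min \<bar>potential_difference (p N) (q N) N z\<bar> (2 * L) \<partial>square_measure B) \<longlonglongrightarrow>
      (\<integral>z. 0 \<partial>square_measure B)"
  proof (rule integral_dominated_convergence[where w = "\<lambda>_. 2 * L"])
    show "AE z in square_measure B. (\<lambda>N. min \<bar>potential_difference (p N) (q N) N z\<bar> (2 * L)) \<longlonglongrightarrow> 0"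
      using lim
    proof eventually_elim
      case (elim z)
      have "(\<lambda>N. min \<bar>potential_difference (p N) (q N) N z\<bar> (2 * L)) \<longlonglongrightarrow> min \<bar>0\<bar> (2 * L)"
        by (intro tendsto_intros elim)
      then show ?case using L by simp
    qed
    show "AE z in square_measure B. norm (min \<bar>potential_difference (p N) (q N) N z\<bar> (2 * L)) \<le> 2 * L" for N
      using L by (intro AE_I2) auto
  qed auto
  then have "\<forall>\<^sub>F N in sequentially. (\<integral>z. min \<bar>potential_difference (p N) (q N) N z\<bar> (2 * L) \<partial>square_measure B) < e / 2"
    using e by (intro order_tendstoD(2)) auto
  then show "\<forall>\<^sub>F N in sequentially. dist (\<integral>z. \<bar>potential_difference (p N) (q N) N z\<bar> \<partial>square_measure B) 0 < e"
    using pq eventually_gt_at_top[of 0]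
  proof eventually_elim
    case (elim N)
    have "(\<integral>z. \<bar>potential_difference (p N) (q N) N z\<bar> \<partial>square_measure B) \<ge> 0" by simp
    then show ?case
      using integral_abs_potential_difference_le[of N "p N" B "q N" L] elim L by simp
  qed
qed

text \<open>By the representation through the Laplacian, the difference of the two averages of
  \<phi>(x, y) = \<alpha>(x) \<beta>(y) is the integral of the potential difference against
  \<open>G\<close>, the Laplacian of \<phi>, divided by 2 \<pi>. \<open>G\<close> is bounded on the
  square, so convergence in L^1 suffices. The strict inequality between the radii keeps every point
  inside the open square.\<close>

lemma sum_poly_difference_tendsto_0:
  fixes p q :: "nat \<Rightarrow> nat \<Rightarrow> complex"
  assumes pq: "\<forall>\<^sub>F N in sequentially. \<forall>i<N. cmod (p N i) \<le> B\<^sub>0 \<and> cmod (q N i) \<le> B\<^sub>0" and B: "B\<^sub>0 < B"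
    and lim: "AE z in square_measure B. (\<lambda>N. potential_difference (p N) (q N) N z) \<longlonglongrightarrow> 0"
    and \<alpha>: "poly \<alpha> B = 0" "poly \<alpha> (- B) = 0" "poly (pderiv \<alpha>) B = 0" "poly (pderiv \<alpha>) (- B) = 0"
    and \<beta>: "poly \<beta> B = 0" "poly \<beta> (- B) = 0" "poly (pderiv \<beta>) B = 0" "poly (pderiv \<beta>) (- B) = 0"
  shows "(\<lambda>N. (\<Sum>i<N. poly \<alpha> (Re (p N i)) * poly \<beta> (Im (p N i)) -
      poly \<alpha> (Re (q N i)) * poly \<beta> (Im (q N i))) / real N) \<longlonglongrightarrow> 0"
proof -
  define G where "G z = poly (pderiv (pderiv \<alpha>)) (fst z) * poly \<beta> (snd z) +
    poly \<alpha> (fst z) * poly (pderiv (pderiv \<beta>)) (snd z)" for z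
  have [measurable]: "G \<in> borel_measurable (square_measure B)" unfolding G_def[abs_def] by measurable
  have "bounded (G ` ({-B..B} \<times> {-B..B}))"
    unfolding G_def[abs_def]
    by (intro compact_imp_bounded compact_continuous_image continuous_intros compact_Times) auto
  then obtain K where "K > 0" and K: "\<And>z. z \<in> {-B..B} \<times> {-B..B} \<Longrightarrow> norm (G z) \<le> K"
    unfolding bounded_pos by (metis imageI)
  have pq': "\<forall>\<^sub>F N in sequentially. \<forall>i<N. cmod (p N i) \<le> B \<and> cmod (q N i) \<le> B"
    using pq by eventually_elim (use B in force)
  have ev: "\<forall>\<^sub>F N in sequentially. norm ((\<Sum>i<N. poly \<alpha> (Re (p N i)) * poly \<beta> (Im (p N i)) -
      poly \<alpha> (Re (q N i)) * poly \<beta> (Im (q N i))) / real N) \<le>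
      (\<integral>z. \<bar>potential_difference (p N) (q N) N z\<bar> \<partial>square_measure B) * K / (2 * pi)"
    using pq
  proof eventually_elim
    case (elim N)
    let ?h = "potential_difference (p N) (q N) N"
    let ?\<phi> = "\<lambda>c. poly \<alpha> (Re c) * poly \<beta> (Im c)"
    have lt: "\<bar>Re c\<bar> < B" "\<bar>Im c\<bar> < B" if "cmod c \<le> B\<^sub>0" for c
      using complex_in_squareD[OF that] B by linarith+
    have int: "integrable (square_measure B) (\<lambda>z. log_kernel (fst z - Re c) (snd z - Im c) * G z)"
      and val: "(\<integral>z. log_kernel (fst z - Re c) (snd z - Im c) * G z \<partial>square_measure B) = 2 * pi * ?\<phi> c"
      if "cmod c \<le> B\<^sub>0" for c
    proof -
      show "integrable (square_measure B) (\<lambda>z. log_kernel (fst z - Re c) (snd z - Im c) * G z)"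
        unfolding G_def distrib_left using lt[OF that]
        by (intro Bochner_Integration.integrable_add integrable_square_times_poly integrable_log_kernel) auto
      show "(\<integral>z. log_kernel (fst z - Re c) (snd z - Im c) * G z \<partial>square_measure B) = 2 * pi * ?\<phi> c"
        unfolding G_def using lt[OF that] \<alpha> \<beta> by (intro integral_log_kernel_laplacian) auto
    qed
    have "(\<integral>z. ?h z * G z \<partial>square_measure B) =
        (\<integral>z. (\<Sum>i<N. log_kernel (fst z - Re (p N i)) (snd z - Im (p N i)) * G z -
          log_kernel (fst z - Re (q N i)) (snd z - Im (q N i)) * G z) / real N \<partial>square_measure B)"
      unfolding potential_difference_def by (simp add: sum_distrib_right left_diff_distrib)
    also have "\<dots> = (\<Sum>i<N. 2 * pi * ?\<phi> (p N i) - 2 * pi * ?\<phi> (q N i)) / real N"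
      using elim int val by (simp add: Bochner_Integration.integral_sum Bochner_Integration.integral_diff)
    also have "\<dots> = 2 * pi * ((\<Sum>i<N. ?\<phi> (p N i) - ?\<phi> (q N i)) / real N)"
      by (simp add: right_diff_distrib[symmetric] sum_distrib_left[symmetric] del: sum_subtractf)
    finally have eq: "(\<integral>z. ?h z * G z \<partial>square_measure B) = 2 * pi * ((\<Sum>i<N. ?\<phi> (p N i) - ?\<phi> (q N i)) / real N)" .
    have ih: "integrable (square_measure B) ?h"
      using elim B by (intro integrable_potential_difference) force
    have "norm (\<integral>z. ?h z * G z \<partial>square_measure B) \<le> (\<integral>z. norm (?h z * G z) \<partial>square_measure B)"
      by (rule integral_norm_bound)
    also have "\<dots> \<le> (\<integral>z. \<bar>?h z\<bar> * K \<partial>square_measure B)"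
    proof (rule integral_mono_AE')
      show "AE z in square_measure B. norm (?h z * G z) \<le> \<bar>?h z\<bar> * K"
        using AE_segment_pair[of B 0 0]
      proof eventually_elim
        case (elim z)
        then show ?case
          using K[of z] by (cases z) (simp add: abs_mult mult_left_mono abs_le_iff)
      qed
    qed (use ih \<open>K > 0\<close> in auto)
    also have "\<dots> = (\<integral>z. \<bar>?h z\<bar> \<partial>square_measure B) * K" by simp
    finally show ?case unfolding eq by (simp add: norm_mult abs_mult field_simps)
  qed
  have "(\<lambda>N. (\<integral>z. \<bar>potential_difference (p N) (q N) N z\<bar> \<partial>square_measure B) * K / (2 * pi)) \<longlonglongrightarrow> 0 * K / (2 * pi)"
    by (intro tendsto_intros integral_abs_potential_difference_tendsto_0 pq' lim) auto
  then show ?thesis by (intro Lim_null_comparison[OF ev]) simp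
qed


text \<open>Links the polynomials delivered by Stone-Weierstrass to the products of one-variable
  polynomials for which the Laplacian formula is available.\<close>

lemma real_polynomial_function_complex_expansion:
  fixes g :: "complex \<Rightarrow> real"
  assumes "real_polynomial_function g"
  shows "\<exists>ps. \<forall>z. g z = (\<Sum>(a, b)\<leftarrow>ps. poly a (Re z) * poly b (Im z))"
  using assms
proof induction
  case (linear f)
  have lin: "f z = Re z * f 1 + Im z * f \<i>" for z
  proof -
    have "z = Re z *\<^sub>R 1 + Im z *\<^sub>R \<i>" by (simp add: complex_eq_iff)
    then have "f z = f (Re z *\<^sub>R 1 + Im z *\<^sub>R \<i>)" by simp
    also have "\<dots> = Re z * f 1 + Im z * f \<i>"
      using linear by (simp add: linear_simps)
    finally show ?thesis .
  qed
  show ?case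
    by (intro exI[of _ "[([:0, f 1:], 1), (1, [:0, f \<i>:])]"] allI, subst lin) simp
next
  case (const c)
  show ?case by (intro exI[of _ "[([:c:], 1)]"]) simp
next
  case (add f g)
  then obtain ps qs where "\<forall>z. f z = (\<Sum>(a, b)\<leftarrow>ps. poly a (Re z) * poly b (Im z))"
    "\<forall>z. g z = (\<Sum>(a, b)\<leftarrow>qs. poly a (Re z) * poly b (Im z))" by blast
  then show ?case by (intro exI[of _ "ps @ qs"]) simp
next
  case (mult f g)
  then obtain ps qs where ps: "\<forall>z. f z = (\<Sum>(a, b)\<leftarrow>ps. poly a (Re z) * poly b (Im z))"
    and qs: "\<forall>z. g z = (\<Sum>(a, b)\<leftarrow>qs. poly a (Re z) * poly b (Im z))" by blast
  have inner: "(\<Sum>(a, b)\<leftarrow>map (\<lambda>(c, d). (a' * c, b' * d)) qs. poly a (Re z) * poly b (Im z)) =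
      poly a' (Re z) * poly b' (Im z) * (\<Sum>(a, b)\<leftarrow>qs. poly a (Re z) * poly b (Im z))" for a' b' z
    by (induction qs) (auto simp: algebra_simps)
  have cc: "(\<Sum>(a, b)\<leftarrow>concat (map (\<lambda>(a', b'). map (\<lambda>(c, d). (a' * c, b' * d)) qs) ps). poly a (Re z) * poly b (Im z)) =
      (\<Sum>(a, b)\<leftarrow>ps. poly a (Re z) * poly b (Im z)) * (\<Sum>(a, b)\<leftarrow>qs. poly a (Re z) * poly b (Im z))" for z
    by (induction ps) (auto simp: inner algebra_simps simp del: map_map)
  show ?case
    using ps qs by (intro exI[of _ "concat (map (\<lambda>(a', b'). map (\<lambda>(c, d). (a' * c, b' * d)) qs) ps)"] allI)
      (subst cc, simp)
qed

text \<open>Polynomials approximate the quotient of f by a weight instead of f itself; multiplying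
  back keeps the approximation on the disc and supplies the boundary conditions on the square. The
  quotient is continuous there because the weight is positive on the smaller disc.\<close>

theorem replacement_principle:
  fixes p q :: "nat \<Rightarrow> nat \<Rightarrow> complex" and f :: "complex \<Rightarrow> real"
  assumes pq: "\<forall>\<^sub>F N in sequentially. \<forall>i<N. cmod (p N i) \<le> B\<^sub>0 \<and> cmod (q N i) \<le> B\<^sub>0" and B: "B\<^sub>0 < B"
    and lim: "AE z in square_measure B. (\<lambda>N. potential_difference (p N) (q N) N z) \<longlonglongrightarrow> 0"
    and f: "continuous_on UNIV f"
  shows "(\<lambda>N. (\<Sum>i<N. f (p N i) - f (q N i)) / real N) \<longlonglongrightarrow> 0"
proof (rule tendstoI)
  fix e :: real assume e: "e > 0"
  \<comment> \<open>The weight makes every polynomial vanish to second order on the boundary of the square.\<close>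
  define r where "r = [:B\<^sup>2, 0, -1:]\<^sup>2"
  define \<omega> where "\<omega> c = poly r (Re c) * poly r (Im c)" for c
  have r: "poly r x = (B\<^sup>2 - x\<^sup>2)\<^sup>2" for x by (simp add: r_def power2_eq_square algebra_simps)
  have r_bd: "0 < poly r x" "poly r x \<le> B ^ 4" if "\<bar>x\<bar> \<le> B\<^sub>0" for x
  proof -
    have "\<bar>x\<bar>\<^sup>2 < B\<^sup>2" using that B by (intro power_strict_mono) auto
    then have x: "x\<^sup>2 < B\<^sup>2" by simp
    then show "0 < poly r x" unfolding r by simp
    have "(B\<^sup>2 - x\<^sup>2)\<^sup>2 \<le> (B\<^sup>2)\<^sup>2" using x by (intro power_mono) auto
    then show "poly r x \<le> B ^ 4" unfolding r by simp
  qed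
  have \<omega>: "0 < \<omega> c" "\<omega> c \<le> B ^ 8" if "cmod c \<le> B\<^sub>0" for c
  proof -
    note bd = r_bd[OF complex_in_squareD(1)[OF that]] r_bd[OF complex_in_squareD(2)[OF that]]
    show "0 < \<omega> c" using bd by (simp add: \<omega>_def)
    have "\<omega> c \<le> B ^ 4 * B ^ 4" unfolding \<omega>_def using bd by (intro mult_mono) auto
    then show "\<omega> c \<le> B ^ 8" by (simp flip: power_add)
  qed
  \<comment> \<open>The weight is at most B^8 on the disc, so this choice makes the error at each
    point at most e/4. The two point families then contribute e/2 together, and the polynomial
    average another e/4.\<close>
  define \<epsilon> where "\<epsilon> = e / (4 * (B ^ 8 + 1))"
  have B8: "0 \<le> B ^ 8" by simp
  have \<epsilon>: "\<epsilon> > 0" using e B8 by (simp add: \<epsilon>_def add_nonneg_pos)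
  have "continuous_on (cball 0 B\<^sub>0) (\<lambda>c. f c / \<omega> c)"
    using \<omega>(1) unfolding \<omega>_def
    by (intro continuous_intros continuous_on_subset[OF f]) force+
  then obtain g where g: "real_polynomial_function g" "\<And>c. c \<in> cball 0 B\<^sub>0 \<Longrightarrow> \<bar>f c / \<omega> c - g c\<bar> < \<epsilon>"
    using Stone_Weierstrass_real_polynomial_function[of "cball 0 B\<^sub>0" "\<lambda>c. f c / \<omega> c" \<epsilon>] \<epsilon> by auto
  obtain ps where ps: "\<And>z. g z = (\<Sum>(a, b)\<leftarrow>ps. poly a (Re z) * poly b (Im z))"
    using real_polynomial_function_complex_expansion[OF g(1)] by blast
  have close: "\<bar>f c - g c * \<omega> c\<bar> \<le> e / 4" if c: "cmod c \<le> B\<^sub>0" for c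
  proof -
    have "f c - g c * \<omega> c = (f c / \<omega> c - g c) * \<omega> c"
      using \<omega>(1)[OF c] by (simp add: left_diff_distrib)
    then have "\<bar>f c - g c * \<omega> c\<bar> = \<bar>f c / \<omega> c - g c\<bar> * \<omega> c"
      using \<omega>(1)[OF c] by (simp add: abs_mult)
    also have "\<dots> \<le> \<epsilon> * (B ^ 8 + 1)"
      using g(2)[of c] \<omega>[OF c] c \<epsilon> by (intro mult_mono) auto
    also have "\<dots> = e / 4"
    proof -
      have "e / (4 * X) * X = e / 4" if "X \<noteq> 0" for X using that by simp
      from this[of "B ^ 8 + 1"] show ?thesis unfolding \<epsilon>_def using B8 by linarith
    qed
    finally show ?thesis .
  qed
  have term_lim: "(\<lambda>N. (\<Sum>i<N. poly a (Re (p N i)) * poly b (Im (p N i)) * \<omega> (p N i) -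
      poly a (Re (q N i)) * poly b (Im (q N i)) * \<omega> (q N i)) / real N) \<longlonglongrightarrow> 0" for a b
  proof -
    have z: "poly (a * r) B = 0" "poly (a * r) (- B) = 0"
      "poly (pderiv (a * r)) B = 0" "poly (pderiv (a * r)) (- B) = 0" for a
      by (simp_all add: r pderiv_mult) (simp_all add: r_def power2_eq_square pderiv_pCons algebra_simps)
    show ?thesis
      using sum_poly_difference_tendsto_0[OF pq B lim z[of a] z[of b]]
      by (simp add: \<omega>_def mult_ac)
  qed
  have "(\<lambda>N. (\<Sum>i<N. (\<Sum>(a, b)\<leftarrow>qs. poly a (Re (p N i)) * poly b (Im (p N i))) * \<omega> (p N i) -
      (\<Sum>(a, b)\<leftarrow>qs. poly a (Re (q N i)) * poly b (Im (q N i))) * \<omega> (q N i)) / real N) \<longlonglongrightarrow> 0" for qs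
  proof (induction qs)
    case (Cons x qs)
    obtain a b where x: "x = (a, b)" by (cases x)
    show ?case
      using tendsto_add[OF term_lim[of a b] Cons]
      by (simp add: x distrib_right sum.distrib sum_subtractf add_divide_distrib diff_divide_distrib algebra_simps)
  qed simp
  then have lim_g: "(\<lambda>N. (\<Sum>i<N. g (p N i) * \<omega> (p N i) - g (q N i) * \<omega> (q N i)) / real N) \<longlonglongrightarrow> 0"
    unfolding ps by blast
  have "0 < e / 4" using e by simp
  from tendstoD[OF lim_g this]
  have "\<forall>\<^sub>F N in sequentially. \<bar>(\<Sum>i<N. g (p N i) * \<omega> (p N i) - g (q N i) * \<omega> (q N i)) / real N\<bar> < e / 4"
    by (simp only: dist_real_def diff_0_right)
  then show "\<forall>\<^sub>F N in sequentially. dist ((\<Sum>i<N. f (p N i) - f (q N i)) / real N) 0 < e"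
    using pq eventually_gt_at_top[of 0]
  proof eventually_elim
    case (elim N)
    have "\<bar>(\<Sum>i<N. f (p N i) - f (q N i)) / real N - (\<Sum>i<N. g (p N i) * \<omega> (p N i) - g (q N i) * \<omega> (q N i)) / real N\<bar>
      = \<bar>\<Sum>i<N. (f (p N i) - g (p N i) * \<omega> (p N i)) - (f (q N i) - g (q N i) * \<omega> (q N i))\<bar> / real N"
      by (simp add: diff_divide_distrib[symmetric] sum_subtractf algebra_simps)
    also have "\<dots> \<le> (\<Sum>i<N. e / 4 + e / 4) / real N"
    proof (intro divide_right_mono order.trans[OF sum_abs] sum_mono)
      fix i assume "i \<in> {..<N}"
      then have "cmod (p N i) \<le> B\<^sub>0" "cmod (q N i) \<le> B\<^sub>0" using elim by auto
      from close[OF this(1)] close[OF this(2)]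
      show "\<bar>(f (p N i) - g (p N i) * \<omega> (p N i)) - (f (q N i) - g (q N i) * \<omega> (q N i))\<bar> \<le> e / 4 + e / 4"
        by linarith
    qed simp
    also have "\<dots> = e / 2" using elim by simp
    finally show ?case using elim e unfolding dist_real_def by linarith
  qed
qed

section \<open>Circulant matrices and the Fourier matrix\<close>

lemma has_sum_finite_sum:
  fixes f :: "'i \<Rightarrow> 'a \<Rightarrow> 'b::topological_comm_monoid_add"
  assumes "finite A" "\<And>i. i \<in> A \<Longrightarrow> (f i has_sum s i) B"
  shows "((\<lambda>x. \<Sum>i\<in>A. f i x) has_sum (\<Sum>i\<in>A. s i)) B"
  using assms by (induction A rule: finite_induct) (auto intro: has_sum_add simp: has_sum_0)

definition unity_root :: "nat \<Rightarrow> nat \<Rightarrow> complex" where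
  "unity_root N l = cis (2 * pi * real l / real N)"

lemma sum_unity_root_powi:
  assumes N: "N > 0"
  shows "(\<Sum>l<N. unity_root N l powi m) = (if int N dvd m then of_nat N else 0)"
proof -
  define z where "z = cis (2 * pi * of_int m / real N)"
  have pow: "unity_root N l powi m = z ^ l" for l
    by (simp add: unity_root_def z_def cis_power_int Complex.DeMoivre mult_ac)
  show ?thesis
  proof (cases "int N dvd m")
    case True
    then obtain k where "m = int N * k" by auto
    then have "2 * pi * real_of_int m / real N = 2 * pi * of_int k" using N by simp
    then have "z = cis (2 * pi * of_int k)" unfolding z_def by (simp only:)
    with cis_multiple_2pi[OF Ints_of_int, of k] have "z = 1" by (simp only:)
    then show ?thesis using True by (simp add: pow)
  next
    case False
    have "z \<noteq> 1"
    proof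
      assume "z = 1"
      then have "cos (2 * pi * of_int m / real N) = 1" by (simp add: z_def complex_eq_iff)
      then obtain k :: int where "2 * pi * of_int m / real N = of_int k * 2 * pi"
        by (auto simp: cos_one_2pi_int)
      then have "of_int m = of_int k * real N" using N by (simp add: field_simps)
      then have "(of_int m :: real) = of_int (k * int N)" by simp
      then have "m = k * int N" by (rule of_int_eq_iff[THEN iffD1])
      then show False using False by simp
    qed
    moreover have "z ^ N = 1"
    proof -
      have "z ^ N = cis (2 * pi * of_int m)" using N by (simp add: z_def Complex.DeMoivre)
      then show ?thesis by (simp add: cis_multiple_2pi)
    qed
    ultimately show ?thesis using False by (simp add: pow sum_gp_strict)
  qed
qed

definition fourier_mat :: "nat \<Rightarrow> complex mat" where
  "fourier_mat N = mat N N (\<lambda>(l, k). unity_root N l powi int k / complex_of_real (sqrt (real N)))"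

definition fourier_mat_adj :: "nat \<Rightarrow> complex mat" where
  "fourier_mat_adj N = mat N N (\<lambda>(j, l). unity_root N l powi (- int j) / complex_of_real (sqrt (real N)))"

lemma fourier_mat_carrier [simp]:
  "fourier_mat N \<in> carrier_mat N N" "fourier_mat_adj N \<in> carrier_mat N N"
  by (auto simp: fourier_mat_def fourier_mat_adj_def)

lemma unity_root_nz [simp]: "unity_root N l \<noteq> 0" by (simp add: unity_root_def)

lemma cmod_unity_root [simp]: "cmod (unity_root N l) = 1" by (simp add: unity_root_def)

lemma cnj_unity_root_powi: "cnj (unity_root N l powi m) = unity_root N l powi (- m)"
  by (simp add: unity_root_def cis_power_int cis_cnj)

lemma cnj_unity_root_power: "cnj (unity_root N l) ^ j = unity_root N l powi (- int j)"
  using cnj_unity_root_powi[of N l "int j"] by simp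

lemma fourier_adj_diag_fourier_entry:
  assumes N: "N > 0" and "j < N" "k < N"
  shows "(\<Sum>l<N. fourier_mat_adj N $$ (j,l) * c l * fourier_mat N $$ (l,k)) =
    (\<Sum>l<N. c l * unity_root N l powi (int k - int j)) / of_nat N"
proof -
  have "complex_of_real (sqrt (real N)) * complex_of_real (sqrt (real N)) = of_nat N"
    by (simp flip: of_real_mult)
  then have "fourier_mat_adj N $$ (j,l) * c l * fourier_mat N $$ (l,k) =
      c l * unity_root N l powi (int k - int j) / of_nat N" if "l < N" for l
    using assms that by (simp add: fourier_mat_def fourier_mat_adj_def power_int_diff power_int_minus field_simps)
  then show ?thesis by (simp add: sum_divide_distrib)
qed

lemma fourier_adj_times_fourier:
  assumes N: "N > 0"
  shows "fourier_mat_adj N * fourier_mat N = 1\<^sub>m N"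
proof (rule eq_matI)
  fix j k assume "j < dim_row (1\<^sub>m N :: complex mat)" "k < dim_col (1\<^sub>m N :: complex mat)"
  then have jk: "j < N" "k < N" by auto
  have "(fourier_mat_adj N * fourier_mat N) $$ (j,k) = (\<Sum>l<N. fourier_mat_adj N $$ (j,l) * 1 * fourier_mat N $$ (l,k))"
    using jk by (simp add: scalar_prod_def atLeast0LessThan carrier_matD[OF fourier_mat_carrier(1)] carrier_matD[OF fourier_mat_carrier(2)])
  also have "\<dots> = (\<Sum>l<N. unity_root N l powi (int k - int j)) / of_nat N"
    using fourier_adj_diag_fourier_entry[OF N jk, of "\<lambda>_. 1"] by simp
  also have "\<dots> = (if int N dvd int k - int j then 1 else 0)"
    using N by (simp add: sum_unity_root_powi)
  also have "int N dvd int k - int j \<longleftrightarrow> j = k"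
  proof
    assume "int N dvd int k - int j"
    moreover have "\<bar>int k - int j\<bar> < int N" using jk by linarith
    ultimately show "j = k" using dvd_imp_le_int[of "int k - int j" "int N"] by force
  qed simp
  finally show "(fourier_mat_adj N * fourier_mat N) $$ (j,k) = 1\<^sub>m N $$ (j,k)" using jk by simp
qed (auto simp: carrier_matD[OF fourier_mat_carrier(1)] carrier_matD[OF fourier_mat_carrier(2)])

lemma fourier_mat_isometry:
  assumes N: "N > 0"
  shows "(\<Sum>l<N. (cmod (\<Sum>j<N. fourier_mat N $$ (l,j) * v j))\<^sup>2) = (\<Sum>j<N. (cmod (v j))\<^sup>2)"
proof -
  have adj: "cnj (fourier_mat N $$ (l,j)) = fourier_mat_adj N $$ (j,l)" if "l < N" "j < N" for l j
    using that by (simp add: fourier_mat_def fourier_mat_adj_def cnj_unity_root_power)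
  have ort: "(\<Sum>l<N. fourier_mat_adj N $$ (j,l) * fourier_mat N $$ (l,k)) = (if j = k then 1 else 0)"
    if "j < N" "k < N" for j k
  proof -
    have "(fourier_mat_adj N * fourier_mat N) $$ (j,k) = (\<Sum>l<N. fourier_mat_adj N $$ (j,l) * fourier_mat N $$ (l,k))"
      using that by (simp add: scalar_prod_def atLeast0LessThan carrier_matD[OF fourier_mat_carrier(1)] carrier_matD[OF fourier_mat_carrier(2)])
    then show ?thesis using fourier_adj_times_fourier[OF N] that by simp
  qed
  have "complex_of_real (\<Sum>l<N. (cmod (\<Sum>j<N. fourier_mat N $$ (l,j) * v j))\<^sup>2) =
      (\<Sum>l<N. (\<Sum>k<N. fourier_mat N $$ (l,k) * v k) * (\<Sum>j<N. fourier_mat_adj N $$ (j,l) * cnj (v j)))"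
    unfolding of_real_sum complex_norm_square
    by (intro sum.cong refl arg_cong2[where f = "(*)"]) (auto simp: adj intro!: sum.cong)
  also have "\<dots> = (\<Sum>l<N. \<Sum>k<N. \<Sum>j<N. v k * cnj (v j) * (fourier_mat_adj N $$ (j,l) * fourier_mat N $$ (l,k)))"
    by (simp add: sum_product mult_ac)
  also have "\<dots> = (\<Sum>k<N. \<Sum>l<N. \<Sum>j<N. v k * cnj (v j) * (fourier_mat_adj N $$ (j,l) * fourier_mat N $$ (l,k)))"
    by (rule sum.swap)
  also have "\<dots> = (\<Sum>k<N. \<Sum>j<N. \<Sum>l<N. v k * cnj (v j) * (fourier_mat_adj N $$ (j,l) * fourier_mat N $$ (l,k)))"
    by (rule sum.cong[OF refl], rule sum.swap)
  also have "\<dots> = (\<Sum>k<N. \<Sum>j<N. if j = k then v k * cnj (v k) else 0)"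
    by (intro sum.cong refl) (auto simp: sum_distrib_left[symmetric] ort)
  also have "\<dots> = complex_of_real (\<Sum>j<N. (cmod (v j))\<^sup>2)"
    unfolding of_real_sum complex_norm_square by simp
  finally show ?thesis by (rule of_real_eq_iff[THEN iffD1])
qed

section \<open>Column norms and determinants of perturbed circulants\<close>

definition column_norm :: "nat \<Rightarrow> complex mat \<Rightarrow> nat \<Rightarrow> real" where
  "column_norm N W k = L2_set (\<lambda>r. cmod (W $$ (r, k))) {..<N}"

text \<open>The size of a perturbation as seen by Hadamard's inequality: a product of factors 1 + |W
  e_k| / d is at most the exponential of their sum. It is bounded for the wrap-around matrix and
  tends to 0 for the noise.\<close>

definition column_norm_sum :: "nat \<Rightarrow> complex mat \<Rightarrow> real" where
  "column_norm_sum N W = (\<Sum>k<N. column_norm N W k)"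

lemma column_norm_sum_nonneg [simp]: "0 \<le> column_norm_sum N W"
  by (simp add: column_norm_sum_def column_norm_def sum_nonneg)

lemma column_norm_add_le:
  assumes "W \<in> carrier_mat N N" "W' \<in> carrier_mat N N" "k < N"
  shows "column_norm N (W + W') k \<le> column_norm N W k + column_norm N W' k"
proof -
  have "column_norm N (W + W') k \<le> L2_set (\<lambda>r. cmod (W $$ (r,k)) + cmod (W' $$ (r,k))) {..<N}"
    unfolding column_norm_def using assms by (intro L2_set_mono) (auto intro: norm_triangle_ineq)
  also have "\<dots> \<le> column_norm N W k + column_norm N W' k"
    unfolding column_norm_def by (rule L2_set_triangle_ineq)
  finally show ?thesis .
qed

lemma column_norm_sum_add_le:
  assumes "W \<in> carrier_mat N N" "W' \<in> carrier_mat N N"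
  shows "column_norm_sum N (W + W') \<le> column_norm_sum N W + column_norm_sum N W'"
  unfolding column_norm_sum_def sum.distrib[symmetric]
  using assms by (intro sum_mono column_norm_add_le) auto

lemma column_norm_sum_smult:
  assumes "W \<in> carrier_mat N N"
  shows "column_norm_sum N (c \<cdot>\<^sub>m W) = cmod c * column_norm_sum N W"
proof -
  have "column_norm N (c \<cdot>\<^sub>m W) k = cmod c * column_norm N W k" if "k < N" for k
    unfolding column_norm_def using assms that
    by (subst L2_set_right_distrib) (auto intro!: L2_set_cong simp: norm_mult)
  then show ?thesis by (simp add: column_norm_sum_def sum_distrib_left)
qed

lemma column_norm_sum_le_entry_sum:
  "column_norm_sum N W \<le> (\<Sum>k<N. \<Sum>r<N. cmod (W $$ (r, k)))"
  unfolding column_norm_sum_def column_norm_def by (intro sum_mono L2_set_le_sum) auto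

text \<open>Source of the exponent 3/2: there are N columns, each of length at most sqrt N times the
  largest entry.\<close>

lemma column_norm_sum_le_entry_bound:
  assumes "\<And>r k. r < N \<Longrightarrow> k < N \<Longrightarrow> cmod (W $$ (r, k)) \<le> b" and "0 \<le> b"
  shows "column_norm_sum N W \<le> real N * sqrt (real N) * b"
proof -
  have "column_norm N W k \<le> sqrt (real N) * b" if "k < N" for k
  proof -
    have "column_norm N W k \<le> L2_set (\<lambda>r. b) {..<N}"
      unfolding column_norm_def using assms that by (intro L2_set_mono) auto
    then show ?thesis using assms by (simp add: L2_set_constant)
  qed
  then have "column_norm_sum N W \<le> (\<Sum>k<N. sqrt (real N) * b)"
    unfolding column_norm_sum_def by (intro sum_mono) auto
  then show ?thesis by simp
qed

text \<open>Given by its spectral decomposition in the Fourier basis, so that the eigenvalues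
  \<open>c l\<close> can be prescribed and shifted by z. For values of the symbol it is the
  periodised Toeplitz matrix.\<close>

definition circulant_mat :: "(nat \<Rightarrow> complex) \<Rightarrow> nat \<Rightarrow> complex mat" where
  "circulant_mat c N = mat N N (\<lambda>(j, k). \<Sum>l<N. fourier_mat_adj N $$ (j,l) * c l * fourier_mat N $$ (l,k))"

lemma circulant_mat_carrier [simp]: "circulant_mat c N \<in> carrier_mat N N"
  by (simp add: circulant_mat_def)

lemma det_fourier:
  assumes N: "N > 0"
  shows "det (fourier_mat_adj N) * det (fourier_mat N) = 1" "cmod (det (fourier_mat N)) = 1"
    "cmod (det (fourier_mat_adj N)) = 1"
proof -
  show 1: "det (fourier_mat_adj N) * det (fourier_mat N) = 1"
    using det_mult[of "fourier_mat_adj N" N "fourier_mat N"] fourier_adj_times_fourier[OF N] by simp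
  have adj: "fourier_mat_adj N = transpose_mat (map_mat cnj (fourier_mat N))"
    by (rule eq_matI) (auto simp: fourier_mat_def fourier_mat_adj_def cnj_unity_root_power)
  have cV: "map_mat cnj (fourier_mat N) \<in> carrier_mat N N" by simp
  have "det (fourier_mat_adj N) = cnj (det (fourier_mat N))"
    unfolding adj det_transpose[OF cV] by (rule det_map_cnj[OF fourier_mat_carrier(1)])
  with 1 have "(cmod (det (fourier_mat N)))\<^sup>2 = 1"
    by (metis complex_norm_square mult.commute of_real_eq_1_iff)
  then show "cmod (det (fourier_mat N)) = 1" using norm_ge_zero[of "det (fourier_mat N)"] by (auto simp: power2_eq_1_iff)
  then show "cmod (det (fourier_mat_adj N)) = 1"
    using arg_cong[OF 1, of cmod] by (simp add: norm_mult)
qed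

text \<open>With U, V the Fourier pair and D the diagonal of eigenvalues, the sum equals U D (V +
  E), where E is D^(-1) V W. The Fourier matrix acts on W from the left only, so column k of E comes
  from column k of W and the column norms of W itself survive; a conjugation would mix the
  columns.\<close>

lemma circulant_add_factorization:
  assumes N: "N > 0" and c: "\<And>l. l < N \<Longrightarrow> c l \<noteq> 0" and W: "W \<in> carrier_mat N N"
  shows "det (circulant_mat c N + W) = (\<Prod>l<N. c l) * det (fourier_mat_adj N) *
    det (fourier_mat N + mat N N (\<lambda>(l,k). (\<Sum>j<N. fourier_mat N $$ (l,j) * W $$ (j,k)) / c l))"
proof -
  let ?V = "fourier_mat N" and ?U = "fourier_mat_adj N"
  define D where "D = mat N N (\<lambda>(i,j). if i = j then c i else 0)"
  define E where "E = mat N N (\<lambda>(l,k). (\<Sum>j<N. ?V $$ (l,j) * W $$ (j,k)) / c l)"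
  have carr: "D \<in> carrier_mat N N" "E \<in> carrier_mat N N" by (auto simp: D_def E_def)
  have DM: "(D * M) $$ (l,k) = c l * M $$ (l,k)" if "M \<in> carrier_mat N N" "l < N" "k < N" for M l k
  proof -
    have "(D * M) $$ (l,k) = (\<Sum>i<N. D $$ (l,i) * M $$ (i,k))"
      using that carr by (simp add: scalar_prod_def atLeast0LessThan)
    also have "\<dots> = (\<Sum>i<N. (if l = i then c l * M $$ (i,k) else 0))"
      using that by (intro sum.cong) (auto simp: D_def)
    finally have "(D * M) $$ (l,k) = (\<Sum>i<N. (if l = i then c l * M $$ (i,k) else 0))" .
    then show ?thesis using that by simp
  qed
  have "D * E = ?V * W"
  proof (rule eq_matI)
    fix l k assume "l < dim_row (?V * W)" "k < dim_col (?V * W)"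
    then have lk: "l < N" "k < N" using W by (auto simp: fourier_mat_def)
    then show "(D * E) $$ (l,k) = (?V * W) $$ (l,k)"
      using DM[OF carr(2) lk] c[OF lk(1)] W carrier_matD[OF fourier_mat_carrier(1), of N]
      by (simp add: E_def scalar_prod_def atLeast0LessThan)
  qed (use carr W in \<open>auto simp: fourier_mat_def\<close>)
  moreover have "circulant_mat c N = ?U * (D * ?V)"
  proof (rule eq_matI)
    fix j k assume "j < dim_row (?U * (D * ?V))" "k < dim_col (?U * (D * ?V))"
    then have jk: "j < N" "k < N" by (auto simp: fourier_mat_def fourier_mat_adj_def)
    have "(?U * (D * ?V)) $$ (j,k) = (\<Sum>l<N. ?U $$ (j,l) * (D * ?V) $$ (l,k))"
      using jk carr carrier_matD[OF fourier_mat_carrier(1), of N] carrier_matD[OF fourier_mat_carrier(2), of N]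
      by (subst index_mult_mat(1)) (auto simp: scalar_prod_def atLeast0LessThan simp del: index_mult_mat(1))
    also have "\<dots> = circulant_mat c N $$ (j,k)"
      using jk DM[OF fourier_mat_carrier(1)] by (simp add: circulant_mat_def mult.assoc del: index_mult_mat(1))
    finally show "circulant_mat c N $$ (j,k) = (?U * (D * ?V)) $$ (j,k)" by simp
  qed (auto simp: fourier_mat_def fourier_mat_adj_def circulant_mat_def)
  moreover have "W = ?U * (?V * W)"
    using fourier_adj_times_fourier[OF N] W assoc_mult_mat[of ?U N N ?V N W N] by simp
  ultimately have "circulant_mat c N + W = ?U * (D * ?V) + ?U * (D * E)" by simp
  also have "\<dots> = ?U * (D * (?V + E))"
    using carr by (simp add: mult_add_distrib_mat[of _ N N _ N])
  finally have "det (circulant_mat c N + W) = det ?U * (det D * det (?V + E))"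
    using carr by (simp add: det_mult[of _ N])
  moreover have "det D = (\<Prod>l<N. c l)"
  proof -
    have "upper_triangular D" using carr by (auto simp: upper_triangular_def D_def)
    then show ?thesis
      using det_upper_triangular[OF _ carr(1)] by (simp add: prod_list_diag_prod atLeast0LessThan D_def)
  qed
  ultimately show ?thesis by (simp add: E_def mult_ac)
qed

lemma det_circulant:
  assumes N: "N > 0" and c: "\<And>l. l < N \<Longrightarrow> c l \<noteq> 0"
  shows "det (circulant_mat c N) = (\<Prod>l<N. c l)"
proof -
  have z: "circulant_mat c N + 0\<^sub>m N N = circulant_mat c N" by (simp add: circulant_mat_def)
  have "mat N N (\<lambda>(l,k). (\<Sum>j<N. fourier_mat N $$ (l,j) * (0\<^sub>m N N :: complex mat) $$ (j,k)) / c l) = 0\<^sub>m N N"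
    by (intro eq_matI) auto
  then show ?thesis
    using circulant_add_factorization[where c = c, OF N c zero_carrier_mat, unfolded z] det_fourier(1)[OF N]
    by (simp add: right_add_zero_mat[OF fourier_mat_carrier(1)] mult.assoc)
qed

text \<open>Column k of the last factor is a unit vector plus a vector of length at most |W e_k| /
  d, because the Fourier matrix is an isometry and the eigenvalues are at least d in modulus.
  Hadamard's inequality and 1 + x \<le> exp x finish the bound.\<close>

lemma det_circulant_add_le:
  assumes N: "N > 0" and d: "d > 0" and c: "\<And>l. l < N \<Longrightarrow> d \<le> cmod (c l)" and W: "W \<in> carrier_mat N N"
  shows "cmod (det (circulant_mat c N + W)) \<le> cmod (det (circulant_mat c N)) * exp (column_norm_sum N W / d)"
proof -
  let ?V = "fourier_mat N"
  define E where "E = mat N N (\<lambda>(l,k). (\<Sum>j<N. ?V $$ (l,j) * W $$ (j,k)) / c l)"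
  have E: "E \<in> carrier_mat N N" by (simp add: E_def)
  have c0: "c l \<noteq> 0" if "l < N" for l using c[OF that] d by auto
  have V1: "column_norm N ?V k = 1" if "k < N" for k
  proof -
    have "(\<Sum>l<N. (cmod (?V $$ (l,k)))\<^sup>2) = (\<Sum>l<N. 1 / real N)"
      using that by (intro sum.cong) (auto simp: fourier_mat_def norm_divide norm_power power_divide)
    then show ?thesis using N by (simp add: column_norm_def L2_set_def)
  qed
  have E1: "column_norm N E k \<le> column_norm N W k / d" if k: "k < N" for k
  proof -
    have "(cmod (E $$ (l,k)))\<^sup>2 \<le> (cmod (\<Sum>j<N. ?V $$ (l,j) * W $$ (j,k)))\<^sup>2 / d\<^sup>2" if l: "l < N" for l
    proof -
      have "cmod (E $$ (l,k)) = cmod (\<Sum>j<N. ?V $$ (l,j) * W $$ (j,k)) / cmod (c l)"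
        using l k by (simp add: E_def norm_divide)
      also have "\<dots> \<le> cmod (\<Sum>j<N. ?V $$ (l,j) * W $$ (j,k)) / d"
        using c[OF l] d by (intro divide_left_mono mult_pos_pos) auto
      finally have "(cmod (E $$ (l,k)))\<^sup>2 \<le> (cmod (\<Sum>j<N. ?V $$ (l,j) * W $$ (j,k)) / d)\<^sup>2"
        by (intro power_mono) auto
      then show ?thesis by (simp add: power_divide)
    qed
    then have "(\<Sum>l<N. (cmod (E $$ (l,k)))\<^sup>2) \<le> (\<Sum>l<N. (cmod (\<Sum>j<N. ?V $$ (l,j) * W $$ (j,k)))\<^sup>2 / d\<^sup>2)"
      by (intro sum_mono) auto
    also have "\<dots> = (\<Sum>j<N. (cmod (W $$ (j,k)))\<^sup>2) / d\<^sup>2"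
      unfolding sum_divide_distrib[symmetric] fourier_mat_isometry[OF N] ..
    finally have "sqrt (\<Sum>l<N. (cmod (E $$ (l,k)))\<^sup>2) \<le> sqrt ((\<Sum>j<N. (cmod (W $$ (j,k)))\<^sup>2) / d\<^sup>2)"
      by (rule real_sqrt_le_mono)
    then show ?thesis using d by (simp add: column_norm_def L2_set_def real_sqrt_divide)
  qed
  have "cmod (det (?V + E)) \<le> (\<Prod>k<N. column_norm N (?V + E) k)"
    using hadamard_det_le[of "?V + E" N] E by (simp add: column_norm_def L2_set_def)
  also have "\<dots> \<le> (\<Prod>k<N. exp (column_norm N W k / d))"
  proof (intro prod_mono conjI)
    fix k assume "k \<in> {..<N}"
    then have k: "k < N" by simp
    have "column_norm N (?V + E) k \<le> 1 + column_norm N W k / d"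
      using column_norm_add_le[OF fourier_mat_carrier(1) E k] V1[OF k] E1[OF k] by linarith
    also have "\<dots> \<le> exp (column_norm N W k / d)" by (rule exp_ge_add_one_self)
    finally show "column_norm N (?V + E) k \<le> exp (column_norm N W k / d)" .
  qed (simp add: column_norm_def)
  also have "\<dots> = exp (column_norm_sum N W / d)"
    by (simp add: exp_sum column_norm_sum_def sum_divide_distrib)
  finally have "cmod (det (?V + E)) \<le> exp (column_norm_sum N W / d)" .
  moreover have "cmod (det (circulant_mat c N + W)) = cmod (\<Prod>l<N. c l) * cmod (det (?V + E))"
    using circulant_add_factorization[where c = c, OF N c0 W] det_fourier(3)[OF N] by (simp add: norm_mult E_def)
  ultimately show ?thesis
    using det_circulant[where c = c, OF N c0] by (simp add: mult_left_mono)
qed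

text \<open>Counts the entries where the Toeplitz matrix with the single coefficient \<open>\<nu>\<close> and its periodization
  differ; this is where the weight \<open>|\<nu>|\<close> in the hypothesis comes from.\<close>

lemma card_wrapped_entries:
  assumes N: "N > 0"
  shows "card {(j, k). j < N \<and> k < N \<and> int N dvd \<nu> - (int j - int k) \<and> \<nu> \<noteq> int j - int k} \<le> nat \<bar>\<nu>\<bar>"
proof -
  let ?S = "{(j, k). j < N \<and> k < N \<and> int N dvd \<nu> - (int j - int k) \<and> \<nu> \<noteq> int j - int k}"
  \<comment> \<open>Divisibility says k = j - \<nu> modulo N, so j determines k. If moreover k
    differs from j - \<nu>, then j - \<nu> lies outside the range 0, ..., N - 1, and this happens in
    at most |\<nu>| rows j.\<close>
  let ?J = "{j. j < N \<and> (int j < \<nu> \<or> int j - \<nu> \<ge> int N)}"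
  have near: "m = 0" if "int N dvd m" "\<bar>m\<bar> < int N" for m
    using that dvd_imp_le_int[of m "int N"] by force
  have "inj_on fst ?S"
  proof (rule inj_onI)
    fix x y assume xy: "x \<in> ?S" "y \<in> ?S" "fst x = fst y"
    obtain j k j' k' where e: "x = (j,k)" "y = (j',k')" by (cases x, cases y) auto
    have "int N dvd \<nu> - (int j - int k)" "int N dvd \<nu> - (int j - int k')" using xy e by auto
    then have "int N dvd (\<nu> - (int j - int k)) - (\<nu> - (int j - int k'))" by (rule dvd_diff)
    then have "int N dvd int k - int k'" by simp
    moreover have "\<bar>int k - int k'\<bar> < int N" using xy e by auto
    ultimately have "int k - int k' = 0" by (rule near)
    then show "x = y" using xy e by simp
  qed
  moreover have "fst ` ?S \<subseteq> ?J"
  proof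
    fix j assume "j \<in> fst ` ?S"
    then obtain k where k: "j < N" "k < N" "int N dvd \<nu> - (int j - int k)" "\<nu> \<noteq> int j - int k" by auto
    have "\<not> \<bar>\<nu> - (int j - int k)\<bar> < int N" using near[OF k(3)] k(4) by auto
    then show "j \<in> ?J" using k(1,2) by auto
  qed
  moreover have "finite ?J" by simp
  ultimately have "card ?S \<le> card ?J" by (metis (no_types, lifting) card_image card_mono)
  also have "?J \<subseteq> (if \<nu> \<ge> 0 then {..<nat \<nu>} else {nat (int N + \<nu>)..<N})" by auto
  then have "card ?J \<le> card (if \<nu> \<ge> 0 then {..<nat \<nu>} else {nat (int N + \<nu>)..<N})" by (intro card_mono) auto
  also have "\<dots> \<le> nat \<bar>\<nu>\<bar>" by auto
  finally show ?thesis .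
qed

section \<open>Perturbations of Toeplitz matrices\<close>

lemma det_add_smult_polynomial:
  fixes A B :: "complex mat"
  assumes A: "A \<in> carrier_mat n n" and B: "B \<in> carrier_mat n n"
  shows "\<exists>p. \<forall>w. poly p w = det (A + w \<cdot>\<^sub>m B)"
proof -
  let ?p = "\<Sum>p\<in>{p. p permutes {0..<n}}. [:signof p:] * (\<Prod>i = 0..<n. [:A $$ (i, p i), B $$ (i, p i):])"
  have AB: "A + w \<cdot>\<^sub>m B \<in> carrier_mat n n" for w using A B by simp
  have "poly ?p w = det (A + w \<cdot>\<^sub>m B)" for w
    unfolding det_def'[OF AB] poly_sum poly_mult poly_prod
  proof (rule sum.cong[OF refl])
    fix p assume p: "p \<in> {p. p permutes {0..<n}}"
    have "(\<Prod>i = 0..<n. poly [:A $$ (i, p i), B $$ (i, p i):] w) = (\<Prod>i = 0..<n. (A + w \<cdot>\<^sub>m B) $$ (i, p i))"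
    proof (rule prod.cong[OF refl])
      fix i assume "i \<in> {0..<n}"
      moreover from this p have "p i < n" using permutes_in_image[of p "{0..<n}" i] by simp
      ultimately show "poly [:A $$ (i, p i), B $$ (i, p i):] w = (A + w \<cdot>\<^sub>m B) $$ (i, p i)"
        using A B by simp
    qed
    then show "poly [:signof p:] w * (\<Prod>i = 0..<n. poly [:A $$ (i, p i), B $$ (i, p i):] w) =
      signof p * (\<Prod>i = 0..<n. (A + w \<cdot>\<^sub>m B) $$ (i, p i))" by simp
  qed
  then show ?thesis by blast
qed

text \<open>The upper bound, valid for all complex multiples of \<open>E\<close>, implies the lower
  one: det(T + w E) / det T is 1 at w = 0 and grows at most like exp(|w| / 16).\<close>

lemma det_add_small_ge:
  fixes T E :: "complex mat"
  assumes T: "T \<in> carrier_mat N N" and E: "E \<in> carrier_mat N N" and T0: "det T \<noteq> 0"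
    and le: "\<And>W. W \<in> carrier_mat N N \<Longrightarrow> cmod (det (T + W)) \<le> cmod (det T) * exp (column_norm_sum N W / d)"
    and small: "column_norm_sum N E / d \<le> 1 / 16" and d: "d > 0"
  shows "cmod (det (T + E)) \<ge> cmod (det T) / 2"
proof -
  obtain p where p: "\<And>w. poly p w = det (T + w \<cdot>\<^sub>m E)" using det_add_smult_polynomial[OF T E] by blast
  have "T + 0 \<cdot>\<^sub>m E = T" using T E by (intro eq_matI) auto
  then have p0: "poly p 0 = det T" using p[of 0] by simp
  have "cmod (poly p 1 / det T) \<ge> 1 / 2"
  proof (rule holomorphic_one_near_one[where \<rho> = "column_norm_sum N E / d"])
    show "(\<lambda>w. poly p w / det T) holomorphic_on UNIV" using T0 by (intro holomorphic_intros) auto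
    show "poly p 0 / det T = 1" using p0 T0 by simp
    show "cmod (poly p t / det T) \<le> exp (column_norm_sum N E / d * cmod t)" for t
      using le[of "t \<cdot>\<^sub>m E"] E T0
      by (simp add: p norm_divide divide_le_eq column_norm_sum_smult mult_ac)
  qed (use small d in auto)
  moreover have "1 \<cdot>\<^sub>m E = E" using E by (intro eq_matI) auto
  then have "poly p 1 = det (T + E)" using p[of 1] by simp
  ultimately show ?thesis using T0 by (simp add: norm_divide field_simps)
qed

text \<open>The polynomial \<open>w \<mapsto> det (T + E + w R)\<close> has a bounded number of zeros near \<open>1\<close>,
  and each of them can spoil at most one of the equally spaced points \<open>1 + \<delta> k / N\<^sup>3\<close>.\<close>

lemma card_small_det_le:
  fixes T E R :: "complex mat"
  assumes T: "T \<in> carrier_mat N N" and E: "E \<in> carrier_mat N N" and R: "R \<in> carrier_mat N N"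
    and T0: "det T \<noteq> 0" and N: "N > 0"
    and le: "\<And>W. W \<in> carrier_mat N N \<Longrightarrow> cmod (det (T + W)) \<le> cmod (det T) * exp (column_norm_sum N W / d)"
    and small: "column_norm_sum N E / d \<le> 1 / 16" and d: "d > 0"
    and K: "column_norm_sum N R \<le> K"
    and \<delta>: "0 < \<delta>" "\<delta> \<le> 1"
    and M: "1 / 16 + 12 * K / d \<le> M" and n: "2 * exp M \<le> real n"
  shows "card {k. k < N\<^sup>2 \<and> cmod (det (T + (E + complex_of_real (1 + \<delta> * (real k / real N ^ 3)) \<cdot>\<^sub>m R))) <
    cmod (det T) * (exp (- 4 * M - 2) / 8 * (\<delta> / (2 * real N ^ 3)) ^ n)} \<le> n"
proof -
  have TE: "T + E \<in> carrier_mat N N" using T E by simp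
  obtain p where p: "\<And>w. poly p w = det (T + E + w \<cdot>\<^sub>m R)" using det_add_smult_polynomial[OF TE R] by blast
  define f where "f = Polynomial.smult (1 / det T) p"
  have f: "poly f w = det (T + (E + w \<cdot>\<^sub>m R)) / det T" for w
    using T E R by (simp add: f_def p assoc_add_mat)
  have "E + 0 \<cdot>\<^sub>m R = E" using E R by (intro eq_matI) auto
  then have f0: "cmod (poly f 0) \<ge> 1 / 2"
    using det_add_small_ge[OF T E T0 le small d] T0 by (simp add: f norm_divide field_simps)
  \<comment> \<open>The radius 12 is the one required by \<open>poly_lower_bound_by_roots\<close>.
    On that disc the multiples of \<open>R\<close> contribute 12 K / d and \<open>E\<close>
    contributes 1/16, which explains the condition on \<open>M\<close>.\<close>
  have fle: "cmod (poly f w) \<le> exp M" if w: "cmod w \<le> 12" for w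
  proof -
    have "column_norm_sum N (E + w \<cdot>\<^sub>m R) \<le> column_norm_sum N E + cmod w * column_norm_sum N R"
      using column_norm_sum_add_le[of E N "w \<cdot>\<^sub>m R"] E R by (simp add: column_norm_sum_smult)
    also have "\<dots> \<le> column_norm_sum N E + 12 * K"
      using w K by (intro add_left_mono mult_mono) auto
    finally have "column_norm_sum N (E + w \<cdot>\<^sub>m R) / d \<le> (column_norm_sum N E + 12 * K) / d"
      using d by (intro divide_right_mono) auto
    also have "\<dots> \<le> M" using small M unfolding add_divide_distrib by linarith
    finally have "exp (column_norm_sum N (E + w \<cdot>\<^sub>m R) / d) \<le> exp M" by simp
    then have "cmod (det T) * exp (column_norm_sum N (E + w \<cdot>\<^sub>m R) / d) \<le> cmod (det T) * exp M"
      by (intro mult_left_mono) auto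
    with le[of "E + w \<cdot>\<^sub>m R"] E R have "cmod (det (T + (E + w \<cdot>\<^sub>m R))) \<le> cmod (det T) * exp M"
      by (meson add_carrier_mat order_trans smult_carrier_mat)
    then show ?thesis using T0 by (simp add: f norm_divide divide_le_eq mult_ac)
  qed
  obtain ws where ws: "2 ^ length ws \<le> 2 * exp M"
    and low: "\<And>w. cmod w \<le> 2 \<Longrightarrow> exp (- 4 * M - 2) / 8 * prod_list (map (\<lambda>v. cmod (w - v)) ws) \<le> cmod (poly f w)"
    using poly_lower_bound_by_roots[OF f0 fle] by blast
  have len: "length ws \<le> n"
  proof -
    have "real (length ws) \<le> 2 ^ length ws"
      using of_nat_mono[OF less_imp_le[OF less_exp[of "length ws"]], where 'a = real] by simp
    then have "real (length ws) \<le> real n" using ws n by linarith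
    then show ?thesis by simp
  qed
  \<comment> \<open>Half the spacing of the test points, so that no zero is closer than \<eta> to
    two of them.\<close>
  define \<eta> where "\<eta> = \<delta> / (2 * real N ^ 3)"
  define pt where "pt k = complex_of_real (1 + \<delta> * (real k / real N ^ 3))" for k
  have N1: "real N ^ 3 \<ge> 1" using N by (simp add: one_le_power)
  have \<eta>: "0 < \<eta>" "\<eta> \<le> 1"
  proof -
    show "0 < \<eta>" using \<delta> N by (simp add: \<eta>_def)
    have "\<delta> \<le> 2 * real N ^ 3" using \<delta> N1 by linarith
    then show "\<eta> \<le> 1" using N by (simp add: \<eta>_def divide_le_eq)
  qed
  have pt2: "cmod (pt k) \<le> 2" if "k < N\<^sup>2" for k
  proof -
    have "real k \<le> real N ^ 2" using that by (metis less_imp_le of_nat_le_iff of_nat_power)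
    also have "\<dots> \<le> real N ^ 3" using N by (intro power_increasing) auto
    finally have "real k / real N ^ 3 \<le> 1" using N1 by (simp add: divide_le_eq)
    then have "\<delta> * (real k / real N ^ 3) \<le> 1 * 1" using \<delta> by (intro mult_mono) auto
    then show ?thesis unfolding pt_def norm_of_real using \<delta> by simp
  qed
  let ?bad = "{k. k < N\<^sup>2 \<and> cmod (det (T + (E + pt k \<cdot>\<^sub>m R))) < cmod (det T) * (exp (- 4 * M - 2) / 8 * \<eta> ^ n)}"
  \<comment> \<open>If every zero stays \<eta> away, the product over the zeros is at least
    \<eta>^n, as it has at most n factors and \<eta> \<le> 1. So a bad point must have a zero
    nearby.\<close>
  have near: "\<exists>v\<in>set ws. cmod (pt k - v) < \<eta>" if k: "k \<in> ?bad" for k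
  proof (rule ccontr)
    assume "\<not> ?thesis"
    then have far: "\<forall>v\<in>set ws. \<eta> \<le> cmod (pt k - v)" by auto
    have "\<eta> ^ length us \<le> prod_list (map (\<lambda>v. cmod (pt k - v)) us)" if "\<forall>v\<in>set us. \<eta> \<le> cmod (pt k - v)" for us
      using that \<eta>(1) by (induction us) (auto intro!: mult_mono)
    from this[OF far] have "\<eta> ^ length ws \<le> prod_list (map (\<lambda>v. cmod (pt k - v)) ws)" .
    moreover have "\<eta> ^ n \<le> \<eta> ^ length ws" using len \<eta> by (intro power_decreasing) auto
    ultimately have "exp (- 4 * M - 2) / 8 * \<eta> ^ n \<le> exp (- 4 * M - 2) / 8 * prod_list (map (\<lambda>v. cmod (pt k - v)) ws)"
      by (intro mult_left_mono) auto
    also have "\<dots> \<le> cmod (poly f (pt k))" using low pt2 k by simp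
    finally have "cmod (det T) * (exp (- 4 * M - 2) / 8 * \<eta> ^ n) \<le> cmod (det (T + (E + pt k \<cdot>\<^sub>m R)))"
      using T0 by (simp add: f norm_divide le_divide_eq mult_ac)
    then show False using k by simp
  qed
  have "\<forall>k\<in>?bad. \<exists>v. v \<in> set ws \<and> cmod (pt k - v) < \<eta>"
  proof
    fix k assume "k \<in> ?bad"
    from near[OF this] show "\<exists>v. v \<in> set ws \<and> cmod (pt k - v) < \<eta>" by blast
  qed
  from bchoice[OF this] obtain g where g': "\<forall>k\<in>?bad. g k \<in> set ws \<and> cmod (pt k - g k) < \<eta>" ..
  have g: "g k \<in> set ws" "cmod (pt k - g k) < \<eta>" if "k \<in> ?bad" for k
    using bspec[OF g' that] by simp_all
  have "inj_on g ?bad"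
  proof (rule inj_onI, rule ccontr)
    fix k l assume kl: "k \<in> ?bad" "l \<in> ?bad" "g k = g l" "k \<noteq> l"
    have "cmod (pt k - pt l) \<le> cmod (pt k - g k) + cmod (pt l - g k)"
      using norm_triangle_ineq4[of "pt k - g k" "pt l - g k"] by simp
    also have "\<dots> < \<eta> + \<eta>" using g(2)[OF kl(1)] g(2)[OF kl(2)] kl(3) by (intro add_strict_mono) auto
    also have "\<eta> + \<eta> = \<delta> / real N ^ 3" by (simp add: \<eta>_def)
    finally have lt: "cmod (pt k - pt l) < \<delta> / real N ^ 3" .
    have "pt k - pt l = complex_of_real (\<delta> / real N ^ 3 * (real k - real l))"
    proof -
      have "(1 + \<delta> * (real k / real N ^ 3)) - (1 + \<delta> * (real l / real N ^ 3)) = \<delta> / real N ^ 3 * (real k - real l)"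
        by (simp add: diff_divide_distrib right_diff_distrib)
      then show ?thesis unfolding pt_def of_real_diff[symmetric] by (simp only:)
    qed
    then have "cmod (pt k - pt l) = \<delta> / real N ^ 3 * \<bar>real k - real l\<bar>"
      using \<delta> by (simp only: norm_of_real) (simp add: abs_mult)
    moreover have "\<bar>real k - real l\<bar> \<ge> 1" using kl(4) by linarith
    then have "\<delta> / real N ^ 3 * 1 \<le> \<delta> / real N ^ 3 * \<bar>real k - real l\<bar>"
      using \<delta> by (intro mult_left_mono) auto
    ultimately show False using lt by simp
  qed
  moreover have "g ` ?bad \<subseteq> set ws" using g(1) by blast
  ultimately have "card ?bad \<le> card (set ws)" by (rule card_inj_on_le) simp
  also have "\<dots> \<le> n" using card_length[of ws] len by simp
  finally show ?thesis by (simp add: pt_def \<eta>_def)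
qed

section \<open>The Toeplitz matrix minus its circulant\<close>

abbreviation coeff_norm :: "(int \<Rightarrow> complex) \<Rightarrow> real" where
  "coeff_norm a \<equiv> \<Sum>\<^sub>\<infinity>\<nu>. cmod (a \<nu>)"

abbreviation weighted_norm :: "(int \<Rightarrow> complex) \<Rightarrow> real" where
  "weighted_norm a \<equiv> \<Sum>\<^sub>\<infinity>\<nu>. \<bar>real_of_int \<nu>\<bar> * cmod (a \<nu>)"

definition wrap_mat :: "(int \<Rightarrow> complex) \<Rightarrow> nat \<Rightarrow> complex mat" where
  "wrap_mat a N = toeplitz_mat a N + (-1) \<cdot>\<^sub>m circulant_mat (\<lambda>l. symbol a (unity_root N l)) N"

lemma toeplitz_mat_carrier [simp]: "toeplitz_mat a N \<in> carrier_mat N N"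
  by (simp add: toeplitz_mat_def)

lemma wrap_mat_carrier [simp]: "wrap_mat a N \<in> carrier_mat N N"
  by (simp add: wrap_mat_def)

lemma symbol_has_sum:
  assumes "(\<lambda>\<nu>. cmod (a \<nu>)) summable_on UNIV" and "cmod \<zeta> = 1"
  shows "((\<lambda>\<nu>. a \<nu> * \<zeta> powi \<nu>) has_sum symbol a \<zeta>) UNIV"
proof -
  have "(\<lambda>\<nu>. norm (a \<nu> * \<zeta> powi \<nu>)) summable_on UNIV"
  proof -
    have "norm (a \<nu> * \<zeta> powi \<nu>) = norm (a \<nu>)" for \<nu>
      unfolding norm_mult norm_power_int assms(2) by simp
    then show ?thesis using assms(1) by (simp only:)
  qed
  from has_sum_infsum[OF abs_summable_summable[OF this]] show ?thesis unfolding symbol_def .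
qed

text \<open>Aliasing: averaging over the N-th roots of unity retains exactly the coefficients with
  index congruent to j - k modulo N. The Toeplitz entry is the one term \<nu> = j - k, so the
  difference collects the others.\<close>

lemma wrap_mat_entry_le:
  assumes a: "(\<lambda>\<nu>. cmod (a \<nu>)) summable_on UNIV" and jk: "j < N" "k < N"
  shows "cmod (wrap_mat a N $$ (j, k)) \<le>
    (\<Sum>\<^sub>\<infinity>\<nu>. cmod (a \<nu>) * of_bool (int N dvd \<nu> - (int j - int k) \<and> \<nu> \<noteq> int j - int k))"
    and "(\<lambda>\<nu>. cmod (a \<nu>) * of_bool (int N dvd \<nu> - (int j - int k) \<and> \<nu> \<noteq> int j - int k)) summable_on UNIV"
proof -
  have N: "N > 0" using jk by simp
  let ?w = "\<lambda>\<nu>. int N dvd \<nu> - (int j - int k)"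
  show sm: "(\<lambda>\<nu>. cmod (a \<nu>) * of_bool (?w \<nu> \<and> \<nu> \<noteq> int j - int k)) summable_on UNIV"
    by (rule summable_on_comparison_test[OF a]) auto
  have "((\<lambda>\<nu>. a \<nu> * unity_root N l powi (\<nu> + (int k - int j))) has_sum
      symbol a (unity_root N l) * unity_root N l powi (int k - int j)) UNIV" for l
    using has_sum_cmult_left[OF symbol_has_sum[OF a cmod_unity_root[of N l]], where c = "unity_root N l powi (int k - int j)"]
    by (simp add: power_int_add mult.assoc)
  then have "((\<lambda>\<nu>. (\<Sum>l<N. a \<nu> * unity_root N l powi (\<nu> + (int k - int j)))) has_sum
      (\<Sum>l<N. symbol a (unity_root N l) * unity_root N l powi (int k - int j))) UNIV"
    by (intro has_sum_finite_sum) auto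
  from has_sum_cmult_left[OF this, of "1 / of_nat N"]
  have "((\<lambda>\<nu>. (\<Sum>l<N. a \<nu> * unity_root N l powi (\<nu> + (int k - int j))) * (1 / of_nat N)) has_sum
      circulant_mat (\<lambda>l. symbol a (unity_root N l)) N $$ (j, k)) UNIV"
    using fourier_adj_diag_fourier_entry[OF N jk, of "\<lambda>l. symbol a (unity_root N l)"] jk
    by (simp add: circulant_mat_def)
  moreover have "(\<Sum>l<N. a \<nu> * unity_root N l powi (\<nu> + (int k - int j))) * (1 / of_nat N) = a \<nu> * of_bool (?w \<nu>)" for \<nu>
  proof -
    have m: "\<nu> + (int k - int j) = \<nu> - (int j - int k)" by simp
    show ?thesis
      unfolding m sum_distrib_left[symmetric] sum_unity_root_powi[OF N] using N by simp
  qed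
  ultimately have circ: "((\<lambda>\<nu>. a \<nu> * of_bool (?w \<nu>)) has_sum
      circulant_mat (\<lambda>l. symbol a (unity_root N l)) N $$ (j, k)) UNIV" by simp
  have "((\<lambda>\<nu>. a \<nu> * of_bool (\<nu> = int j - int k)) has_sum (\<Sum>\<nu>\<in>{int j - int k}. a \<nu> * of_bool (\<nu> = int j - int k))) UNIV"
    by (rule has_sum_cong_neutral[THEN iffD1, OF _ _ _ has_sum_finite]) auto
  from has_sum_add[OF this has_sum_cmult_right[OF circ, of "-1"]]
  have "((\<lambda>\<nu>. a \<nu> * of_bool (\<nu> = int j - int k) + - 1 * (a \<nu> * of_bool (?w \<nu>))) has_sum wrap_mat a N $$ (j,k)) UNIV"
    using jk by (simp add: wrap_mat_def toeplitz_mat_def circulant_mat_def)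
  moreover have "a \<nu> * of_bool (\<nu> = int j - int k) + - 1 * (a \<nu> * of_bool (?w \<nu>)) =
      - (a \<nu> * of_bool (?w \<nu> \<and> \<nu> \<noteq> int j - int k))" for \<nu> by auto
  ultimately have "((\<lambda>\<nu>. - (a \<nu> * of_bool (?w \<nu> \<and> \<nu> \<noteq> int j - int k))) has_sum wrap_mat a N $$ (j,k)) UNIV" by simp
  moreover have "((\<lambda>\<nu>. norm (- (a \<nu> * of_bool (?w \<nu> \<and> \<nu> \<noteq> int j - int k)))) has_sum
      (\<Sum>\<^sub>\<infinity>\<nu>. cmod (a \<nu>) * of_bool (?w \<nu> \<and> \<nu> \<noteq> int j - int k))) UNIV"
  proof -
    have "cmod (of_bool P) = of_bool P" for P by (cases P) auto
    then show ?thesis using has_sum_infsum[OF sm] by (simp only: norm_mult norm_minus_cancel)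
  qed
  ultimately show "cmod (wrap_mat a N $$ (j, k)) \<le> (\<Sum>\<^sub>\<infinity>\<nu>. cmod (a \<nu>) * of_bool (?w \<nu> \<and> \<nu> \<noteq> int j - int k))"
    by (rule norm_has_sum_bound[rotated])
qed

text \<open>Summing over the positions first, the coefficient of index \<nu> is counted once for
  each entry into which it wraps, at most |\<nu>| times. The bound is therefore independent of
  N.\<close>

lemma sum_wrap_mat_le:
  assumes N: "N > 0" and a: "(\<lambda>\<nu>. cmod (a \<nu>)) summable_on UNIV"
    and a': "(\<lambda>\<nu>. \<bar>real_of_int \<nu>\<bar> * cmod (a \<nu>)) summable_on UNIV"
  shows "(\<Sum>k<N. \<Sum>j<N. cmod (wrap_mat a N $$ (j, k))) \<le> weighted_norm a"
proof -
  let ?w = "\<lambda>j k \<nu>. int N dvd \<nu> - (int j - int k) \<and> \<nu> \<noteq> int j - int k"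
  let ?s = "\<lambda>j k. \<Sum>\<^sub>\<infinity>\<nu>. cmod (a \<nu>) * of_bool (?w j k \<nu>)"
  have "(\<Sum>k<N. \<Sum>j<N. cmod (wrap_mat a N $$ (j, k))) \<le> (\<Sum>k<N. \<Sum>j<N. ?s j k)"
    by (intro sum_mono wrap_mat_entry_le(1) a) auto
  also have "\<dots> \<le> weighted_norm a"
  proof (rule has_sum_mono)
    show "((\<lambda>\<nu>. \<Sum>k<N. \<Sum>j<N. cmod (a \<nu>) * of_bool (?w j k \<nu>)) has_sum (\<Sum>k<N. \<Sum>j<N. ?s j k)) UNIV"
      by (intro has_sum_finite_sum has_sum_infsum wrap_mat_entry_le(2)[OF a]) auto
    show "((\<lambda>\<nu>. \<bar>real_of_int \<nu>\<bar> * cmod (a \<nu>)) has_sum weighted_norm a) UNIV"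
      by (rule has_sum_infsum[OF a'])
    fix \<nu> :: int
    have "(\<Sum>k<N. \<Sum>j<N. cmod (a \<nu>) * of_bool (?w j k \<nu>)) = cmod (a \<nu>) * (\<Sum>j<N. \<Sum>k<N. of_bool (?w j k \<nu>))"
      by (subst sum.swap) (simp only: sum_distrib_left)
    also have "(\<Sum>j<N. \<Sum>k<N. of_bool (?w j k \<nu>)) = (\<Sum>(j,k)\<in>{..<N} \<times> {..<N}. of_bool (?w j k \<nu>) :: real)"
      by (rule sum.cartesian_product)
    also have "\<dots> = (\<Sum>x\<in>{..<N} \<times> {..<N}. if ?w (fst x) (snd x) \<nu> then 1 else 0)"
      by (intro sum.cong) auto
    also have "\<dots> = real (card {x\<in>{..<N} \<times> {..<N}. ?w (fst x) (snd x) \<nu>})"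
      by (simp flip: sum.inter_filter)
    also have "{x\<in>{..<N} \<times> {..<N}. ?w (fst x) (snd x) \<nu>} = {(j, k). j < N \<and> k < N \<and> ?w j k \<nu>}" by auto
    also have "cmod (a \<nu>) * real (card \<dots>) \<le> cmod (a \<nu>) * real (nat \<bar>\<nu>\<bar>)"
      using card_wrapped_entries[OF N, of \<nu>] by (intro mult_left_mono) auto
    finally show "(\<Sum>k<N. \<Sum>j<N. cmod (a \<nu>) * of_bool (?w j k \<nu>)) \<le> \<bar>real_of_int \<nu>\<bar> * cmod (a \<nu>)"
      by (simp add: mult.commute)
  qed
  finally show ?thesis .
qed

lemma circulant_mat_shift:
  assumes N: "N > 0"
  shows "circulant_mat (\<lambda>l. c l - z) N = circulant_mat c N + (- z) \<cdot>\<^sub>m 1\<^sub>m N"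
proof (rule eq_matI)
  fix j k assume "j < dim_row (circulant_mat c N + (- z) \<cdot>\<^sub>m 1\<^sub>m N)" "k < dim_col (circulant_mat c N + (- z) \<cdot>\<^sub>m 1\<^sub>m N)"
  then have jk: "j < N" "k < N" by auto
  have "(fourier_mat_adj N * fourier_mat N) $$ (j,k) = (\<Sum>l<N. fourier_mat_adj N $$ (j,l) * fourier_mat N $$ (l,k))"
    using jk by (simp add: scalar_prod_def atLeast0LessThan carrier_matD[OF fourier_mat_carrier(1)] carrier_matD[OF fourier_mat_carrier(2)])
  then have "(\<Sum>l<N. fourier_mat_adj N $$ (j,l) * fourier_mat N $$ (l,k)) = (if j = k then 1 else 0)"
    using fourier_adj_times_fourier[OF N] jk by simp
  moreover have "circulant_mat (\<lambda>l. c l - z) N $$ (j,k) = circulant_mat c N $$ (j,k) -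
      z * (\<Sum>l<N. fourier_mat_adj N $$ (j,l) * fourier_mat N $$ (l,k))"
    using jk by (simp add: circulant_mat_def algebra_simps sum_subtractf sum_distrib_left)
  ultimately show "circulant_mat (\<lambda>l. c l - z) N $$ (j,k) = (circulant_mat c N + (- z) \<cdot>\<^sub>m 1\<^sub>m N) $$ (j,k)"
    using jk by (simp add: circulant_mat_def)
qed (auto simp: circulant_mat_def)

section \<open>Empirical measures and the symbol curve\<close>

lemma poly_prod_linear: "poly (\<Prod>e\<leftarrow>es. [:- e, 1:]) z = (\<Prod>e\<leftarrow>es. z - e)" for z :: complex
  by (induction es) (auto simp: algebra_simps)

lemma order_prod_linear:
  fixes es :: "complex list"
  shows "Polynomial.order z (\<Prod>e\<leftarrow>es. [:- e, 1:]) = card {i. i < length es \<and> es ! i = z}"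
proof -
  have nz: "(\<Prod>e\<leftarrow>us. [:- e, 1:]) \<noteq> (0 :: complex poly)" for us :: "complex list"
    by (auto simp: prod_list_zero_iff)
  have "Polynomial.order z (\<Prod>e\<leftarrow>es. [:- e, 1:]) = length (filter (\<lambda>e. e = z) es)"
  proof (induction es)
    case (Cons e es)
    have ord1: "Polynomial.order z [:- e, 1:] = (if e = z then 1 else 0)"
      using order_linear_power[of z "- e" 1] by auto
    have "[:- e, 1:] * (\<Prod>e\<leftarrow>es. [:- e, 1:]) \<noteq> 0" using nz[of "e # es"] by (simp only: list.map prod_list.Cons not_False_eq_True)
    then have "Polynomial.order z (\<Prod>e\<leftarrow>e # es. [:- e, 1:]) =
        Polynomial.order z [:- e, 1:] + Polynomial.order z (\<Prod>e\<leftarrow>es. [:- e, 1:])"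
      unfolding list.map prod_list.Cons by (rule order_mult)
    then show ?case unfolding ord1 Cons.IH by simp
  qed simp
  then show ?thesis by (simp add: length_filter_conv_card)
qed

text \<open>Passing from distinct eigenvalues weighted by multiplicity to a list with repetitions
  makes the measure an image of the uniform law on indices, and integrals become averages.\<close>

lemma empirical_measure_eq_distr:
  assumes A: "A \<in> carrier_mat N N" and es: "char_poly A = (\<Prod>e\<leftarrow>es. [:- e, 1:])" "length es = N"
  shows "empirical_measure A = distr (uniform_count_measure {..<N}) borel (\<lambda>i. es ! i)"
proof (rule measure_eqI)
  fix B assume "B \<in> sets (empirical_measure A)"
  then have B: "B \<in> sets borel" by simp
  have sp: "spectrum A = set es"
    unfolding spectrum_root_char_poly[OF A] es(1) by (auto simp: poly_prod_linear prod_list_zero_iff)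
  have "(\<Sum>z\<in>spectrum A. of_nat (Polynomial.order z (char_poly A)) * indicator B z :: ennreal) =
      (\<Sum>z\<in>set es. \<Sum>i\<in>{i\<in>{..<N}. es ! i = z}. indicator B (es ! i))"
    unfolding sp es(1) order_prod_linear by (intro sum.cong refl) (simp add: es(2))
  also have "\<dots> = (\<Sum>i<N. indicator B (es ! i))"
    using es(2) by (intro sum.group) auto
  also have "\<dots> = of_nat (card {i\<in>{..<N}. es ! i \<in> B})"
    by (simp add: indicator_def of_bool_def flip: sum.inter_filter)
  finally have "emeasure (empirical_measure A) B = ennreal (1 / real N) * of_nat (card {i\<in>{..<N}. es ! i \<in> B})"
    using A by (simp add: emeasure_empirical_measure[OF B])
  also have "\<dots> = ennreal (real (card {i\<in>{..<N}. es ! i \<in> B}) / real N)"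
    by (simp add: ennreal_of_nat_eq_real_of_nat ennreal_mult'[symmetric])
  also have "\<dots> = emeasure (uniform_count_measure {..<N}) {i\<in>{..<N}. es ! i \<in> B}"
    by (subst emeasure_uniform_count_measure) auto
  also have "\<dots> = emeasure (distr (uniform_count_measure {..<N}) borel (\<lambda>i. es ! i)) B"
    using B by (subst emeasure_distr) (auto intro!: arg_cong2[where f = emeasure] simp: space_uniform_count_measure)
  finally show "emeasure (empirical_measure A) B = emeasure (distr (uniform_count_measure {..<N}) borel (\<lambda>i. es ! i)) B" .
qed simp

lemma integral_empirical_measure:
  fixes f :: "complex \<Rightarrow> real"
  assumes A: "A \<in> carrier_mat N N" and es: "char_poly A = (\<Prod>e\<leftarrow>es. [:- e, 1:])" "length es = N"
    and [measurable]: "f \<in> borel_measurable borel"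
  shows "(\<integral>z. f z \<partial>empirical_measure A) = (\<Sum>i<N. f (es ! i)) / real N"
proof -
  have "(\<integral>z. f z \<partial>empirical_measure A) = (\<integral>i. f (es ! i) \<partial>uniform_count_measure {..<N})"
    unfolding empirical_measure_eq_distr[OF A es] by (rule integral_distr) auto
  also have "\<dots> = (\<Sum>i<N. f (es ! i)) / real N"
    unfolding uniform_count_measure_def
    by (subst lebesgue_integral_point_measure_finite) (auto simp: sum_divide_distrib)
  finally show ?thesis .
qed

lemma cmod_det_shift_eq_prod:
  fixes A :: "complex mat"
  assumes A: "A \<in> carrier_mat N N" and es: "char_poly A = (\<Prod>e\<leftarrow>es. [:- e, 1:])" "length es = N"
  shows "cmod (det (A + (- z) \<cdot>\<^sub>m 1\<^sub>m N)) = (\<Prod>i<N. cmod (z - es ! i))"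
proof -
  let ?M = "A + (- z) \<cdot>\<^sub>m 1\<^sub>m N"
  have M: "?M \<in> carrier_mat N N" using A by simp
  have "char_matrix A z = ?M" using A by (auto simp: char_matrix_def)
  then have "poly (char_poly A) z = det (- ?M)" using char_poly_matrix[OF A] by simp
  also have "- ?M = (-1) \<cdot>\<^sub>m ?M" using M by (intro eq_matI) auto
  also have "det \<dots> = (-1) ^ N * det ?M" using A by simp
  finally have "cmod (det ?M) = cmod (poly (char_poly A) z)" by (simp add: norm_mult norm_power)
  also have "poly (char_poly A) z = (\<Prod>e\<leftarrow>es. z - e)" unfolding es(1) by (rule poly_prod_linear)
  also have "\<dots> = (\<Prod>i<N. z - es ! i)"
    using es(2) by (simp add: prod.list_conv_set_nth atLeast0LessThan)
  finally show ?thesis by (simp add: prod_norm)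
qed

text \<open>Read the eigenvector equation in the coordinate of largest modulus. This confines the
  spectrum to a fixed disc, as the replacement principle requires.\<close>

lemma cmod_eigenvalue_le_row_sum:
  fixes A :: "complex mat"
  assumes A: "A \<in> carrier_mat N N" and es: "char_poly A = (\<Prod>e\<leftarrow>es. [:- e, 1:])" "length es = N"
    and i: "i < N" and le: "\<And>j. j < N \<Longrightarrow> (\<Sum>k<N. cmod (A $$ (j,k))) \<le> C"
  shows "cmod (es ! i) \<le> C"
proof -
  let ?e = "es ! i"
  have "poly (char_poly A) ?e = 0"
    using i es by (auto simp: poly_prod_linear prod_list_zero_iff)
  then have "eigenvalue A ?e" using eigenvalue_root_char_poly[OF A] by simp
  then obtain v where v: "v \<in> carrier_vec N" "v \<noteq> 0\<^sub>v N" "A *\<^sub>v v = ?e \<cdot>\<^sub>v v"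
    using A by (auto simp: eigenvalue_def eigenvector_def)
  have N: "N > 0" using i by simp
  define m where "m = Max ((\<lambda>j. cmod (v $ j)) ` {..<N})"
  have fin: "finite ((\<lambda>j. cmod (v $ j)) ` {..<N})" "(\<lambda>j. cmod (v $ j)) ` {..<N} \<noteq> {}" using N by auto
  obtain j where j: "j < N" "cmod (v $ j) = m" using Max_in[OF fin] unfolding m_def by force
  have mle: "cmod (v $ k) \<le> m" if "k < N" for k using Max_ge[OF fin(1)] that by (auto simp: m_def)
  have "m > 0"
  proof (rule ccontr)
    assume "\<not> m > 0"
    then have "cmod (v $ k) \<le> 0" if "k < N" for k using mle[OF that] by linarith
    then have "v = 0\<^sub>v N" using v(1) by (intro eq_vecI) auto
    then show False using v(2) by simp
  qed
  have "?e * v $ j = (A *\<^sub>v v) $ j" using v j by simp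
  also have "\<dots> = (\<Sum>k<N. A $$ (j,k) * v $ k)"
    using A v(1) j by (simp add: scalar_prod_def atLeast0LessThan)
  finally have "cmod ?e * m = cmod (\<Sum>k<N. A $$ (j,k) * v $ k)" using j(2) by (metis norm_mult)
  also have "\<dots> \<le> (\<Sum>k<N. cmod (A $$ (j,k)) * m)"
    using mle by (intro sum_norm_le) (auto simp: norm_mult intro!: mult_left_mono)
  also have "\<dots> \<le> C * m"
    unfolding sum_distrib_right[symmetric] using le[OF j(1)] \<open>m > 0\<close> by (intro mult_right_mono) auto
  finally show ?thesis using \<open>m > 0\<close> by simp
qed

text \<open>The argument of \<open>G\<close> is the left endpoint of the cell of length h containing
  \<theta>, which makes the Riemann sum an exact integral.\<close>

lemma has_bochner_integral_step_function:
  fixes G :: "real \<Rightarrow> real"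
  assumes h: "h > 0"
  shows "has_bochner_integral lborel (\<lambda>\<theta>. indicator {0..<h * real n} \<theta> *\<^sub>R G (h * of_int \<lfloor>\<theta> / h\<rfloor>))
    (h * (\<Sum>j<n. G (h * real j)))"
proof (induction n)
  case (Suc n)
  have le: "h * real n \<le> h * real (Suc n)" "0 \<le> h * real n" using h by (auto intro!: mult_left_mono)
  have "has_bochner_integral lborel (\<lambda>\<theta>. indicator {h * real n..<h * real (Suc n)} \<theta> *\<^sub>R G (h * real n))
      (measure lborel {h * real n..<h * real (Suc n)} *\<^sub>R G (h * real n))"
    using le by (intro has_bochner_integral_indicator) auto
  moreover have "measure lborel {h * real n..<h * real (Suc n)} = h"
    using le by (simp add: algebra_simps)
  ultimately have "has_bochner_integral lborel (\<lambda>\<theta>. indicator {h * real n..<h * real (Suc n)} \<theta> *\<^sub>R G (h * real n))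
      (h * G (h * real n))" by simp
  from has_bochner_integral_add[OF Suc this]
  have "has_bochner_integral lborel (\<lambda>\<theta>. indicator {0..<h * real n} \<theta> *\<^sub>R G (h * of_int \<lfloor>\<theta> / h\<rfloor>) +
     indicator {h * real n..<h * real (Suc n)} \<theta> *\<^sub>R G (h * real n)) (h * (\<Sum>j<n. G (h * real j)) + h * G (h * real n))" .
  also have "(\<lambda>\<theta>. indicator {0..<h * real n} \<theta> *\<^sub>R G (h * of_int \<lfloor>\<theta> / h\<rfloor>) +
     indicator {h * real n..<h * real (Suc n)} \<theta> *\<^sub>R G (h * real n)) =
     (\<lambda>\<theta>. indicator {0..<h * real (Suc n)} \<theta> *\<^sub>R G (h * of_int \<lfloor>\<theta> / h\<rfloor>))"
  proof
    fix \<theta>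
    have "\<lfloor>\<theta> / h\<rfloor> = int n" if "h * real n \<le> \<theta>" "\<theta> < h * real (Suc n)"
      using that h by (intro floor_unique) (auto simp: field_simps)
    then show "indicator {0..<h * real n} \<theta> *\<^sub>R G (h * of_int \<lfloor>\<theta> / h\<rfloor>) +
     indicator {h * real n..<h * real (Suc n)} \<theta> *\<^sub>R G (h * real n) =
     indicator {0..<h * real (Suc n)} \<theta> *\<^sub>R G (h * of_int \<lfloor>\<theta> / h\<rfloor>)"
      using le by (auto simp: indicator_def)
  qed
  finally show ?case by (simp add: distrib_left)
qed (simp add: has_bochner_integral_zero)

text \<open>Each Riemann sum is the integral of a step function; the endpoints of the cells converge
  to \<theta>, so dominated convergence applies with the bound K.\<close>

lemma riemann_sum_tendsto:
  fixes G :: "real \<Rightarrow> real"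
  assumes T: "T > 0" and G: "continuous_on UNIV G" and bd: "\<And>x. \<bar>G x\<bar> \<le> K"
  shows "(\<lambda>N. (\<Sum>j<N. G (T * real j / real N)) / real N) \<longlonglongrightarrow> (\<integral>\<theta>. indicator {0..<T} \<theta> *\<^sub>R G \<theta> \<partial>lborel) / T"
proof -
  have [measurable]: "G \<in> borel_measurable borel" using G by (rule borel_measurable_continuous_onI)
  define S where "S N \<theta> = indicator {0..<T} \<theta> *\<^sub>R G (T / real N * of_int \<lfloor>\<theta> / (T / real N)\<rfloor>)" for N \<theta>
  have [measurable]: "S N \<in> borel_measurable borel" for N unfolding S_def[abs_def] by measurable
  have "(\<lambda>N. \<integral>\<theta>. S N \<theta> \<partial>lborel) \<longlonglongrightarrow> (\<integral>\<theta>. indicator {0..<T} \<theta> *\<^sub>R G \<theta> \<partial>lborel)"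
  proof (rule integral_dominated_convergence[where w = "\<lambda>\<theta>. indicator {0..<T} \<theta> *\<^sub>R K"])
    show "integrable lborel (\<lambda>\<theta>. indicator {0..<T} \<theta> *\<^sub>R K)"
      using T by (intro integrable_real_mult_indicator integrable_scaleR_left integrable_real_indicator) auto
    show "AE \<theta> in lborel. (\<lambda>N. S N \<theta>) \<longlonglongrightarrow> indicator {0..<T} \<theta> *\<^sub>R G \<theta>"
    proof (rule AE_I2)
      fix \<theta>
      have "(\<lambda>N. T / real N * of_int \<lfloor>\<theta> / (T / real N)\<rfloor>) \<longlonglongrightarrow> \<theta>"
      proof (rule LIM_zero_cancel, rule Lim_null_comparison)
        show "\<forall>\<^sub>F N in sequentially. norm (T / real N * of_int \<lfloor>\<theta> / (T / real N)\<rfloor> - \<theta>) \<le> T / real N"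
          using eventually_gt_at_top[of 0]
        proof eventually_elim
          case (elim N)
          define h where "h = T / real N"
          have h: "h > 0" using T elim by (simp add: h_def)
          have fl: "of_int \<lfloor>\<theta> / h\<rfloor> \<le> \<theta> / h" "\<theta> / h < of_int \<lfloor>\<theta> / h\<rfloor> + 1" using floor_correct[of "\<theta> / h"] by auto
          have "of_int \<lfloor>\<theta> / h\<rfloor> * h \<le> \<theta>" "\<theta> < (of_int \<lfloor>\<theta> / h\<rfloor> + 1) * h"
            using fl unfolding pos_le_divide_eq[OF h] pos_divide_less_eq[OF h] .
          then have "h * of_int \<lfloor>\<theta> / h\<rfloor> \<le> \<theta>" "\<theta> < h * of_int \<lfloor>\<theta> / h\<rfloor> + h"
            by (simp_all add: algebra_simps)
          then show ?case unfolding h_def[symmetric] real_norm_def by linarith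
        qed
        show "(\<lambda>N. T / real N) \<longlonglongrightarrow> 0" by real_asymp
      qed
      then have "(\<lambda>N. G (T / real N * of_int \<lfloor>\<theta> / (T / real N)\<rfloor>)) \<longlonglongrightarrow> G \<theta>"
        using continuous_on_tendsto_compose[OF G] by simp
      then show "(\<lambda>N. S N \<theta>) \<longlonglongrightarrow> indicator {0..<T} \<theta> *\<^sub>R G \<theta>"
        unfolding S_def by (intro tendsto_intros)
    qed
    show "AE \<theta> in lborel. norm (S N \<theta>) \<le> indicator {0..<T} \<theta> *\<^sub>R K" for N
      using bd by (intro AE_I2) (auto simp: S_def indicator_def)
  qed measurable
  from tendsto_divide[OF this tendsto_const[of T]] T
  have "(\<lambda>N. (\<integral>\<theta>. S N \<theta> \<partial>lborel) / T) \<longlonglongrightarrow> (\<integral>\<theta>. indicator {0..<T} \<theta> *\<^sub>R G \<theta> \<partial>lborel) / T" by simp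
  moreover have "\<forall>\<^sub>F N in sequentially. (\<integral>\<theta>. S N \<theta> \<partial>lborel) / T = (\<Sum>j<N. G (T * real j / real N)) / real N"
    using eventually_gt_at_top[of 0]
  proof eventually_elim
    case (elim N)
    have "T / real N > 0" "T / real N * real N = T" using T elim by auto
    with has_bochner_integral_integral_eq[OF has_bochner_integral_step_function[of "T / real N" N G]]
    have "(\<integral>\<theta>. S N \<theta> \<partial>lborel) = T / real N * (\<Sum>j<N. G (T / real N * real j))"
      unfolding S_def by simp
    then show ?case using T by simp
  qed
  ultimately show ?thesis by (blast intro: Lim_transform_eventually)
qed


section \<open>Regularity of the symbol and its curve\<close>

context
  fixes a :: "int \<Rightarrow> complex"
  assumes a: "(\<lambda>\<nu>. cmod (a \<nu>)) summable_on UNIV"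
    and a': "(\<lambda>\<nu>. \<bar>real_of_int \<nu>\<bar> * cmod (a \<nu>)) summable_on UNIV"
begin

lemma cmod_cis_diff_le: "cmod (cis x - cis y) \<le> \<bar>x - y\<bar>"
proof -
  have "cmod (cis x - cis y) = cmod (cis y * (cis (x - y) - 1))"
    by (simp add: cis_divide[symmetric] right_diff_distrib)
  also have "\<dots> = cmod (cis (x - y) - 1)" by (simp add: norm_mult)
  also have "\<dots> \<le> \<bar>x - y\<bar>"
  proof -
    have "(cmod (cis t - 1))\<^sup>2 = (2 * sin (t / 2))\<^sup>2" for t
    proof -
      have "(cmod (cis t - 1))\<^sup>2 = (cos t - 1)\<^sup>2 + (sin t)\<^sup>2" by (simp add: cmod_power2)
      also have "\<dots> = 2 - 2 * cos t"
        using sin_cos_squared_add[of t] by (simp add: power2_diff)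
      also have "cos t = 1 - 2 * (sin (t / 2))\<^sup>2" using cos_double_sin[of "t / 2"] by simp
      finally show ?thesis by (simp add: power_mult_distrib)
    qed
    from this[of "x - y"] have "sqrt ((cmod (cis (x - y) - 1))\<^sup>2) = sqrt ((2 * sin ((x - y) / 2))\<^sup>2)"
      by (rule arg_cong)
    then have "cmod (cis (x - y) - 1) = \<bar>2 * sin ((x - y) / 2)\<bar>"
      by (simp only: real_sqrt_abs abs_norm_cancel)
    also have "\<dots> \<le> 2 * \<bar>(x - y) / 2\<bar>"
      using abs_sin_x_le_abs_x[of "(x - y) / 2"] by (simp add: abs_mult)
    finally show ?thesis by simp
  qed
  finally show ?thesis .
qed

lemma powi_diff_le:
  fixes z w :: complex
  assumes "cmod z = 1" "cmod w = 1"
  shows "cmod (z powi n - w powi n) \<le> \<bar>real_of_int n\<bar> * cmod (z - w)"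
proof (cases "n \<ge> 0")
  case True
  then show ?thesis
    using norm_power_diff[of z w "nat n"] assms by (simp add: power_int_def)
next
  case False
  \<comment> \<open>Inversion is an isometry on the unit circle, which reduces negative exponents to
    positive ones.\<close>
  have "cmod (inverse z - inverse w) = cmod (z - w)"
  proof -
    have "inverse z - inverse w = (w - z) / (z * w)"
    proof -
      have "z \<noteq> 0" "w \<noteq> 0" using assms by auto
      then show ?thesis by (simp add: diff_divide_distrib inverse_eq_divide)
    qed
    then show ?thesis using assms by (simp add: norm_divide norm_mult norm_minus_commute)
  qed
  then show ?thesis
    using norm_power_diff[of "inverse z" "inverse w" "nat (- n)"] assms False
    by (simp add: power_int_def norm_inverse)
qed

text \<open>The summability of |\<nu>| |a_\<nu>| serves a second time here. Lipschitz regularity,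
  beyond mere continuity, is what makes the symbol curve a null set of the plane.\<close>

lemma symbol_lipschitz:
  assumes "cmod z = 1" "cmod w = 1"
  shows "cmod (symbol a z - symbol a w) \<le> weighted_norm a * cmod (z - w)"
proof -
  let ?f = "\<lambda>\<nu>. a \<nu> * z powi \<nu> + - (a \<nu> * w powi \<nu>)"
  have "((\<lambda>\<nu>. - (a \<nu> * w powi \<nu>)) has_sum - symbol a w) UNIV"
    using symbol_has_sum[OF a assms(2)] by (simp add: has_sum_uminus)
  from has_sum_add[OF symbol_has_sum[OF a assms(1)] this]
  have f: "(?f has_sum (symbol a z - symbol a w)) UNIV" by simp
  have g: "((\<lambda>\<nu>. \<bar>real_of_int \<nu>\<bar> * cmod (a \<nu>) * cmod (z - w)) has_sum
      weighted_norm a * cmod (z - w)) UNIV"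
    by (intro has_sum_cmult_left has_sum_infsum a')
  have le: "norm (?f \<nu>) \<le> \<bar>real_of_int \<nu>\<bar> * cmod (a \<nu>) * cmod (z - w)" for \<nu>
  proof -
    have "?f \<nu> = a \<nu> * (z powi \<nu> - w powi \<nu>)" by (simp add: right_diff_distrib)
    then have "norm (?f \<nu>) = cmod (a \<nu>) * cmod (z powi \<nu> - w powi \<nu>)" by (simp only: norm_mult)
    also have "\<dots> \<le> cmod (a \<nu>) * (\<bar>real_of_int \<nu>\<bar> * cmod (z - w))"
      by (intro mult_left_mono powi_diff_le assms) auto
    finally show ?thesis by (simp add: mult_ac)
  qed
  have sn: "(\<lambda>\<nu>. norm (?f \<nu>)) summable_on UNIV"
    by (rule summable_on_comparison_test[OF has_sum_imp_summable[OF g]]) (use le in auto)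
  have "norm (symbol a z - symbol a w) \<le> infsum (\<lambda>\<nu>. norm (?f \<nu>)) UNIV"
    by (rule norm_has_sum_bound[OF has_sum_infsum[OF sn] f])
  also have "\<dots> \<le> weighted_norm a * cmod (z - w)"
    by (rule has_sum_mono[OF has_sum_infsum[OF sn] g]) (rule le)
  finally show ?thesis .
qed

lemma symbol_cis_lipschitz:
  "cmod (symbol a (cis x) - symbol a (cis y)) \<le> weighted_norm a * \<bar>x - y\<bar>"
proof -
  have "weighted_norm a \<ge> 0" by (intro infsum_nonneg) auto
  then have "weighted_norm a * cmod (cis x - cis y) \<le>
      weighted_norm a * \<bar>x - y\<bar>"
    by (intro mult_left_mono cmod_cis_diff_le)
  with symbol_lipschitz[of "cis x" "cis y"] show ?thesis by simp
qed

lemma continuous_symbol_cis: "continuous_on UNIV (\<lambda>\<theta>. symbol a (cis \<theta>))"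
proof -
  let ?K = "weighted_norm a"
  have "?K \<ge> 0" by (intro infsum_nonneg) auto
  then have "?K-lipschitz_on UNIV (\<lambda>\<theta>. symbol a (cis \<theta>))"
    by (intro lipschitz_onI) (use symbol_cis_lipschitz in \<open>auto simp: dist_norm\<close>)
  then show ?thesis by (rule lipschitz_on_continuous_on)
qed

lemma cmod_symbol_le:
  assumes "cmod \<zeta> = 1"
  shows "cmod (symbol a \<zeta>) \<le> coeff_norm a"
proof -
  have "norm (a \<nu> * \<zeta> powi \<nu>) = norm (a \<nu>)" for \<nu>
    unfolding norm_mult norm_power_int assms by simp
  then have "((\<lambda>\<nu>. norm (a \<nu> * \<zeta> powi \<nu>)) has_sum coeff_norm a) UNIV"
    using has_sum_infsum[OF a] by (simp only:)
  from norm_has_sum_bound[OF this symbol_has_sum[OF a assms]] show ?thesis .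
qed

text \<open>One period of the parameter covers the curve, so it is compact. A point off the curve
  thus has a positive distance from it.\<close>

lemma closed_symbol_curve: "closed (range (\<lambda>\<theta>. symbol a (cis \<theta>)))"
proof -
  have "range (\<lambda>\<theta>. symbol a (cis \<theta>)) = (\<lambda>\<theta>. symbol a (cis \<theta>)) ` {0..2 * pi}"
  proof (intro equalityI subsetI)
    fix w assume "w \<in> range (\<lambda>\<theta>. symbol a (cis \<theta>))"
    then obtain \<theta> where \<theta>: "w = symbol a (cis \<theta>)" by auto
    obtain t where t: "0 \<le> t" "t < 2 * pi" "cos \<theta> = cos t" "sin \<theta> = sin t"
      using sincos_total_2pi[of "cos \<theta>" "sin \<theta>"] by auto
    then have "cis \<theta> = cis t" by (simp add: complex_eq_iff)
    then show "w \<in> (\<lambda>\<theta>. symbol a (cis \<theta>)) ` {0..2 * pi}" using t \<theta> by auto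
  qed auto
  moreover have "compact ((\<lambda>\<theta>. symbol a (cis \<theta>)) ` {0..2 * pi})"
    by (intro compact_continuous_image continuous_on_subset[OF continuous_symbol_cis]) auto
  ultimately show ?thesis by (simp add: compact_imp_closed)
qed

text \<open>The curve is the image of a line in the plane under a Lipschitz map of the plane to
  itself: \<open>F\<close> ignores the second coordinate. Such maps preserve null sets.\<close>

lemma AE_not_on_symbol_curve:
  "AE z in square_measure B. Complex (fst z) (snd z) \<notin> range (\<lambda>\<theta>. symbol a (cis \<theta>))"
proof -
  let ?K = "weighted_norm a"
  define F :: "real \<times> real \<Rightarrow> real \<times> real" where
    "F x = (Re (symbol a (cis (fst x))), Im (symbol a (cis (fst x))))" for x
  let ?S = "{x :: real \<times> real. x \<bullet> (0, 1) = 0}"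
  have K: "?K \<ge> 0" by (intro infsum_nonneg) auto
  have "negligible (F ` ?S)"
  proof (rule negligible_locally_Lipschitz_image)
    show "negligible ?S" by (rule negligible_standard_hyperplane) (simp add: Basis_prod_def)
    fix x :: "real \<times> real"
    have "norm (F y - F x) \<le> ?K * norm (y - x)" for y
    proof -
      have "norm (F y - F x) = cmod (symbol a (cis (fst y)) - symbol a (cis (fst x)))"
        by (simp add: F_def norm_Pair cmod_def)
      also have "\<dots> \<le> ?K * \<bar>fst y - fst x\<bar>" by (rule symbol_cis_lipschitz)
      also have "\<dots> \<le> ?K * norm (y - x)"
        using K norm_fst_le[of "fst (y - x)" "snd (y - x)"] unfolding prod.collapse
        by (intro mult_left_mono) auto
      finally show ?thesis .
    qed
    then show "\<exists>T B. open T \<and> x \<in> T \<and> (\<forall>y\<in>?S \<inter> T. norm (F y - F x) \<le> B * norm (y - x))"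
      by (intro exI[of _ UNIV] exI[of _ ?K]) auto
  qed simp
  then have "F ` ?S \<in> null_sets lebesgue" by (simp add: negligible_iff_null_sets)
  then have "AE z in lebesgue. z \<notin> F ` ?S" by (rule AE_not_in)
  then have ae0: "AE z in lborel. z \<notin> F ` ?S" by (simp only: AE_completion_iff)
  have on_curve: "z \<in> F ` ?S" if "Complex (fst z) (snd z) \<in> range (\<lambda>\<theta>. symbol a (cis \<theta>))" for z
  proof -
    from that obtain \<theta> where "Complex (fst z) (snd z) = symbol a (cis \<theta>)" by auto
    then have "z = F (\<theta>, 0)" by (simp add: F_def prod_eq_iff complex_eq_iff)
    moreover have "(\<theta>, 0) \<in> ?S" by simp
    ultimately show ?thesis by (rule image_eqI)
  qed
  have ae: "AE z in lborel \<Otimes>\<^sub>M lborel. Complex (fst z) (snd z) \<notin> range (\<lambda>\<theta>. symbol a (cis \<theta>))"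
    unfolding lborel_prod using ae0 by eventually_elim (use on_curve in blast)
  define w :: "real \<times> real \<Rightarrow> ennreal" where
    "w = (\<lambda>(x, y). ennreal (indicator {-B..B} x) * ennreal (indicator {-B..B} y))"
  have w: "w \<in> borel_measurable (lborel \<Otimes>\<^sub>M lborel)" unfolding w_def by measurable
  have sq: "square_measure B = density (lborel \<Otimes>\<^sub>M lborel) w"
    using segment.sigma_finite_measure_axioms[of B] unfolding segment_measure_def w_def
    by (intro pair_measure_density) (auto simp: lborel.sigma_finite_measure_axioms)
  show ?thesis
    unfolding sq AE_density[OF w] using ae by eventually_elim auto
qed

text \<open>Since \<open>circle_measure\<close> lives on the circle, measurability of the symbol is
  taken with respect to the restricted Borel sets, where it follows from the Lipschitz
  bound.\<close>

lemma integral_limit_measure: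
  fixes f :: "complex \<Rightarrow> real"
  assumes f: "continuous_on UNIV f"
  shows "(\<integral>z. f z \<partial>distr (scale_measure (ennreal (1 / (2 * pi))) circle_measure) borel (symbol a)) =
    (\<integral>\<theta>. indicator {0..<2 * pi} \<theta> *\<^sub>R f (symbol a (cis \<theta>)) \<partial>lborel) / (2 * pi)"
proof -
  let ?R = "restrict_space borel (sphere 0 1) :: complex measure"
  have [measurable]: "f \<in> borel_measurable borel" using f by (rule borel_measurable_continuous_onI)
  let ?K = "weighted_norm a"
  have "?K \<ge> 0" by (intro infsum_nonneg) auto
  then have "?K-lipschitz_on (sphere 0 1) (symbol a)"
    by (intro lipschitz_onI) (use symbol_lipschitz in \<open>auto simp: dist_norm\<close>)
  then have "continuous_on (sphere 0 1) (symbol a)" by (rule lipschitz_on_continuous_on)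
  then have sym: "symbol a \<in> borel_measurable ?R"
    by (rule borel_measurable_continuous_on_restrict)
  have sets_circle: "sets circle_measure = sets ?R" by (simp add: circle_measure_def)
  have symc: "symbol a \<in> borel_measurable circle_measure"
    using sym measurable_cong_sets[OF sets_circle refl] by blast
  have fsym: "(\<lambda>z. f (symbol a z)) \<in> borel_measurable ?R" using sym by measurable
  have fsymc: "(\<lambda>z. f (symbol a z)) \<in> borel_measurable circle_measure" using symc by measurable
  have scale: "scale_measure (ennreal (1 / (2 * pi))) circle_measure = density circle_measure (\<lambda>_. ennreal (1 / (2 * pi)))"
    by (rule measure_eqI) (auto simp: emeasure_density_const)
  have cis: "cis \<in> measurable (restrict_space lborel {0..<2 * pi}) ?R"
  proof (rule measurable_restrict_space2)
    have "cis \<in> borel_measurable borel" by (intro borel_measurable_continuous_onI continuous_intros)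
    then show "cis \<in> borel_measurable (restrict_space lborel {0..<2 * pi})"
      by (intro measurable_restrict_space1) simp
  qed auto
  have "(\<integral>z. f z \<partial>distr (scale_measure (ennreal (1 / (2 * pi))) circle_measure) borel (symbol a)) =
      (\<integral>z. f (symbol a z) \<partial>density circle_measure (\<lambda>_. ennreal (1 / (2 * pi))))"
    unfolding scale using symc by (intro integral_distr) auto
  also have "\<dots> = (\<integral>z. (1 / (2 * pi)) *\<^sub>R f (symbol a z) \<partial>circle_measure)"
    using fsymc by (intro integral_density) auto
  also have "\<dots> = (\<integral>z. f (symbol a z) \<partial>circle_measure) / (2 * pi)" by simp
  also have "(\<integral>z. f (symbol a z) \<partial>circle_measure) = (\<integral>\<theta>. f (symbol a (cis \<theta>)) \<partial>restrict_space lborel {0..<2 * pi})"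
    unfolding circle_measure_def by (rule integral_distr[OF cis fsym])
  also have "\<dots> = (\<integral>\<theta>. indicator {0..<2 * pi} \<theta> *\<^sub>R f (symbol a (cis \<theta>)) \<partial>lborel)"
    by (rule integral_restrict_space) simp
  finally show ?thesis .
qed

end

section \<open>Anti-concentration for Gaussian matrices\<close>

lemma borel_measurable_det:
  fixes A :: "'a \<Rightarrow> complex mat"
  assumes carr: "\<And>x. x \<in> space M \<Longrightarrow> A x \<in> carrier_mat N N"
    and meas: "\<And>i j. i < N \<Longrightarrow> j < N \<Longrightarrow> (\<lambda>x. A x $$ (i, j)) \<in> borel_measurable M"
  shows "(\<lambda>x. det (A x)) \<in> borel_measurable M"
proof -
  have "(\<lambda>x. \<Sum>p\<in>{p. p permutes {0..<N}}. signof p * (\<Prod>i = 0..<N. A x $$ (i, p i))) \<in> borel_measurable M"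
  proof (intro borel_measurable_sum borel_measurable_times borel_measurable_const borel_measurable_prod)
    fix p i assume "p \<in> {p. p permutes {0..<N}}" "i \<in> {0..<N}"
    then have "i < N" "p i < N" using permutes_in_image[of p "{0..<N}" i] by auto
    then show "(\<lambda>x. A x $$ (i, p i)) \<in> borel_measurable M" by (rule meas)
  qed
  then show ?thesis
    by (subst measurable_cong[OF det_def'[OF carr]])
qed

lemma summable_on_reindexed_sum_le:
  fixes g :: "int \<Rightarrow> real"
  assumes "g summable_on UNIV" "\<And>\<nu>. g \<nu> \<ge> 0"
  shows "(\<Sum>k<N. g (j - int k)) \<le> infsum g UNIV"
proof -
  have "(\<Sum>k<N. g (j - int k)) = sum g ((\<lambda>k. j - int k) ` {..<N})"
    by (subst sum.reindex) (auto intro!: inj_onI)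
  also have "\<dots> \<le> infsum g UNIV"
    using assms by (intro finite_sum_le_infsum) auto
  finally show ?thesis .
qed

locale gaussian_matrix = prob_space M for M :: "'w measure" +
  fixes N :: nat and Q :: "'w \<Rightarrow> complex mat"
  assumes N: "N > 0" and gaussian: "complex_gaussian_matrix M N Q"
begin

definition idx :: "(nat \<times> nat) set" where "idx = {..<N} \<times> {..<N}"

definition entries :: "'w \<Rightarrow> nat \<times> nat \<Rightarrow> complex" where
  "entries \<omega> = (\<lambda>ij\<in>idx. Q \<omega> $$ ij)"

lemma Q_carrier: "\<omega> \<in> space M \<Longrightarrow> Q \<omega> \<in> carrier_mat N N"
  using gaussian by (simp add: complex_gaussian_matrix_def)

lemma Q_entry_measurable:
  assumes "i < N" "j < N"
  shows "(\<lambda>\<omega>. Q \<omega> $$ (i, j)) \<in> borel_measurable M"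
proof -
  have "random_variable borel (case (i, j) of (i, j) \<Rightarrow> \<lambda>\<omega>. Q \<omega> $$ (i, j))"
    using gaussian assms unfolding complex_gaussian_matrix_def indep_vars_def2 by blast
  then show ?thesis by simp
qed

lemma Q_entry_distr: "i < N \<Longrightarrow> j < N \<Longrightarrow> distr M borel (\<lambda>\<omega>. Q \<omega> $$ (i, j)) = std_complex_normal"
  using gaussian by (simp add: complex_gaussian_matrix_def)

text \<open>The Gaussian integral is not computed: the density has total mass 1 because it is the
  law of an entry.\<close>

lemma prob_std_complex_normal: "prob_space std_complex_normal"
  using prob_space_distr[OF Q_entry_measurable[OF N N]] Q_entry_distr[OF N N] by simp

lemma entries_measurable [measurable]: "entries \<in> measurable M (PiM idx (\<lambda>_. borel))"
  unfolding entries_def[abs_def] by (rule measurable_restrict) (auto simp: idx_def Q_entry_measurable)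

text \<open>Turns the independence of the entries into the product measure to which the translation
  estimates apply.\<close>

lemma distr_entries: "distr M (PiM idx (\<lambda>_. borel)) entries = PiM idx (\<lambda>_. std_complex_normal)"
proof -
  let ?X = "\<lambda>(i, j) \<omega>. Q \<omega> $$ (i, j)"
  have "idx \<noteq> {}" using N by (auto simp: idx_def)
  moreover have "random_variable borel (?X ij)" if "ij \<in> idx" for ij
    using that Q_entry_measurable by (auto simp: idx_def)
  moreover have "indep_vars (\<lambda>_. borel) ?X idx"
    using gaussian by (simp add: complex_gaussian_matrix_def idx_def)
  ultimately have "distr M (PiM idx (\<lambda>_. borel)) (\<lambda>\<omega>. \<lambda>ij\<in>idx. ?X ij \<omega>) = (PiM idx (\<lambda>ij. distr M borel (?X ij)))"
    using indep_vars_iff_distr_eq_PiM'[where I = idx and M' = "\<lambda>_. borel" and X = ?X] by blast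
  also have "\<dots> = PiM idx (\<lambda>_. std_complex_normal)"
    by (rule PiM_cong) (auto simp: idx_def Q_entry_distr)
  also have "(\<lambda>\<omega>. \<lambda>ij\<in>idx. ?X ij \<omega>) = entries"
    by (auto simp: entries_def fun_eq_iff restrict_def)
  finally show ?thesis .
qed

lemma prob_entry_large:
  assumes "0 \<le> b"
  shows "prob {\<omega>\<in>space M. \<exists>i<N. \<exists>j<N. b < cmod (Q \<omega> $$ (i,j))} \<le> (real N)\<^sup>2 * (2 * exp (- b\<^sup>2 / 2))"
    and "{\<omega>\<in>space M. \<exists>i<N. \<exists>j<N. b < cmod (Q \<omega> $$ (i,j))} \<in> events"
proof -
  let ?E = "\<lambda>ij. {\<omega>\<in>space M. b < cmod (Q \<omega> $$ ij)}"
  have E: "?E ij \<in> events" if "ij \<in> idx" for ij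
    using that Q_entry_measurable by (auto simp: idx_def)
  have U: "{\<omega>\<in>space M. \<exists>i<N. \<exists>j<N. b < cmod (Q \<omega> $$ (i,j))} = (\<Union>ij\<in>idx. ?E ij)"
    by (auto simp: idx_def)
  have fin: "finite idx" by (simp add: idx_def)
  show "{\<omega>\<in>space M. \<exists>i<N. \<exists>j<N. b < cmod (Q \<omega> $$ (i,j))} \<in> events"
    unfolding U using E fin by auto
  have "prob (?E ij) \<le> 2 * exp (- b\<^sup>2 / 2)" if ij: "ij \<in> idx" for ij
  proof -
    obtain i j where ij': "ij = (i, j)" "i < N" "j < N" using ij by (auto simp: idx_def)
    have "emeasure M (?E ij) = emeasure (distr M borel (\<lambda>\<omega>. Q \<omega> $$ (i, j))) {x. b < cmod x}"
      using ij' Q_entry_measurable[of i j] by (subst emeasure_distr) (auto intro!: arg_cong2[where f = emeasure])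
    also have "\<dots> \<le> ennreal (2 * exp (- b\<^sup>2 / 2)) * emeasure std_complex_normal UNIV"
      using emeasure_std_complex_normal_tail[OF assms] ij' by (simp add: Q_entry_distr)
    also have "emeasure std_complex_normal UNIV = 1"
      using prob_space.emeasure_space_1[OF prob_std_complex_normal] by simp
    finally show ?thesis by (simp add: emeasure_eq_measure)
  qed
  then have "(\<Sum>ij\<in>idx. prob (?E ij)) \<le> (\<Sum>ij\<in>idx. 2 * exp (- b\<^sup>2 / 2))" by (intro sum_mono)
  also have "\<dots> = (real N)\<^sup>2 * (2 * exp (- b\<^sup>2 / 2))" by (simp add: idx_def power2_eq_square)
  finally have "(\<Sum>ij\<in>idx. prob (?E ij)) \<le> (real N)\<^sup>2 * (2 * exp (- b\<^sup>2 / 2))" .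
  moreover have "prob (\<Union>ij\<in>idx. ?E ij) \<le> (\<Sum>ij\<in>idx. prob (?E ij))"
    using E fin by (intro finite_measure_subadditive_finite) auto
  ultimately show "prob {\<omega>\<in>space M. \<exists>i<N. \<exists>j<N. b < cmod (Q \<omega> $$ (i,j))} \<le> (real N)\<^sup>2 * (2 * exp (- b\<^sup>2 / 2))"
    unfolding U by simp
qed

text \<open>Translating the noise moves the determinant along the line T + \<delta> Q + w
  \<open>R\<close>, on which at most n of the N^2 test points are bad. The translates have
  comparable Gaussian weight, so the bad event has probability at most a constant times n /
  N^2.\<close>

lemma prob_small_det:
  fixes T R :: "complex mat" and \<delta> d K b L :: real
  assumes T: "T \<in> carrier_mat N N" and R: "R \<in> carrier_mat N N" and T0: "det T \<noteq> 0" and d: "d > 0"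
    and le: "\<And>W. W \<in> carrier_mat N N \<Longrightarrow> cmod (det (T + W)) \<le> cmod (det T) * exp (column_norm_sum N W / d)"
    and K: "(\<Sum>k<N. \<Sum>j<N. cmod (R $$ (j, k))) \<le> K"
    and \<delta>: "0 < \<delta>" "\<delta> \<le> 1" and b: "0 \<le> b" "b \<le> real N"
    and small: "\<delta> * (real N * sqrt (real N) * (b + K)) / d \<le> 1 / 16"
    and L: "1 / 16 + 12 * K / d \<le> L" and n: "2 * exp L \<le> real n"
  defines "bad \<equiv> {\<omega>\<in>space M. (\<forall>i<N. \<forall>j<N. cmod (Q \<omega> $$ (i, j)) \<le> b) \<and>
    cmod (det (T + (complex_of_real \<delta> \<cdot>\<^sub>m Q \<omega> + R))) <
    cmod (det T) * (exp (- 4 * L - 2) / 8 * (\<delta> / (2 * real N ^ 3)) ^ n)}"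
  shows "prob bad \<le> exp (2 * K + K\<^sup>2) * real n / (real N)\<^sup>2" and "bad \<in> events"
proof -
  define thr where "thr = cmod (det T) * (exp (- 4 * L - 2) / 8 * (\<delta> / (2 * real N ^ 3)) ^ n)"
  define F where "F x = cmod (det (T + (complex_of_real \<delta> \<cdot>\<^sub>m mat N N x + R)))" for x
  let ?P = "PiM idx (\<lambda>_. borel) :: (nat \<times> nat \<Rightarrow> complex) measure"
  define S where "S = {x\<in>space ?P. (\<forall>ij\<in>idx. cmod (x ij) \<le> b) \<and> F x < thr}"
  \<comment> \<open>Adding \<open>c k\<close> to the noise replaces \<open>R\<close> by (1 +
    \<delta> k / N^3) \<open>R\<close>: the factor \<delta> in front of the noise is where the
    spacing \<delta> / N^3 comes from.\<close>
  define c where "c k ij = complex_of_real (real k / real N ^ 3) * R $$ ij" for k ij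
  have fin: "finite idx" by (simp add: idx_def)
  have N1: "real N \<ge> 1" using N by simp
  have K0: "0 \<le> K" by (rule order_trans[OF _ K]) (simp add: sum_nonneg)
  have Fm: "F \<in> borel_measurable ?P"
  proof -
    have "(\<lambda>x. det (T + (complex_of_real \<delta> \<cdot>\<^sub>m mat N N x + R))) \<in> borel_measurable ?P"
    proof (rule borel_measurable_det)
      fix i j assume ij: "i < N" "j < N"
      then have "(i, j) \<in> idx" by (simp add: idx_def)
      then have "(\<lambda>x. x (i, j)) \<in> borel_measurable ?P" by (rule measurable_component_singleton)
      then have "(\<lambda>x. T $$ (i, j) + (complex_of_real \<delta> * x (i, j) + R $$ (i, j))) \<in> borel_measurable ?P" by measurable
      then show "(\<lambda>x. (T + (complex_of_real \<delta> \<cdot>\<^sub>m mat N N x + R)) $$ (i, j)) \<in> borel_measurable ?P"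
        using ij T R by simp
    qed (use T R in auto)
    then show ?thesis unfolding F_def[abs_def] by measurable
  qed
  have S: "S \<in> sets ?P"
  proof -
    have "(\<lambda>x. x ij) \<in> borel_measurable ?P" if "ij \<in> idx" for ij
      using that by (rule measurable_component_singleton)
    then show ?thesis using Fm fin unfolding S_def by measurable
  qed
  have sumR: "(\<Sum>ij\<in>idx. cmod (R $$ ij)) \<le> K"
  proof -
    have "(\<Sum>ij\<in>idx. cmod (R $$ ij)) = (\<Sum>j<N. \<Sum>k<N. cmod (R $$ (j, k)))"
      unfolding idx_def by (simp add: sum.cartesian_product)
    also have "\<dots> = (\<Sum>k<N. \<Sum>j<N. cmod (R $$ (j, k)))" by (rule sum.swap)
    finally show ?thesis using K by simp
  qed
  have Rle: "cmod (R $$ ij) \<le> K" if "ij \<in> idx" for ij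
    using member_le_sum[of ij idx "\<lambda>ij. cmod (R $$ ij)"] fin that sumR by simp
  have u: "real k / real N ^ 3 \<le> 1 / real N" if "k < N\<^sup>2" for k
  proof -
    have "real k \<le> real N ^ 2" using that by (metis less_imp_le of_nat_le_iff of_nat_power)
    then have "real k / real N ^ 3 \<le> real N ^ 2 / real N ^ 3" by (intro divide_right_mono) auto
    also have "\<dots> = 1 / real N" using N by (simp add: eval_nat_numeral)
    finally show ?thesis .
  qed
  have cle: "cmod (c k ij) \<le> cmod (R $$ ij) / real N" if "k < N\<^sup>2" for k ij
  proof -
    have "cmod (c k ij) = real k / real N ^ 3 * cmod (R $$ ij)"
      by (simp add: c_def norm_mult norm_divide norm_power)
    also have "\<dots> \<le> 1 / real N * cmod (R $$ ij)" using u[OF that] by (intro mult_right_mono) auto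
    finally show ?thesis by simp
  qed
  have cle': "cmod (c k ij) \<le> K" if "k < N\<^sup>2" "ij \<in> idx" for k ij
  proof -
    have "cmod (R $$ ij) / real N \<le> cmod (R $$ ij) / 1" using N1 by (intro divide_left_mono) auto
    then show ?thesis using cle[OF that(1), of ij] Rle[OF that(2)] by simp
  qed
  have matc: "complex_of_real \<delta> \<cdot>\<^sub>m mat N N (translate idx (c k) x) + R =
      complex_of_real \<delta> \<cdot>\<^sub>m mat N N x + complex_of_real (1 + \<delta> * (real k / real N ^ 3)) \<cdot>\<^sub>m R" for k x
    using R by (intro eq_matI) (auto simp: translate_def idx_def c_def algebra_simps)
  have card: "card {k. k < N\<^sup>2 \<and> translate idx (c k) x \<in> S} \<le> n" for x
  proof (cases "\<exists>k<N\<^sup>2. translate idx (c k) x \<in> S")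
    case False
    then have "{k. k < N\<^sup>2 \<and> translate idx (c k) x \<in> S} = {}" by auto
    then show ?thesis by (simp only: card.empty)
  next
    case True
    then obtain k0 where k0: "k0 < N\<^sup>2" "translate idx (c k0) x \<in> S" by blast
    \<comment> \<open>A single translate in \<open>S\<close> already bounds the untranslated entries
      by b + K, so \<delta> times this matrix is a small perturbation of \<open>T\<close> and the
      count of bad points applies.\<close>
    have xle: "cmod (x ij) \<le> b + K" if "ij \<in> idx" for ij
    proof -
      have "cmod (x ij + c k0 ij) \<le> b" using k0(2) that by (auto simp: S_def translate_def)
      moreover have "cmod (x ij) \<le> cmod (x ij + c k0 ij) + cmod (c k0 ij)"
        using norm_triangle_ineq4[of "x ij + c k0 ij" "c k0 ij"] by simp
      ultimately show ?thesis using cle'[OF k0(1) that] by linarith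
    qed
    let ?E = "complex_of_real \<delta> \<cdot>\<^sub>m mat N N x"
    have "column_norm_sum N ?E = \<delta> * column_norm_sum N (mat N N x)"
      using \<delta> by (subst column_norm_sum_smult) auto
    also have "\<dots> \<le> \<delta> * (real N * sqrt (real N) * (b + K))"
      using \<delta> xle b K0 by (intro mult_left_mono column_norm_sum_le_entry_bound) (auto simp: idx_def)
    finally have "column_norm_sum N ?E / d \<le> \<delta> * (real N * sqrt (real N) * (b + K)) / d"
      using d by (intro divide_right_mono) auto
    with small have E: "column_norm_sum N ?E / d \<le> 1 / 16" by linarith
    have "column_norm_sum N R \<le> K" using column_norm_sum_le_entry_sum[of N R] K by linarith
    note card_small_det_le[OF T _ R T0 N le E d this \<delta> L n]
    then have "card {k. k < N\<^sup>2 \<and> cmod (det (T + (?E + complex_of_real (1 + \<delta> * (real k / real N ^ 3)) \<cdot>\<^sub>m R))) < thr} \<le> n"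
      unfolding thr_def by simp
    moreover have "{k. k < N\<^sup>2 \<and> translate idx (c k) x \<in> S} \<subseteq>
        {k. k < N\<^sup>2 \<and> cmod (det (T + (?E + complex_of_real (1 + \<delta> * (real k / real N ^ 3)) \<cdot>\<^sub>m R))) < thr}"
      by (auto simp: S_def F_def matc)
    moreover have "finite {k. k < N\<^sup>2 \<and> cmod (det (T + (?E + complex_of_real (1 + \<delta> * (real k / real N ^ 3)) \<cdot>\<^sub>m R))) < thr}"
      by simp
    ultimately show ?thesis by (meson card_mono order_trans)
  qed
  have Csum: "(\<Sum>ij\<in>idx. 2 * b * cmod (c k ij) + (cmod (c k ij))\<^sup>2) \<le> 2 * K + K\<^sup>2" if k: "k < N\<^sup>2" for k
  proof -
    have "(\<Sum>ij\<in>idx. cmod (c k ij)) \<le> (\<Sum>ij\<in>idx. cmod (R $$ ij) / real N)"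
      by (intro sum_mono cle k)
    also have "\<dots> \<le> K / real N"
      unfolding sum_divide_distrib[symmetric] using sumR by (intro divide_right_mono) auto
    finally have s1: "(\<Sum>ij\<in>idx. cmod (c k ij)) \<le> K / real N" .
    have "(\<Sum>ij\<in>idx. (cmod (c k ij))\<^sup>2) \<le> (\<Sum>ij\<in>idx. K * cmod (c k ij))"
      unfolding power2_eq_square using cle'[OF k] by (intro sum_mono mult_right_mono) auto
    also have "\<dots> = K * (\<Sum>ij\<in>idx. cmod (c k ij))" by (simp add: sum_distrib_left)
    also have "\<dots> \<le> K * (K / real N)" using s1 K0 by (intro mult_left_mono) auto
    also have "\<dots> \<le> K * (K / 1)" using K0 N1 by (intro mult_left_mono divide_left_mono) auto
    finally have s2: "(\<Sum>ij\<in>idx. (cmod (c k ij))\<^sup>2) \<le> K\<^sup>2" by (simp add: power2_eq_square)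
    \<comment> \<open>Entries up to b \<le> N are balanced by translations of total size at most K /
      N, which leaves a cost independent of N.\<close>
    have "2 * b * (\<Sum>ij\<in>idx. cmod (c k ij)) \<le> 2 * real N * (K / real N)"
      using s1 b by (intro mult_mono) (auto simp: sum_nonneg)
    also have "\<dots> = 2 * K" using N by simp
    finally show ?thesis using s2 by (simp add: sum.distrib sum_distrib_left)
  qed
  have main: "of_nat (N\<^sup>2) * emeasure (PiM idx (\<lambda>_. std_complex_normal)) S \<le> ennreal (exp (2 * K + K\<^sup>2)) * of_nat n"
    by (rule gaussian_product_avoiding_translates[OF fin prob_std_complex_normal S, where b = b and c = c])
      (use Csum card in \<open>auto simp: S_def\<close>)
  have bad_eq: "bad = entries -` S \<inter> space M"
  proof (intro equalityI subsetI)
    fix \<omega> assume w: "\<omega> \<in> bad"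
    then have \<omega>: "\<omega> \<in> space M" by (simp add: bad_def)
    have "mat N N (entries \<omega>) = Q \<omega>"
      using Q_carrier[OF \<omega>] by (intro eq_matI) (auto simp: entries_def idx_def)
    then show "\<omega> \<in> entries -` S \<inter> space M"
      using w \<omega> measurable_space[OF entries_measurable \<omega>]
      by (auto simp: bad_def S_def F_def thr_def entries_def idx_def)
  next
    fix \<omega> assume w: "\<omega> \<in> entries -` S \<inter> space M"
    then have \<omega>: "\<omega> \<in> space M" by simp
    have "mat N N (entries \<omega>) = Q \<omega>"
      using Q_carrier[OF \<omega>] by (intro eq_matI) (auto simp: entries_def idx_def)
    then show "\<omega> \<in> bad"
      using w by (auto simp: bad_def S_def F_def thr_def entries_def idx_def)
  qed
  show "bad \<in> events" unfolding bad_eq using S by measurable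
  have "emeasure M bad = emeasure (distr M ?P entries) S"
    unfolding bad_eq using S by (intro emeasure_distr[symmetric]) measurable
  then have "ennreal (real (N\<^sup>2) * prob bad) \<le> ennreal (exp (2 * K + K\<^sup>2) * real n)"
    using main by (simp add: distr_entries emeasure_eq_measure ennreal_mult' ennreal_of_nat_eq_real_of_nat)
  then have "real (N\<^sup>2) * prob bad \<le> exp (2 * K + K\<^sup>2) * real n" by (simp add: ennreal_le_iff)
  then show "prob bad \<le> exp (2 * K + K\<^sup>2) * real n / (real N)\<^sup>2"
    using N by (simp add: field_simps)
qed

end

section \<open>Almost sure convergence\<close>

text \<open>The exponent budget: N^(3/2) from the column norms and N^\<epsilon> from the largest
  entry leave at most N^(-\<epsilon>) after multiplication by
  N^(-\<open>\<delta>\<^sub>1\<close>).\<close>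

lemma tendsto_perturbation_size:
  fixes K \<epsilon> \<delta>\<^sub>1 :: real
  assumes "\<epsilon> > 0" "3 / 2 + 2 * \<epsilon> \<le> \<delta>\<^sub>1"
  shows "(\<lambda>N. real N powr (- \<delta>\<^sub>1) * (real N * sqrt (real N) * (real N powr \<epsilon> + K))) \<longlonglongrightarrow> 0"
proof -
  have "(\<lambda>N. real N powr (3 / 2 - \<delta>\<^sub>1 + \<epsilon>) + K * real N powr (3 / 2 - \<delta>\<^sub>1)) \<longlonglongrightarrow> 0 + K * 0"
    using assms by (intro tendsto_intros tendsto_neg_powr filterlim_real_sequentially) auto
  moreover have "\<forall>\<^sub>F N in sequentially. real N powr (3 / 2 - \<delta>\<^sub>1 + \<epsilon>) + K * real N powr (3 / 2 - \<delta>\<^sub>1) =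
      real N powr (- \<delta>\<^sub>1) * (real N * sqrt (real N) * (real N powr \<epsilon> + K))"
    using eventually_gt_at_top[of 0]
  proof eventually_elim
    case (elim N)
    have "real N * sqrt (real N) = real N powr 1 * real N powr (1 / 2)"
      using elim by (simp add: powr_half_sqrt)
    also have "\<dots> = real N powr (1 + 1 / 2)" by (rule powr_add[symmetric])
    also have "\<dots> = real N powr (3 / 2)" by simp
    finally have half: "real N * sqrt (real N) = real N powr (3 / 2)" .
    have e1: "real N powr (3 / 2 - \<delta>\<^sub>1) = real N powr (3 / 2) * real N powr (- \<delta>\<^sub>1)"
      using powr_add[of "real N" "3 / 2" "- \<delta>\<^sub>1"] by simp
    have alg: "x * y * e + K * (x * y) = y * (x * (e + K))" for x y e :: real by (simp add: algebra_simps)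
    show ?case unfolding half powr_add[of "real N" "3 / 2 - \<delta>\<^sub>1" \<epsilon>] e1 by (rule alg)
  qed
  ultimately show ?thesis using Lim_transform_eventually by fastforce
qed

lemma summable_gaussian_tail:
  fixes \<epsilon> :: real
  assumes "\<epsilon> > 0"
  shows "summable (\<lambda>N. (real N)\<^sup>2 * (2 * exp (- (real N powr \<epsilon>)\<^sup>2 / 2)))"
proof (rule summable_comparison_test_ev)
  have "(\<lambda>N. (real N) ^ 4 * (2 * exp (- (real N powr \<epsilon>)\<^sup>2 / 2))) \<longlonglongrightarrow> 0"
    using assms by real_asymp
  then have "\<forall>\<^sub>F N in sequentially. (real N) ^ 4 * (2 * exp (- (real N powr \<epsilon>)\<^sup>2 / 2)) < 1"
    by (rule order_tendstoD(2)) simp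
  then show "\<forall>\<^sub>F N in sequentially. norm ((real N)\<^sup>2 * (2 * exp (- (real N powr \<epsilon>)\<^sup>2 / 2))) \<le> inverse (real N ^ 2)"
    using eventually_gt_at_top[of 0]
  proof eventually_elim
    case (elim N)
    have "(real N) ^ 4 = (real N)\<^sup>2 * (real N)\<^sup>2" by (simp flip: power_add)
    then show ?case using elim by (simp add: field_simps)
  qed
  show "summable (\<lambda>N. inverse (real N ^ 2))" by (rule inverse_power_summable) simp
qed

text \<open>The loss per zero is ln 2 + 3 ln N - ln \<delta>, with - ln \<delta> at most
  N^\<open>\<delta>\<^sub>0\<close>. This is where \<open>\<delta>\<^sub>0\<close> < 1 is
  used.\<close>

lemma tendsto_log_loss:
  fixes c n \<delta>\<^sub>0 :: real
  assumes "0 < \<delta>\<^sub>0" "\<delta>\<^sub>0 < 1"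
  shows "(\<lambda>N. (c + n * (ln 2 + 3 * ln (real N) + real N powr \<delta>\<^sub>0)) / real N) \<longlonglongrightarrow> 0"
proof -
  have "(\<lambda>N. ln (real N) / real N) \<longlonglongrightarrow> 0" "(\<lambda>N. 1 / real N) \<longlonglongrightarrow> 0" by real_asymp+
  moreover have "(\<lambda>N. real N powr \<delta>\<^sub>0 / real N) \<longlonglongrightarrow> 0"
  proof -
    have "(\<lambda>N. real N powr (\<delta>\<^sub>0 - 1)) \<longlonglongrightarrow> 0"
      using assms by (intro tendsto_neg_powr filterlim_real_sequentially) auto
    moreover have "real N powr (\<delta>\<^sub>0 - 1) = real N powr \<delta>\<^sub>0 / real N" for N
      by (cases "N = 0") (auto simp: powr_diff)
    ultimately show ?thesis by simp
  qed
  ultimately have "(\<lambda>N. (c + n * ln 2) * (1 / real N) + 3 * n * (ln (real N) / real N) + n * (real N powr \<delta>\<^sub>0 / real N))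
      \<longlonglongrightarrow> (c + n * ln 2) * 0 + 3 * n * 0 + n * 0"
    by (intro tendsto_intros)
  then show ?thesis by (simp add: add_divide_distrib algebra_simps)
qed

locale perturbed_toeplitz = prob_space M for M :: "'w measure" +
  fixes a :: "int \<Rightarrow> complex" and Q :: "nat \<Rightarrow> 'w \<Rightarrow> complex mat" and \<delta> :: "nat \<Rightarrow> real"
    and \<delta>\<^sub>0 \<delta>\<^sub>1 :: real
  assumes a: "(\<lambda>\<nu>. cmod (a \<nu>)) summable_on UNIV"
    and a': "(\<lambda>\<nu>. \<bar>real_of_int \<nu>\<bar> * cmod (a \<nu>)) summable_on UNIV"
    and gaussian: "\<And>N. N \<ge> 1 \<Longrightarrow> complex_gaussian_matrix M N (Q N)"
    and \<delta>: "\<forall>\<^sub>F N in sequentially. exp (- (real N powr \<delta>\<^sub>0)) \<le> \<delta> N \<and> \<delta> N \<le> real N powr (- \<delta>\<^sub>1)"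
    and \<delta>\<^sub>0: "0 < \<delta>\<^sub>0" "\<delta>\<^sub>0 < 1" and \<delta>\<^sub>1: "\<delta>\<^sub>1 > 3 / 2"
begin

text \<open>Entries are truncated at N^\<epsilon>. Half of the excess of
  \<open>\<delta>\<^sub>1\<close> over 3/2 leaves a factor N^(-\<epsilon>) to spare, and \<epsilon>
  \<le> 1 keeps the truncation level below N, as the translation estimate requires.\<close>

definition \<epsilon> :: real where "\<epsilon> = min 1 ((\<delta>\<^sub>1 - 3 / 2) / 2)"

definition bound :: "nat \<Rightarrow> real" where "bound N = real N powr \<epsilon>"

definition perturbed :: "'w \<Rightarrow> nat \<Rightarrow> complex mat" where
  "perturbed \<omega> N = toeplitz_mat a N + complex_of_real (\<delta> N) \<cdot>\<^sub>m Q N \<omega>"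

lemma \<epsilon>: "0 < \<epsilon>" "\<epsilon> \<le> 1" "3 / 2 + 2 * \<epsilon> \<le> \<delta>\<^sub>1"
proof -
  have "\<epsilon> \<le> (\<delta>\<^sub>1 - 3 / 2) / 2" unfolding \<epsilon>_def by (rule min.cobounded2)
  then have "\<epsilon> * 2 \<le> \<delta>\<^sub>1 - 3 / 2" by (subst (asm) le_divide_eq) simp
  then show "3 / 2 + 2 * \<epsilon> \<le> \<delta>\<^sub>1" by (simp add: algebra_simps)
qed (use \<delta>\<^sub>1 in \<open>auto simp: \<epsilon>_def\<close>)

lemma norms_nonneg: "0 \<le> coeff_norm a" "0 \<le> weighted_norm a"
  by (auto intro!: infsum_nonneg)

lemma gaussian_matrix: "N \<ge> 1 \<Longrightarrow> gaussian_matrix M N (Q N)"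
  using gaussian by (simp add: gaussian_matrix_def gaussian_matrix_axioms_def prob_space_axioms)

lemma Q_carrier: "N \<ge> 1 \<Longrightarrow> \<omega> \<in> space M \<Longrightarrow> Q N \<omega> \<in> carrier_mat N N"
  by (rule gaussian_matrix.Q_carrier[OF gaussian_matrix])

lemma perturbed_carrier: "N \<ge> 1 \<Longrightarrow> \<omega> \<in> space M \<Longrightarrow> perturbed \<omega> N \<in> carrier_mat N N"
  using Q_carrier by (simp add: perturbed_def)

lemma eventually_small:
  assumes "c > 0"
  shows "\<forall>\<^sub>F N in sequentially. \<delta> N * (real N * sqrt (real N) * (bound N + K)) \<le> c"
proof -
  have "\<forall>\<^sub>F N in sequentially. real N powr (- \<delta>\<^sub>1) * (real N * sqrt (real N) * (real N powr \<epsilon> + \<bar>K\<bar>)) < c"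
    using tendsto_perturbation_size[OF \<epsilon>(1,3)] assms by (rule order_tendstoD(2))
  then show ?thesis
    using \<delta>
  proof eventually_elim
    case (elim N)
    have "0 \<le> \<delta> N" using elim exp_gt_zero[of "- (real N powr \<delta>\<^sub>0)"] by linarith
    then have "\<delta> N * (real N * sqrt (real N) * (bound N + K)) \<le> \<delta> N * (real N * sqrt (real N) * (bound N + \<bar>K\<bar>))"
      by (intro mult_left_mono add_left_mono) auto
    also have "\<dots> \<le> real N powr (- \<delta>\<^sub>1) * (real N * sqrt (real N) * (bound N + \<bar>K\<bar>))"
      using elim by (intro mult_right_mono mult_nonneg_nonneg add_nonneg_nonneg) (auto simp: bound_def)
    finally show ?case using elim by (simp add: bound_def)
  qed
qed

lemma eventually_\<delta>: "\<forall>\<^sub>F N in sequentially. 0 < \<delta> N \<and> \<delta> N \<le> 1 \<and> - ln (\<delta> N) \<le> real N powr \<delta>\<^sub>0"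
  using \<delta> eventually_gt_at_top[of 0]
proof eventually_elim
  case (elim N)
  have pos: "0 < \<delta> N" using elim exp_gt_zero[of "- (real N powr \<delta>\<^sub>0)"] by linarith
  have "real N powr (- \<delta>\<^sub>1) \<le> real N powr 0" using elim \<delta>\<^sub>1 by (intro powr_mono) auto
  then have "\<delta> N \<le> 1" using elim by simp
  moreover have "- (real N powr \<delta>\<^sub>0) \<le> ln (\<delta> N)" using elim pos by (simp add: ln_ge_iff)
  ultimately show ?case using pos by simp
qed

lemma bound_le: "N \<ge> 1 \<Longrightarrow> 0 \<le> bound N \<and> bound N \<le> real N"
  using powr_mono[of \<epsilon> 1 "real N"] \<epsilon> by (simp add: bound_def)

text \<open>Borel-Cantelli: the union bound over N^2 entries loses only a polynomial factor against
  the tail exp(- N^(2 \<epsilon>) / 2).\<close>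

lemma AE_eventually_entries_le:
  "AE \<omega> in M. \<forall>\<^sub>F N in sequentially. \<forall>i<N. \<forall>j<N. cmod (Q N \<omega> $$ (i, j)) \<le> bound N"
proof -
  define E where "E N = {\<omega>\<in>space M. \<exists>i<N. \<exists>j<N. bound N < cmod (Q N \<omega> $$ (i, j))}" for N
  have E: "E N \<in> events \<and> prob (E N) \<le> (real N)\<^sup>2 * (2 * exp (- (real N powr \<epsilon>)\<^sup>2 / 2))" for N
  proof (cases "N = 0")
    case True
    then have "E N = {}" by (auto simp: E_def)
    then show ?thesis by simp
  next
    case False
    then have "gaussian_matrix M N (Q N)" by (intro gaussian_matrix) simp
    then interpret g: gaussian_matrix M N "Q N" .
    have "0 \<le> bound N" by (simp add: bound_def)
    from g.prob_entry_large[OF this] show ?thesis unfolding E_def bound_def by blast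
  qed
  have "summable (\<lambda>N. prob (E N))"
    by (rule summable_comparison_test'[OF summable_gaussian_tail[OF \<epsilon>(1)]]) (use E in auto)
  then have "AE \<omega> in M. \<forall>\<^sub>F N in sequentially. \<omega> \<in> space M - E N"
    using E by (intro borel_cantelli_AE1) (auto simp: emeasure_eq_measure)
  then show ?thesis
  proof eventually_elim
    case (elim \<omega>)
    then show ?case
    proof eventually_elim
      case (elim N)
      then have "\<not> (\<exists>i<N. \<exists>j<N. bound N < cmod (Q N \<omega> $$ (i, j)))" by (simp add: E_def)
      then show ?case by (meson not_le)
    qed
  qed
qed

definition circ_shift :: "complex \<Rightarrow> nat \<Rightarrow> complex mat" where
  "circ_shift z N = circulant_mat (\<lambda>l. symbol a (unity_root N l) - z) N"

lemma perturbed_decomposition: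
  assumes "N \<ge> 1" "\<omega> \<in> space M"
  shows "perturbed \<omega> N + (- z) \<cdot>\<^sub>m 1\<^sub>m N = circ_shift z N + (complex_of_real (\<delta> N) \<cdot>\<^sub>m Q N \<omega> + wrap_mat a N)"
proof -
  have N: "N > 0" using assms by simp
  note Q = Q_carrier[OF assms]
  show ?thesis
    unfolding circ_shift_def circulant_mat_shift[OF N] perturbed_def
    using Q carrier_matD[OF Q] carrier_matD[OF toeplitz_mat_carrier, of a N]
      carrier_matD[OF circulant_mat_carrier, of "\<lambda>l. symbol a (unity_root N l)" N]
    by (intro eq_matI) (auto simp: wrap_mat_def)
qed

definition log_det_ratio :: "nat \<Rightarrow> 'w \<Rightarrow> complex \<Rightarrow> real" where
  "log_det_ratio N \<omega> z = (ln (cmod (det (perturbed \<omega> N + (- z) \<cdot>\<^sub>m 1\<^sub>m N))) -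
     ln (\<Prod>l<N. cmod (symbol a (unity_root N l) - z))) / real N"

text \<open>The logarithm of the ratio of determinants is O(1) from above, by the Hadamard bound,
  and at least - O(N^\<open>\<delta>\<^sub>0\<close> + log N) outside events of summable
  probability. The null set of \<omega> depends on z at this stage.\<close>

lemma AE_log_det_ratio_tendsto_0:
  assumes z: "z \<notin> range (\<lambda>\<theta>. symbol a (cis \<theta>))"
  shows "AE \<omega> in M. (\<lambda>N. log_det_ratio N \<omega> z) \<longlonglongrightarrow> 0"
proof -
  let ?K = "weighted_norm a"
  \<comment> \<open>The distance d from z to the curve does not depend on N, and neither do
    \<open>L\<close> and \<open>n\<close> derived from it.\<close>
  obtain d where d: "d > 0" and dist: "\<And>\<theta>. d \<le> cmod (symbol a (cis \<theta>) - z)"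
    using separate_point_closed[OF closed_symbol_curve[OF a a'] z] by (auto simp: dist_norm norm_minus_commute)
  define L where "L = 1 / 16 + 12 * ?K / d"
  define n where "n = nat \<lceil>2 * exp L\<rceil>"
  have n: "2 * exp L \<le> real n" unfolding n_def by (rule real_nat_ceiling_ge)
  have dl: "d \<le> cmod (symbol a (unity_root N l) - z)" for N l
    unfolding unity_root_def by (rule dist)
  have ne: "symbol a (unity_root N l) - z \<noteq> 0" for N l using dl[of N l] d by auto
  have detT: "det (circ_shift z N) = (\<Prod>l<N. symbol a (unity_root N l) - z)" if "N \<ge> 1" for N
    unfolding circ_shift_def using that ne by (intro det_circulant) auto
  have T0: "det (circ_shift z N) \<noteq> 0" if "N \<ge> 1" for N
    unfolding detT[OF that] using ne by (simp add: prod_zero_iff)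
  have le: "cmod (det (circ_shift z N + W)) \<le> cmod (det (circ_shift z N)) * exp (column_norm_sum N W / d)"
    if "N \<ge> 1" "W \<in> carrier_mat N N" for N W
    unfolding circ_shift_def using that dl d by (intro det_circulant_add_le) auto
  have K: "(\<Sum>k<N. \<Sum>j<N. cmod (wrap_mat a N $$ (j, k))) \<le> ?K" if "N \<ge> 1" for N
    using sum_wrap_mat_le[OF _ a a', of N] that by simp
  define thr where "thr N = exp (- 4 * L - 2) / 8 * (\<delta> N / (2 * real N ^ 3)) ^ n" for N
  define good where "good N \<longleftrightarrow> N \<ge> 1 \<and> 0 < \<delta> N \<and> \<delta> N \<le> 1 \<and> - ln (\<delta> N) \<le> real N powr \<delta>\<^sub>0 \<and>
    \<delta> N * (real N * sqrt (real N) * (bound N + ?K)) \<le> d / 16" for N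
  have ev_good: "\<forall>\<^sub>F N in sequentially. good N"
    using eventually_\<delta> eventually_small[OF divide_pos_pos[OF d], of 16 ?K, simplified] eventually_ge_at_top[of 1]
    by eventually_elim (use d in \<open>auto simp: good_def\<close>)
  \<comment> \<open>For the finitely many N that are not \<open>good\<close> the event is declared
    empty, so that the probability bound holds for every N.\<close>
  define bad where "bad N = (if good N then {\<omega>\<in>space M. (\<forall>i<N. \<forall>j<N. cmod (Q N \<omega> $$ (i, j)) \<le> bound N) \<and>
      cmod (det (circ_shift z N + (complex_of_real (\<delta> N) \<cdot>\<^sub>m Q N \<omega> + wrap_mat a N))) <
      cmod (det (circ_shift z N)) * thr N} else {})" for N
  have bad: "bad N \<in> events \<and> prob (bad N) \<le> exp (2 * ?K + ?K\<^sup>2) * real n * inverse (real N ^ 2)" for N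
  proof (cases "good N")
    case False
    then show ?thesis by (simp add: bad_def)
  next
    case True
    then have N: "N \<ge> 1" and small: "\<delta> N * (real N * sqrt (real N) * (bound N + ?K)) / d \<le> 1 / 16"
      using d by (auto simp: good_def field_simps)
    interpret g: gaussian_matrix M N "Q N" by (rule gaussian_matrix[OF N])
    have T: "circ_shift z N \<in> carrier_mat N N" by (simp add: circ_shift_def)
    have \<delta>N: "0 < \<delta> N" "\<delta> N \<le> 1" using True by (auto simp: good_def)
    have b: "0 \<le> bound N" "bound N \<le> real N" using bound_le[OF N] by auto
    have L: "1 / 16 + 12 * ?K / d \<le> L" by (simp add: L_def)
    have bad_N: "bad N = {\<omega>\<in>space M. (\<forall>i<N. \<forall>j<N. cmod (Q N \<omega> $$ (i, j)) \<le> bound N) \<and>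
      cmod (det (circ_shift z N + (complex_of_real (\<delta> N) \<cdot>\<^sub>m Q N \<omega> + wrap_mat a N))) <
      cmod (det (circ_shift z N)) * (exp (- 4 * L - 2) / 8 * (\<delta> N / (2 * real N ^ 3)) ^ n)}"
      unfolding bad_def thr_def using True by (rule if_P)
    note * = g.prob_small_det[where T = "circ_shift z N" and R = "wrap_mat a N" and \<delta> = "\<delta> N" and d = d
        and K = ?K and b = "bound N" and L = L and n = n,
        OF T wrap_mat_carrier T0[OF N] d le[OF N] K[OF N] \<delta>N b small L n, folded bad_N]
    show ?thesis using * unfolding divide_inverse by blast
  qed
  have "summable (\<lambda>N. exp (2 * ?K + ?K\<^sup>2) * real n * inverse (real N ^ 2))"
    by (intro summable_mult inverse_power_summable) simp
  then have "summable (\<lambda>N. prob (bad N))"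
    by (rule summable_comparison_test') (use bad in auto)
  then have "AE \<omega> in M. \<forall>\<^sub>F N in sequentially. \<omega> \<in> space M - bad N"
    using bad by (intro borel_cantelli_AE1) (auto simp: emeasure_eq_measure)
  then show ?thesis
    using AE_eventually_entries_le
  proof eventually_elim
    case (elim \<omega>)
    define c where "c = (1 / 16 + ?K / d) + (4 * L + 2 + ln 8)"
    have c0: "0 \<le> ?K / d" "0 \<le> L" using d norms_nonneg by (auto simp: L_def)
    have "\<forall>\<^sub>F N in sequentially. norm (log_det_ratio N \<omega> z) \<le>
        (c + real n * (ln 2 + 3 * ln (real N) + real N powr \<delta>\<^sub>0)) / real N"
      using elim ev_good
    proof eventually_elim
      case (elim N)
      let ?D = "cmod (det (circ_shift z N))" and ?X = "complex_of_real (\<delta> N) \<cdot>\<^sub>m Q N \<omega> + wrap_mat a N"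
      let ?E = "cmod (det (circ_shift z N + ?X))"
      have \<omega>: "\<omega> \<in> space M" and N: "N \<ge> 1" and \<delta>N: "0 < \<delta> N" "\<delta> N \<le> 1" "- ln (\<delta> N) \<le> real N powr \<delta>\<^sub>0"
        using elim by (auto simp: good_def)
      note Q = Q_carrier[OF N \<omega>]
      have D: "?D > 0" using T0[OF N] by simp
      have thr: "thr N > 0" using \<delta>N N by (simp add: thr_def)
      have low: "?D * thr N \<le> ?E" using elim by (auto simp: bad_def not_less)
      have "column_norm_sum N ?X \<le> \<delta> N * column_norm_sum N (Q N \<omega>) + column_norm_sum N (wrap_mat a N)"
        using column_norm_sum_add_le[of "complex_of_real (\<delta> N) \<cdot>\<^sub>m Q N \<omega>" N "wrap_mat a N"] Q \<delta>N
        by (simp add: column_norm_sum_smult)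
      also have "\<dots> \<le> \<delta> N * (real N * sqrt (real N) * bound N) + ?K"
        using \<delta>N bound_le[OF N] elim K[OF N] column_norm_sum_le_entry_sum[of N "wrap_mat a N"]
        by (intro add_mono mult_left_mono column_norm_sum_le_entry_bound) auto
      also have "\<delta> N * (real N * sqrt (real N) * bound N) \<le> \<delta> N * (real N * sqrt (real N) * (bound N + ?K))"
        using \<delta>N norms_nonneg by (intro mult_left_mono) auto
      also have "\<dots> \<le> d / 16" using elim by (simp add: good_def)
      finally have "column_norm_sum N ?X / d \<le> (d / 16 + ?K) / d" using d by (intro divide_right_mono) auto
      also have "\<dots> = 1 / 16 + ?K / d" using d by (simp add: add_divide_distrib)
      finally have "exp (column_norm_sum N ?X / d) \<le> exp (1 / 16 + ?K / d)" by simp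
      then have "?D * exp (column_norm_sum N ?X / d) \<le> ?D * exp (1 / 16 + ?K / d)"
        using D by (intro mult_left_mono) auto
      then have up: "?E \<le> ?D * exp (1 / 16 + ?K / d)"
        using le[OF N, of ?X] Q by (meson add_carrier_mat order_trans wrap_mat_carrier)
      \<comment> \<open>The determinant is nonzero by the lower bound; at 0 the logarithm would
        return its default value.\<close>
      have E: "?E > 0" using low D thr by (meson less_le_trans mult_pos_pos)
      have "ln ?E \<le> ln (?D * exp (1 / 16 + ?K / d))" using up E by (intro ln_mono) auto
      then have u: "ln ?E - ln ?D \<le> 1 / 16 + ?K / d" using D by (simp add: ln_mult)
      have "ln (?D * thr N) \<le> ln ?E" using low D thr by (intro ln_mono mult_pos_pos) auto
      then have l: "- ln (thr N) \<ge> - (ln ?E - ln ?D)" using D thr by (simp add: ln_mult)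
      have lnthr: "- ln (thr N) = 4 * L + 2 + ln 8 + real n * (ln 2 + 3 * ln (real N) - ln (\<delta> N))"
        using \<delta>N N unfolding thr_def
        by (simp add: ln_mult ln_div ln_realpow algebra_simps)
      have "real n * (ln 2 + 3 * ln (real N) - ln (\<delta> N)) \<le> real n * (ln 2 + 3 * ln (real N) + real N powr \<delta>\<^sub>0)"
        using \<delta>N by (intro mult_left_mono) auto
      then have l': "- ln (thr N) \<le> 4 * L + 2 + ln 8 + real n * (ln 2 + 3 * ln (real N) + real N powr \<delta>\<^sub>0)"
        unfolding lnthr by linarith
      have nn: "0 \<le> real n * (ln 2 + 3 * ln (real N) + real N powr \<delta>\<^sub>0)" using N by simp
      have ln8: "0 \<le> ln (8::real)" by simp
      have "\<bar>ln ?E - ln ?D\<bar> \<le> c + real n * (ln 2 + 3 * ln (real N) + real N powr \<delta>\<^sub>0)"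
        unfolding c_def using u l l' nn c0 ln8 by linarith
      moreover have "log_det_ratio N \<omega> z = (ln ?E - ln ?D) / real N"
        unfolding log_det_ratio_def perturbed_decomposition[OF N \<omega>] detT[OF N] prod_norm ..
      ultimately show ?case using N by (simp add: divide_right_mono)
    qed
    then show ?case
      by (rule Lim_null_comparison) (rule tendsto_log_loss[OF \<delta>\<^sub>0])
  qed
qed

end

section \<open>Exchange of null sets and the limit of the eigenvalue distribution\<close>

context perturbed_toeplitz
begin

text \<open>Joint measurability in \<omega> and z, which the exchange of the two almost everywhere
  quantifiers requires.\<close>

lemma log_det_ratio_measurable:
  assumes N: "N \<ge> 1"
  shows "(\<lambda>x. log_det_ratio N (fst x) (Complex (fst (snd x)) (snd (snd x)))) \<in>
    borel_measurable (M \<Otimes>\<^sub>M square_measure B)"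
proof -
  interpret g: gaussian_matrix M N "Q N" by (rule gaussian_matrix[OF N])
  let ?M = "M \<Otimes>\<^sub>M square_measure B"
  let ?z = "\<lambda>x :: 'w \<times> real \<times> real. Complex (fst (snd x)) (snd (snd x))"
  have "(\<lambda>x. complex_of_real (fst (snd x)) + \<i> * complex_of_real (snd (snd x))) \<in> borel_measurable ?M"
    by measurable
  then have z[measurable]: "?z \<in> borel_measurable ?M"
    by (simp only: Complex_eq)
  have det: "(\<lambda>x. det (perturbed (fst x) N + (- ?z x) \<cdot>\<^sub>m 1\<^sub>m N)) \<in> borel_measurable ?M"
  proof (rule borel_measurable_det)
    fix x assume "x \<in> space ?M"
    then have "fst x \<in> space M" by (auto simp: space_pair_measure)
    from perturbed_carrier[OF N this]
    show "perturbed (fst x) N + (- ?z x) \<cdot>\<^sub>m 1\<^sub>m N \<in> carrier_mat N N" by simp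
  next
    fix i j assume ij: "i < N" "j < N"
    have [measurable]: "(\<lambda>x. Q N (fst x) $$ (i, j)) \<in> borel_measurable ?M"
      by (rule measurable_compose[OF measurable_fst g.Q_entry_measurable[OF ij]])
    have "(\<lambda>x. a (int i - int j) + complex_of_real (\<delta> N) * Q N (fst x) $$ (i, j) + - ?z x * (if i = j then 1 else 0))
        \<in> borel_measurable ?M"
      by measurable
    also have "?this \<longleftrightarrow> (\<lambda>x. (perturbed (fst x) N + (- ?z x) \<cdot>\<^sub>m 1\<^sub>m N) $$ (i, j)) \<in> borel_measurable ?M"
    proof (rule measurable_cong)
      fix x assume "x \<in> space ?M"
      then have "fst x \<in> space M" by (auto simp: space_pair_measure)
      note Q = Q_carrier[OF N this]
      show "a (int i - int j) + complex_of_real (\<delta> N) * Q N (fst x) $$ (i, j) + - ?z x * (if i = j then 1 else 0) =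
        (perturbed (fst x) N + (- ?z x) \<cdot>\<^sub>m 1\<^sub>m N) $$ (i, j)"
        using ij Q carrier_matD[OF Q] by (simp add: perturbed_def toeplitz_mat_def)
    qed
    finally show "(\<lambda>x. (perturbed (fst x) N + (- ?z x) \<cdot>\<^sub>m 1\<^sub>m N) $$ (i, j)) \<in> borel_measurable ?M" .
  qed
  show ?thesis unfolding log_det_ratio_def using det z by measurable
qed

text \<open>Fubini swaps the quantifiers: convergence for almost every \<omega> at each z off the
  curve becomes, for almost every \<omega>, convergence at almost every z of the square.\<close>

lemma AE_AE_log_det_ratio_tendsto_0:
  "AE \<omega> in M. AE z in square_measure B. (\<lambda>N. log_det_ratio N \<omega> (Complex (fst z) (snd z))) \<longlonglongrightarrow> 0"
proof -
  interpret sq: finite_measure "square_measure B" by (rule finite_segment_pair)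
  interpret P: pair_sigma_finite M "square_measure B" ..
  \<comment> \<open>The index is shifted by one because the Gaussian assumption, and with it
    measurability, starts at N = 1.\<close>
  let ?lim = "\<lambda>\<omega> z. (\<lambda>N. log_det_ratio (Suc N) \<omega> (Complex (fst z) (snd z))) \<longlonglongrightarrow> 0"
  have [measurable]: "(\<lambda>x. log_det_ratio (Suc N) (fst x) (Complex (fst (snd x)) (snd (snd x)))) \<in>
    borel_measurable (M \<Otimes>\<^sub>M square_measure B)" for N
    by (rule log_det_ratio_measurable) simp
  \<comment> \<open>Convergence is rewritten with countable quantifiers, which makes the set visibly
    measurable.\<close>
  have "{x \<in> space (M \<Otimes>\<^sub>M square_measure B). ?lim (fst x) (snd x)} =
      {x \<in> space (M \<Otimes>\<^sub>M square_measure B). \<forall>k. \<exists>n0. \<forall>n\<ge>n0.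
        \<bar>log_det_ratio (Suc n) (fst x) (Complex (fst (snd x)) (snd (snd x)))\<bar> < inverse (real (Suc k))}"
  proof -
    have "f \<longlonglongrightarrow> 0 \<longleftrightarrow> (\<forall>k. \<exists>n0. \<forall>n\<ge>n0. \<bar>f n\<bar> < inverse (real (Suc k)))" for f :: "nat \<Rightarrow> real"
    proof
      assume "f \<longlonglongrightarrow> 0"
      then have "\<exists>n0. \<forall>n\<ge>n0. norm (f n - 0) < inverse (real (Suc k))" for k
        using LIMSEQ_D[of f 0 "inverse (real (Suc k))"] by simp
      then show "\<forall>k. \<exists>n0. \<forall>n\<ge>n0. \<bar>f n\<bar> < inverse (real (Suc k))" by simp
    next
      assume R: "\<forall>k. \<exists>n0. \<forall>n\<ge>n0. \<bar>f n\<bar> < inverse (real (Suc k))"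
      show "f \<longlonglongrightarrow> 0"
      proof (rule LIMSEQ_I)
        fix r :: real assume "0 < r"
        then obtain k where k: "inverse (real (Suc k)) < r" using reals_Archimedean by blast
        from R obtain n0 where "\<forall>n\<ge>n0. \<bar>f n\<bar> < inverse (real (Suc k))" by blast
        then show "\<exists>no. \<forall>n\<ge>no. norm (f n - 0) < r" using k by (intro exI[of _ n0]) force
      qed
    qed
    then show ?thesis by simp
  qed
  also have "\<dots> \<in> sets (M \<Otimes>\<^sub>M square_measure B)" by measurable
  finally have meas: "{x \<in> space (M \<Otimes>\<^sub>M square_measure B). ?lim (fst x) (snd x)} \<in> sets (M \<Otimes>\<^sub>M square_measure B)" .
  have "AE z in square_measure B. AE \<omega> in M. ?lim \<omega> z"
    using AE_not_on_symbol_curve[OF a a', of B]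
  proof eventually_elim
    case (elim z)
    from AE_log_det_ratio_tendsto_0[OF elim] show ?case
      by eventually_elim (rule LIMSEQ_Suc)
  qed
  then have "AE \<omega> in M. AE z in square_measure B. ?lim \<omega> z"
    using P.AE_commute[OF meas] by simp
  then show ?thesis
  proof eventually_elim
    case (elim \<omega>)
    then show ?case by eventually_elim (rule LIMSEQ_imp_Suc)
  qed
qed

text \<open>The order is arbitrary and carries no measurability in \<omega>; whatever has to be
  measurable is expressed by determinants.\<close>

definition eigenvalues :: "'w \<Rightarrow> nat \<Rightarrow> complex list" where
  "eigenvalues \<omega> N = (SOME es. char_poly (perturbed \<omega> N) = (\<Prod>e\<leftarrow>es. [:- e, 1:]) \<and> length es = N)"

lemma eigenvalues:
  assumes "N \<ge> 1" "\<omega> \<in> space M"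
  shows "char_poly (perturbed \<omega> N) = (\<Prod>e\<leftarrow>eigenvalues \<omega> N. [:- e, 1:])" "length (eigenvalues \<omega> N) = N"
  using someI_ex[OF char_poly_factorized[OF perturbed_carrier[OF assms]]] by (auto simp: eigenvalues_def)

text \<open>Away from the eigenvalues and the curve no logarithm is evaluated at 0, so sums of
  logarithms are logarithms of the two determinants.\<close>

lemma potential_difference_eq_log_det_ratio:
  assumes N: "N \<ge> 1" and \<omega>: "\<omega> \<in> space M"
    and z: "\<And>i. i < N \<Longrightarrow> z \<noteq> eigenvalues \<omega> N ! i" "z \<notin> range (\<lambda>\<theta>. symbol a (cis \<theta>))"
  shows "potential_difference (\<lambda>i. eigenvalues \<omega> N ! i) (\<lambda>l. symbol a (unity_root N l)) N (Re z, Im z) = log_det_ratio N \<omega> z"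
proof -
  have k: "log_kernel (Re z - Re p) (Im z - Im p) = ln (cmod (z - p))" for p
    by (simp add: ln_cmod_eq_log_kernel)
  have ne: "symbol a (unity_root N l) - z \<noteq> 0" for l using z(2) by (auto simp: unity_root_def)
  have "(\<Sum>i<N. ln (cmod (z - eigenvalues \<omega> N ! i))) = ln (\<Prod>i<N. cmod (z - eigenvalues \<omega> N ! i))"
    using z(1) by (intro ln_prod[symmetric]) auto
  also have "(\<Prod>i<N. cmod (z - eigenvalues \<omega> N ! i)) = cmod (det (perturbed \<omega> N + (- z) \<cdot>\<^sub>m 1\<^sub>m N))"
    by (rule cmod_det_shift_eq_prod[OF perturbed_carrier[OF N \<omega>] eigenvalues[OF N \<omega>], symmetric])
  finally have p: "(\<Sum>i<N. ln (cmod (z - eigenvalues \<omega> N ! i))) = ln (cmod (det (perturbed \<omega> N + (- z) \<cdot>\<^sub>m 1\<^sub>m N)))" .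
  have "(\<Sum>l<N. ln (cmod (z - symbol a (unity_root N l)))) = (\<Sum>l<N. ln (cmod (symbol a (unity_root N l) - z)))"
    by (simp add: norm_minus_commute)
  also have "\<dots> = ln (\<Prod>l<N. cmod (symbol a (unity_root N l) - z))"
    using ne by (intro ln_prod[symmetric]) auto
  finally have q: "(\<Sum>l<N. ln (cmod (z - symbol a (unity_root N l)))) = ln (\<Prod>l<N. cmod (symbol a (unity_root N l) - z))" .
  show ?thesis
    unfolding potential_difference_def log_det_ratio_def fst_conv snd_conv k sum_subtractf p q ..
qed

lemma eventually_cmod_eigenvalues_le:
  assumes \<omega>: "\<omega> \<in> space M"
    and Q: "\<forall>\<^sub>F N in sequentially. \<forall>i<N. \<forall>j<N. cmod (Q N \<omega> $$ (i, j)) \<le> bound N"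
  shows "\<forall>\<^sub>F N in sequentially. \<forall>i<N. cmod (eigenvalues \<omega> N ! i) \<le> coeff_norm a + 1"
  using Q eventually_\<delta> eventually_small[of 1 0, simplified] eventually_ge_at_top[of 1]
proof eventually_elim
  case (elim N)
  then have N: "N \<ge> 1" by simp
  note C = Q_carrier[OF N \<omega>]
  show ?case
  proof (intro allI impI)
    fix i assume i: "i < N"
    show "cmod (eigenvalues \<omega> N ! i) \<le> coeff_norm a + 1"
    proof (rule cmod_eigenvalue_le_row_sum[OF perturbed_carrier[OF N \<omega>] eigenvalues[OF N \<omega>] i])
      fix j assume j: "j < N"
      have "(\<Sum>k<N. cmod (perturbed \<omega> N $$ (j, k))) \<le> (\<Sum>k<N. cmod (a (int j - int k)) + \<delta> N * bound N)"
      proof (rule sum_mono)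
        fix k assume "k \<in> {..<N}"
        then have k: "k < N" by simp
        have "cmod (perturbed \<omega> N $$ (j, k)) = cmod (a (int j - int k) + complex_of_real (\<delta> N) * Q N \<omega> $$ (j, k))"
          using j k C carrier_matD[OF C] by (simp add: perturbed_def toeplitz_mat_def)
        also have "\<dots> \<le> cmod (a (int j - int k)) + \<delta> N * cmod (Q N \<omega> $$ (j, k))"
          using elim by (intro order_trans[OF norm_triangle_ineq]) (simp add: norm_mult)
        also have "\<dots> \<le> cmod (a (int j - int k)) + \<delta> N * bound N"
          using elim j k by (intro add_left_mono mult_left_mono) auto
        finally show "cmod (perturbed \<omega> N $$ (j, k)) \<le> cmod (a (int j - int k)) + \<delta> N * bound N" .
      qed
      also have "\<dots> = (\<Sum>k<N. cmod (a (int j - int k))) + \<delta> N * (real N * 1 * bound N)"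
        by (simp add: sum.distrib)
      \<comment> \<open>The row sum of the noise is estimated crudely through N \<le> N^(3/2), which
        brings it under the smallness of \<delta> N^(3/2) N^\<epsilon>.\<close>
      also have "\<dots> \<le> coeff_norm a + \<delta> N * (real N * sqrt (real N) * bound N)"
      proof (intro add_mono mult_left_mono mult_right_mono)
        show "(\<Sum>k<N. cmod (a (int j - int k))) \<le> coeff_norm a"
          by (rule summable_on_reindexed_sum_le[OF a]) simp
      qed (use elim bound_le[OF N] N in auto)
      also have "\<dots> \<le> coeff_norm a + 1" using elim by simp
      finally show "(\<Sum>k<N. cmod (perturbed \<omega> N $$ (j, k))) \<le> coeff_norm a + 1" .
    qed
  qed
qed

theorem AE_weakly_converges:
  "AE \<omega> in M. weakly_converges (\<lambda>N. empirical_measure (perturbed \<omega> N))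
     (distr (scale_measure (ennreal (1 / (2 * pi))) circle_measure) borel (symbol a))"
proof -
  define B\<^sub>0 where "B\<^sub>0 = coeff_norm a + 1"
  \<comment> \<open>The square has to exceed the disc containing both point families, since the test
    functions vanish on its boundary but must approximate f on the disc.\<close>
  define B where "B = B\<^sub>0 + 1"
  show ?thesis
    using AE_space AE_eventually_entries_le AE_AE_log_det_ratio_tendsto_0[of B]
  proof eventually_elim
    case (elim \<omega>)
    then have \<omega>: "\<omega> \<in> space M" by simp
    define p where "p N i = eigenvalues \<omega> N ! i" for N i
    define q where "q N l = symbol a (unity_root N l)" for N l
    have q_le: "cmod (q N l) \<le> B\<^sub>0" for N l
      using cmod_symbol_le[OF a a' cmod_unity_root[of N l]] by (simp add: q_def B\<^sub>0_def)
    \<comment> \<open>For fixed \<omega> the eigenvalues for all N form a countable set, so almost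
      every z avoids all of them at once.\<close>
    have "AE z in square_measure B. \<forall>N i. z \<noteq> (Re (p N i), Im (p N i))"
    proof (subst AE_all_countable, intro allI, subst AE_all_countable, intro allI)
      fix N i
      show "AE z in square_measure B. z \<noteq> (Re (p N i), Im (p N i))"
        using AE_segment_pair[of B "Re (p N i)" 0] by eventually_elim auto
    qed
    then have lim: "AE z in square_measure B. (\<lambda>N. potential_difference (p N) (q N) N z) \<longlonglongrightarrow> 0"
      using AE_not_on_symbol_curve[OF a a', of B] elim(3)
    proof eventually_elim
      case (elim z)
      have "\<forall>\<^sub>F N in sequentially. log_det_ratio N \<omega> (Complex (fst z) (snd z)) = potential_difference (p N) (q N) N z"
        using eventually_ge_at_top[of 1]
      proof eventually_elim
        case N: (elim N)
        have "Complex (fst z) (snd z) \<noteq> eigenvalues \<omega> N ! i" for i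
          using elim(1) by (auto simp: p_def prod_eq_iff complex_eq_iff)
        then show ?case
          using potential_difference_eq_log_det_ratio[OF N \<omega> _ elim(2)] by (simp add: p_def[abs_def] q_def[abs_def])
      qed
      with elim(3) show ?case by (rule Lim_transform_eventually)
    qed
    have pq: "\<forall>\<^sub>F N in sequentially. \<forall>i<N. cmod (p N i) \<le> B\<^sub>0 \<and> cmod (q N i) \<le> B\<^sub>0"
      using eventually_cmod_eigenvalues_le[OF \<omega> elim(2)]
      by eventually_elim (simp add: p_def B\<^sub>0_def[symmetric] q_le)
    show ?case
      unfolding weakly_converges_def
    proof (intro allI impI)
      fix f :: "complex \<Rightarrow> real" assume f: "continuous_on UNIV f" and bd: "bounded (range f)"
      have fm: "f \<in> borel_measurable borel" using f by (rule borel_measurable_continuous_onI)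
      obtain K where K: "\<And>x. \<bar>f x\<bar> \<le> K" using bd by (auto simp: bounded_iff)
      have 1: "(\<lambda>N. (\<Sum>i<N. f (p N i) - f (q N i)) / real N) \<longlonglongrightarrow> 0"
        by (rule replacement_principle[OF pq _ lim f]) (simp add: B_def)
      have "continuous_on UNIV (\<lambda>\<theta>. f (symbol a (cis \<theta>)))"
        by (rule continuous_on_compose2[OF f continuous_symbol_cis[OF a a']]) simp
      from riemann_sum_tendsto[where T = "2 * pi", OF _ this K]
      have 2: "(\<lambda>N. (\<Sum>l<N. f (q N l)) / real N) \<longlonglongrightarrow>
          (\<integral>\<theta>. indicator {0..<2 * pi} \<theta> *\<^sub>R f (symbol a (cis \<theta>)) \<partial>lborel) / (2 * pi)"
        by (simp add: q_def unity_root_def)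
      have "(\<lambda>N. (\<Sum>i<N. f (p N i)) / real N) \<longlonglongrightarrow>
          (\<integral>\<theta>. indicator {0..<2 * pi} \<theta> *\<^sub>R f (symbol a (cis \<theta>)) \<partial>lborel) / (2 * pi)"
        using tendsto_add[OF 1 2] by (simp add: sum_subtractf diff_divide_distrib)
      moreover have "\<forall>\<^sub>F N in sequentially. (\<Sum>i<N. f (p N i)) / real N = (\<integral>x. f x \<partial>empirical_measure (perturbed \<omega> N))"
        using eventually_ge_at_top[of 1]
      proof eventually_elim
        case N: (elim N)
        show ?case
          using integral_empirical_measure[OF perturbed_carrier[OF N \<omega>] eigenvalues[OF N \<omega>] fm] by (simp add: p_def)
      qed
      ultimately show "(\<lambda>N. \<integral>x. f x \<partial>empirical_measure (perturbed \<omega> N)) \<longlonglongrightarrow>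
          (\<integral>x. f x \<partial>distr (scale_measure (ennreal (1 / (2 * pi))) circle_measure) borel (symbol a))"
        unfolding integral_limit_measure[OF a a' f] by (rule Lim_transform_eventually)
    qed
  qed
qed

end

theorem theorem1p2:
  fixes a :: "int \<Rightarrow> complex" and m :: "int \<Rightarrow> real" and C \<delta>\<^sub>0 \<delta>\<^sub>1 :: real
  assumes "\<And>\<nu>. m \<nu> > 0"
    and "\<And>\<nu>. m (- \<nu>) = m \<nu>"
    and "(\<lambda>\<nu>. (1 + \<bar>real_of_int \<nu>\<bar>) * m \<nu>) summable_on UNIV"
    and "C > 0"
    and "\<And>\<nu>. cmod (a \<nu>) \<le> C * m \<nu>"
    and "0 < \<delta>\<^sub>0" and "\<delta>\<^sub>0 < 1" and "\<delta>\<^sub>1 > 3 / 2"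
  shows "\<exists>c>0. \<forall>(M :: 'w measure) (Q :: nat \<Rightarrow> 'w \<Rightarrow> complex mat) (\<delta> :: nat \<Rightarrow> real).
    prob_space M \<longrightarrow>
    (\<forall>N\<ge>1. complex_gaussian_matrix M N (Q N)) \<longrightarrow>
    (\<forall>\<^sub>F N in sequentially.
       exp (- (real N powr \<delta>\<^sub>0)) \<le> \<delta> N \<and> \<delta> N \<le> c * real N powr (- \<delta>\<^sub>1)) \<longrightarrow>
    (AE \<omega> in M. weakly_converges
       (\<lambda>N. empirical_measure (toeplitz_mat a N + complex_of_real (\<delta> N) \<cdot>\<^sub>m Q N \<omega>))
       (distr (scale_measure (ennreal (1 / (2 * pi))) circle_measure) borel (symbol a)))"
\<comment> \<open>The witness 1 works because \<open>\<delta>\<^sub>1\<close> > 3/2 leaves a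
  negative power of N to make the column norm sum of the noise tend to 0.\<close>
proof (intro exI[of _ 1] conjI allI impI)
  fix M :: "'w measure" and Q :: "nat \<Rightarrow> 'w \<Rightarrow> complex mat" and \<delta> :: "nat \<Rightarrow> real"
  assume M: "prob_space M" and Q: "\<forall>N\<ge>1. complex_gaussian_matrix M N (Q N)"
    and \<delta>: "\<forall>\<^sub>F N in sequentially. exp (- (real N powr \<delta>\<^sub>0)) \<le> \<delta> N \<and> \<delta> N \<le> 1 * real N powr (- \<delta>\<^sub>1)"
  have Cm: "(\<lambda>\<nu>. C * ((1 + \<bar>real_of_int \<nu>\<bar>) * m \<nu>)) summable_on UNIV"
    using assms(3) by (rule summable_on_cmult_right)
  have "cmod (a \<nu>) \<le> C * ((1 + \<bar>real_of_int \<nu>\<bar>) * m \<nu>)" for \<nu>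
  proof -
    have "1 * m \<nu> \<le> (1 + \<bar>real_of_int \<nu>\<bar>) * m \<nu>" using assms(1)[of \<nu>] by (intro mult_right_mono) auto
    then have "C * m \<nu> \<le> C * ((1 + \<bar>real_of_int \<nu>\<bar>) * m \<nu>)" using assms(4) by (intro mult_left_mono) auto
    then show ?thesis using assms(5)[of \<nu>] by linarith
  qed
  then have a: "(\<lambda>\<nu>. cmod (a \<nu>)) summable_on UNIV"
    by (intro summable_on_comparison_test[OF Cm]) auto
  have "\<bar>real_of_int \<nu>\<bar> * cmod (a \<nu>) \<le> C * ((1 + \<bar>real_of_int \<nu>\<bar>) * m \<nu>)" for \<nu>
  proof -
    have "\<bar>real_of_int \<nu>\<bar> * cmod (a \<nu>) \<le> (1 + \<bar>real_of_int \<nu>\<bar>) * (C * m \<nu>)"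
      using assms(5)[of \<nu>] by (intro mult_mono) auto
    then show ?thesis by (simp add: mult_ac)
  qed
  then have a': "(\<lambda>\<nu>. \<bar>real_of_int \<nu>\<bar> * cmod (a \<nu>)) summable_on UNIV"
    by (intro summable_on_comparison_test[OF Cm]) auto
  interpret prob_space M by (rule M)
  interpret perturbed_toeplitz M a Q \<delta> \<delta>\<^sub>0 \<delta>\<^sub>1
    by standard (use a a' Q \<delta> assms in auto)
  show "AE \<omega> in M. weakly_converges
       (\<lambda>N. empirical_measure (toeplitz_mat a N + complex_of_real (\<delta> N) \<cdot>\<^sub>m Q N \<omega>))
       (distr (scale_measure (ennreal (1 / (2 * pi))) circle_measure) borel (symbol a))"
    using AE_weakly_converges by (simp only: perturbed_def)
qed simp

end
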